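(* Let $\varphi\colon\mathbb{D}\to\mathbb{D}$ be any analytic map. If $$\lim_{|\varphi(a)|\to 1}\|\sigma_{\varphi(a)}\circ\varphi\circ\sigma_a\|_{H^2}=0, \qquad (\mathrm{L})$$ then for all $0<R<1$, $$\lim_{t\to1^-}\ \sup_{\{a\in\mathbb{D}:\,|\varphi(a)|\le R\}} \bigl|\{\zeta\in\mathbb{T}: |(\varphi\circ\sigma_a)(\zeta)|>t\}\bigr|=0.$$ Hence $C_\varphi\colon\mathit{BMOA}\to\mathit{BMOA}$ is compact if and only if (L) holds.
   Context: $\mathbb{D}$ is the open unit disc, $\mathbb{T}$ the unit circle, $|E|$ the normalized Lebesgue measure of $E\subset\mathbb{T}$ (so $|\mathbb{T}|=1$), $\|\cdot\|_{H^2}$ the standard Hardy space norm, and $\sigma_a(z)=(a-z)/(1-\bar a z)$ for $a\in\mathbb{D}$. For an analytic self-map $\psi$ of $\mathbb{D}$, $\psi(\zeta)$ for a.e. $\zeta\in\mathbb{T}$ denotes the radial limit. $\mathit{BMOA}$ is the Banach space of analytic $f\colon\mathbb{D}\to\mathbb{C}$ with $|f|_*=\sup_{a\in\mathbb{D}}\|f\circ\sigma_a-f(a)\|_{H^2}<\infty$, normed by $\|f\|_*=|f(0)|+|f|_*$. $C_\varphi f=f\circ\varphi$; it is always bounded on $\mathit{BMOA}$. A statement $\lim_{|\varphi(a)|\to1}F(a)=0$ means: for every $\varepsilon>0$ there is $\eta<1$ such that $|F(a)|<\varepsilon$ for all $a\in\mathbb{D}$ with $|\varphi(a)|>\eta$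 (vacuously true if $\sup_{\mathbb{D}}|\varphi|<1$). A supremum over the empty set is taken to be $0$. *)

theory Defs
  imports "HOL-Complex_Analysis.Complex_Analysis" "HOL-Probability.Probability"
begin

abbreviation unit_disc :: "complex set" where
  "unit_disc \<equiv> ball 0 1"

abbreviation unit_circle :: "complex set" where
  "unit_circle \<equiv> sphere 0 1"

definition disc_involution :: "complex \<Rightarrow> complex \<Rightarrow> complex" ("\<sigma>") where
  "\<sigma> a z = (a - z) / (1 - cnj a * z)"

text \<open>Normalized (completed) Lebesgue measure on the unit circle.\<close>

definition circle_borel :: "complex measure" where
  "circle_borel =
     distr (uniform_measure lborel {0..2 * pi}) (restrict_space borel unit_circle) cis"

definition circle_lebesgue :: "complex measure" where
  "circle_lebesgue = completion circle_borel"

text \<open>The value is \<open>\<infinity>\<close> for analytic functions outside of the Hardy space.\<close>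

definition h2_norm :: "(complex \<Rightarrow> complex) \<Rightarrow> ennreal" where
  "h2_norm f =
     (SUP r\<in>{0<..<1}. ennreal (sqrt (LINT \<zeta>|circle_lebesgue. (cmod (f (of_real r * \<zeta>)))\<^sup>2)))"

text \<open>
  At the points where the limit does not exist, the value is an unspecified constant; for
  bounded analytic functions on the disc these points form a Borel null set.
\<close>

definition radial_limit :: "(complex \<Rightarrow> complex) \<Rightarrow> complex \<Rightarrow> complex" where
  "radial_limit f \<zeta> = Lim (at_left (1::real)) (\<lambda>r. f (of_real r * \<zeta>))"

definition bmoa_seminorm :: "(complex \<Rightarrow> complex) \<Rightarrow> ennreal" where
  "bmoa_seminorm f = (SUP a\<in>unit_disc. h2_norm (\<lambda>z. f (\<sigma> a z) - f a))"

text \<open>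
  Functions on the disc are represented by total functions that are \<open>undefined\<close> off the disc,
  so that two elements of \<open>BMOA\<close> are equal iff they agree on the disc.
\<close>

definition BMOA :: "(complex \<Rightarrow> complex) set" where
  "BMOA = {f \<in> extensional unit_disc. f holomorphic_on unit_disc \<and> bmoa_seminorm f < \<infinity>}"

definition bmoa_norm :: "(complex \<Rightarrow> complex) \<Rightarrow> real" where
  "bmoa_norm f = cmod (f 0) + enn2real (bmoa_seminorm f)"

definition bmoa_dist :: "(complex \<Rightarrow> complex) \<Rightarrow> (complex \<Rightarrow> complex) \<Rightarrow> real" where
  "bmoa_dist f g = bmoa_norm (\<lambda>z. f z - g z)"

definition composition_operator ::
    "(complex \<Rightarrow> complex) \<Rightarrow> (complex \<Rightarrow> complex) \<Rightarrow> (complex \<Rightarrow> complex)" where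
  "composition_operator \<phi> f = restrict (f \<circ> \<phi>) unit_disc"

text \<open>For a linear operator on a normed space, given by its carrier and the metric of its norm.\<close>

definition compact_operator :: "'a set \<Rightarrow> ('a \<Rightarrow> 'a \<Rightarrow> real) \<Rightarrow> ('a \<Rightarrow> 'a) \<Rightarrow> bool" where
  "compact_operator M d T \<longleftrightarrow>
     T ` M \<subseteq> M \<and>
     (\<forall>S. Metric_space.mbounded M d S \<longrightarrow>
        compactin (Metric_space.mtopology M d) ((Metric_space.mtopology M d) closure_of (T ` S)))"

text \<open>\<open>F(a) \<rightarrow> 0\<close> as \<open>|\<phi>(a)| \<rightarrow> 1\<close>; vacuously true if \<open>|\<phi>|\<close> is bounded away from 1.\<close>

definition vanishes_as_modulus_tends_to_1 ::
    "(complex \<Rightarrow> complex) \<Rightarrow> (complex \<Rightarrow> ennreal) \<Rightarrow> bool" where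
  "vanishes_as_modulus_tends_to_1 \<phi> F \<longleftrightarrow>
     (\<forall>\<epsilon>::real. \<epsilon> > 0 \<longrightarrow>
        (\<exists>\<eta><1. \<forall>a\<in>unit_disc. cmod (\<phi> a) > \<eta> \<longrightarrow> F a < ennreal \<epsilon>))"

definition condition_L :: "(complex \<Rightarrow> complex) \<Rightarrow> bool" where
  "condition_L \<phi> \<longleftrightarrow>
     vanishes_as_modulus_tends_to_1 \<phi> (\<lambda>a. h2_norm (\<sigma> (\<phi> a) \<circ> \<phi> \<circ> \<sigma> a))"

subsection \<open>The metric of \<open>BMOA\<close>\<close>

lemma sets_circle_borel: "sets circle_borel = sets (restrict_space borel unit_circle)"
  by (simp add: circle_borel_def)

lemma space_circle_borel: "space circle_borel = unit_circle"
  by (simp add: circle_borel_def space_restrict_space)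

lemma cis_measurable: "cis \<in> lborel \<rightarrow>\<^sub>M restrict_space borel unit_circle"
  by (rule measurable_restrict_space2) (auto intro!: borel_measurable_continuous_onI continuous_intros)

lemma circle_borel_prob: "prob_space circle_borel"
proof -
  have "prob_space (uniform_measure lborel {0..2 * pi})"
    by (rule prob_space_uniform_measure) auto
  then show ?thesis
    unfolding circle_borel_def
    by (rule prob_space.prob_space_distr) (use cis_measurable in simp)
qed

lemma continuous_circle_measurable:
  fixes F :: "complex \<Rightarrow> 'b::{second_countable_topology, banach}"
  assumes "continuous_on unit_circle F"
  shows "F \<in> circle_borel \<rightarrow>\<^sub>M borel"
  using borel_measurable_continuous_on_restrict[OF assms]
  by (simp add: measurable_cong_sets[OF sets_circle_borel refl])

lemma continuous_circle_integrable:
  fixes F :: "complex \<Rightarrow> 'b::{second_countable_topology, banach}"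
  assumes "continuous_on unit_circle F"
  shows "integrable circle_lebesgue F"
proof -
  interpret prob_space circle_borel by (rule circle_borel_prob)
  obtain B where B: "\<And>x. x \<in> unit_circle \<Longrightarrow> norm (F x) \<le> B"
    using compact_continuous_image[OF assms compact_sphere, THEN compact_imp_bounded]
    unfolding bounded_iff by blast
  have "integrable circle_borel F"
    by (rule integrable_const_bound[of _ B])
       (auto intro!: AE_I2 B continuous_circle_measurable assms
             simp: space_circle_borel)
  then show ?thesis
    unfolding circle_lebesgue_def
    using integrable_completion[OF continuous_circle_measurable[OF assms]] by simp
qed

lemma integral_circle_lebesgue:
  fixes F :: "complex \<Rightarrow> real"
  assumes "continuous_on unit_circle F"
  shows "(LINT \<zeta>|circle_lebesgue. F \<zeta>) = integral {0..2 * pi} (\<lambda>t. F (cis t)) / (2 * pi)"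
proof -
  let ?g = "\<lambda>t. F (cis t)"
  have cont: "continuous_on UNIV ?g"
    by (rule continuous_on_compose2[OF assms]) (auto intro!: continuous_intros)
  then have meas: "?g \<in> borel_measurable lborel"
    by (simp add: borel_measurable_continuous_onI)
  have U: "uniform_measure lborel {0..2 * pi} =
      density lborel (\<lambda>t. ennreal (indicator {0..2 * pi} t / (2 * pi)))"
    unfolding uniform_measure_def
    by (intro arg_cong2[where f = density] refl ext)
       (auto simp: indicator_def divide_ennreal simp flip: ennreal_1)
  have "(LINT \<zeta>|circle_lebesgue. F \<zeta>) = (LINT \<zeta>|circle_borel. F \<zeta>)"
    unfolding circle_lebesgue_def
    by (rule integral_completion) (rule continuous_circle_measurable[OF assms])
  also have "\<dots> = (LINT t|uniform_measure lborel {0..2 * pi}. ?g t)"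
    unfolding circle_borel_def
    by (rule integral_distr)
       (use cis_measurable borel_measurable_continuous_on_restrict[OF assms] in simp_all)
  also have "\<dots> = (LINT t|lborel. (indicator {0..2 * pi} t / (2 * pi)) *\<^sub>R ?g t)"
    unfolding U by (rule integral_density) (use meas in auto)
  also have "\<dots> = (LINT t|lborel. (indicator {0..2 * pi} t *\<^sub>R ?g t) / (2 * pi))"
    by (intro Bochner_Integration.integral_cong) auto
  also have "\<dots> = (LINT t:{0..2 * pi}|lborel. ?g t) / (2 * pi)"
    unfolding set_lebesgue_integral_def by simp
  also have "(LINT t:{0..2 * pi}|lborel. ?g t) = integral {0..2 * pi} ?g"
    by (rule set_borel_integral_eq_integral)
       (intro borel_integrable_atLeastAtMost' continuous_on_subset[OF cont] subset_UNIV)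
  finally show ?thesis .
qed

lemma circle_L2_triangle:
  fixes f g :: "complex \<Rightarrow> complex"
  assumes f: "continuous_on unit_circle f" and g: "continuous_on unit_circle g"
  shows "sqrt (LINT x|circle_lebesgue. (cmod (f x + g x))\<^sup>2) \<le>
    sqrt (LINT x|circle_lebesgue. (cmod (f x))\<^sup>2) + sqrt (LINT x|circle_lebesgue. (cmod (g x))\<^sup>2)"
proof -
  let ?I = "\<lambda>h. LINT x|circle_lebesgue. (cmod (h x))\<^sup>2"
  define A B where "A = sqrt (?I f)" and "B = sqrt (?I g)"
  have int: "integrable circle_lebesgue (\<lambda>x. (cmod (h x))\<^sup>2)" if "continuous_on unit_circle h" for h
    by (rule continuous_circle_integrable) (intro continuous_intros that)
  have A0: "0 \<le> A" "A\<^sup>2 = ?I f" and B0: "0 \<le> B" "B\<^sup>2 = ?I g"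
    by (auto simp: A_def B_def)
  have "sqrt (?I (\<lambda>x. f x + g x)) \<le> (A + B) + e" if e: "e > 0" for e
  proof -
    define a b where "a = A + e/2" and "b = B + e/2"
    have ab: "a > 0" "b > 0" using A0 B0 e by (auto simp: a_def b_def)
    have pt: "(u + v)\<^sup>2 \<le> (1 + b/a) * u\<^sup>2 + (1 + a/b) * v\<^sup>2" for u v :: real
    proof -
      have "0 \<le> (b * u - a * v)\<^sup>2 / (a * b)" using ab by simp
      also have "\<dots> = (1 + b/a) * u\<^sup>2 + (1 + a/b) * v\<^sup>2 - (u + v)\<^sup>2"
        using ab by (simp add: field_simps power2_eq_square)
      finally show ?thesis by simp
    qed
    have "?I (\<lambda>x. f x + g x) \<le>
        (LINT x|circle_lebesgue. (1 + b/a) * (cmod (f x))\<^sup>2 + (1 + a/b) * (cmod (g x))\<^sup>2)"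
    proof (rule integral_mono)
      show "(cmod (f x + g x))\<^sup>2 \<le> (1 + b/a) * (cmod (f x))\<^sup>2 + (1 + a/b) * (cmod (g x))\<^sup>2" for x
        by (rule order_trans[OF power_mono[OF norm_triangle_ineq] pt]) simp
    qed (use f g in \<open>auto intro!: int continuous_intros\<close>)
    also have "\<dots> = (1 + b/a) * A\<^sup>2 + (1 + a/b) * B\<^sup>2"
      using int[OF f] int[OF g] by (simp add: A0 B0)
    also have "\<dots> \<le> (1 + b/a) * a\<^sup>2 + (1 + a/b) * b\<^sup>2"
      using ab A0 B0 e by (intro add_mono mult_left_mono power_mono) (auto simp: a_def b_def)
    also have "\<dots> = (a + b)\<^sup>2"
      using ab by (simp add: field_simps power2_eq_square)
    finally have "sqrt (?I (\<lambda>x. f x + g x)) \<le> a + b"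
      using ab by (intro real_le_lsqrt) auto
    then show ?thesis by (simp add: a_def b_def)
  qed
  then show ?thesis unfolding A_def B_def by (rule field_le_epsilon)
qed

lemma continuous_circle_dilation:
  assumes "continuous_on unit_disc f" "r \<in> {0<..<1}"
  shows "continuous_on unit_circle (\<lambda>\<zeta>. f (of_real r * \<zeta>))"
  by (rule continuous_on_compose2[OF assms(1)])
     (use assms(2) in \<open>auto intro!: continuous_intros simp: norm_mult\<close>)

lemma h2_norm_triangle:
  assumes "continuous_on unit_disc f" "continuous_on unit_disc g"
  shows "h2_norm (\<lambda>z. f z + g z) \<le> h2_norm f + h2_norm g"
  unfolding h2_norm_def[of "\<lambda>z. f z + g z"]
proof (rule SUP_least)
  fix r :: real assume r: "r \<in> {0<..<1}"
  let ?I = "\<lambda>h. sqrt (LINT \<zeta>|circle_lebesgue. (cmod (h (of_real r * \<zeta>)))\<^sup>2)"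
  have "ennreal (?I (\<lambda>z. f z + g z)) \<le> ennreal (?I f + ?I g)"
    by (intro ennreal_leI circle_L2_triangle continuous_circle_dilation assms r)
  also have "\<dots> = ennreal (?I f) + ennreal (?I g)"
    by (rule ennreal_plus) auto
  also have "\<dots> \<le> h2_norm f + h2_norm g"
    unfolding h2_norm_def by (intro add_mono SUP_upper r)
  finally show "ennreal (?I (\<lambda>z. f z + g z)) \<le> h2_norm f + h2_norm g" .
qed

lemma h2_norm_eq_0:
  assumes "continuous_on unit_disc f" "h2_norm f = 0" "z \<in> unit_disc" "z \<noteq> 0"
  shows "f z = 0"
proof -
  define r where "r = cmod z"
  have r: "r \<in> {0<..<1}" using assms by (auto simp: r_def)
  let ?F = "\<lambda>\<zeta>. (cmod (f (of_real r * \<zeta>)))\<^sup>2"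
  have cont: "continuous_on unit_circle ?F"
    by (intro continuous_intros continuous_circle_dilation assms r)
  have "ennreal (sqrt (LINT \<zeta>|circle_lebesgue. ?F \<zeta>)) \<le> 0"
    unfolding assms(2)[symmetric] h2_norm_def by (rule SUP_upper) (rule r)
  then have "(LINT \<zeta>|circle_lebesgue. ?F \<zeta>) \<le> 0"
    by (simp add: ennreal_eq_0_iff)
  moreover have "0 \<le> (LINT \<zeta>|circle_lebesgue. ?F \<zeta>)" by simp
  ultimately have "(LINT \<zeta>|circle_lebesgue. ?F \<zeta>) = 0" by linarith
  then have I0: "integral {0..2 * pi} (\<lambda>t. ?F (cis t)) = 0"
    using integral_circle_lebesgue[OF cont] by simp
  have "continuous_on {0..2 * pi} (\<lambda>t. ?F (cis t))"
    by (rule continuous_on_compose2[OF cont]) (auto intro!: continuous_intros)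
  then have "\<forall>t\<in>{0..2 * pi}. ?F (cis t) = 0"
    using I0 integral_eq_0_iff[of 0 "2 * pi" "\<lambda>t. ?F (cis t)"] by simp
  moreover obtain t where "t \<in> {0..2 * pi}" "z = of_real r * cis t"
  proof -
    have "z = of_real r * cis (Arg2pi z)"
      using Arg2pi_eq[of z] by (simp add: r_def cis_conv_exp mult.commute)
    then show ?thesis using that[of "Arg2pi z"] Arg2pi_ge_0[of z] Arg2pi_lt_2pi[of z] by simp
  qed
  ultimately show ?thesis by simp
qed

lemma disc_involution_eq_Moebius: "\<sigma> a z = - Moebius_function 0 a z"
  by (simp add: disc_involution_def Moebius_function_simple minus_divide_left)

lemma disc_involution_in_disc: "a \<in> unit_disc \<Longrightarrow> z \<in> unit_disc \<Longrightarrow> \<sigma> a z \<in> unit_disc"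
  using Moebius_function_norm_lt_1[of a z 0] by (simp add: disc_involution_eq_Moebius)

lemma continuous_disc_involution:
  assumes "a \<in> unit_disc"
  shows "continuous_on unit_disc (\<sigma> a)"
  using holomorphic_on_imp_continuous_on[OF Moebius_function_holomorphic[of a 0]] assms
  by (simp add: disc_involution_eq_Moebius[abs_def] continuous_on_minus)

lemma continuous_bmoa_translate:
  fixes f :: "complex \<Rightarrow> complex"
  assumes "continuous_on unit_disc f" "a \<in> unit_disc"
  shows "continuous_on unit_disc (\<lambda>z. f (\<sigma> a z) - f a)"
proof -
  have "\<sigma> a ` unit_disc \<subseteq> unit_disc"
    using disc_involution_in_disc[OF assms(2)] by blast
  then have "continuous_on unit_disc (\<lambda>z. f (\<sigma> a z))"
    by (rule continuous_on_compose2[OF assms(1) continuous_disc_involution[OF assms(2)]])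
  then show ?thesis by (rule continuous_on_diff) (rule continuous_on_const)
qed

lemma bmoa_seminorm_triangle:
  assumes "continuous_on unit_disc f" "continuous_on unit_disc g"
  shows "bmoa_seminorm (\<lambda>z. f z + g z) \<le> bmoa_seminorm f + bmoa_seminorm g"
  unfolding bmoa_seminorm_def[of "\<lambda>z. f z + g z"]
proof (rule SUP_least)
  fix a assume a: "a \<in> unit_disc"
  have "h2_norm (\<lambda>z. f (\<sigma> a z) + g (\<sigma> a z) - (f a + g a)) =
      h2_norm (\<lambda>z. (f (\<sigma> a z) - f a) + (g (\<sigma> a z) - g a))"
    by (simp add: algebra_simps)
  also have "\<dots> \<le> h2_norm (\<lambda>z. f (\<sigma> a z) - f a) + h2_norm (\<lambda>z. g (\<sigma> a z) - g a)"
    by (intro h2_norm_triangle continuous_bmoa_translate assms a)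
  also have "\<dots> \<le> bmoa_seminorm f + bmoa_seminorm g"
    unfolding bmoa_seminorm_def by (intro add_mono SUP_upper a)
  finally show "h2_norm (\<lambda>z. f (\<sigma> a z) + g (\<sigma> a z) - (f a + g a)) \<le>
      bmoa_seminorm f + bmoa_seminorm g" .
qed

lemma bmoa_seminorm_minus: "bmoa_seminorm (\<lambda>z. g z - f z) = bmoa_seminorm (\<lambda>z. f z - g z)"
proof -
  have "cmod ((g x - f x) - (g y - f y)) = cmod ((f x - g x) - (f y - g y))" for x y
    by (subst norm_minus_cancel[symmetric]) (simp add: algebra_simps)
  then show ?thesis unfolding bmoa_seminorm_def h2_norm_def by simp
qed

lemma bmoa_seminorm_diff_finite:
  assumes "f \<in> BMOA" "g \<in> BMOA"
  shows "bmoa_seminorm (\<lambda>z. f z - g z) < \<infinity>"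
proof -
  have c: "continuous_on unit_disc f" "continuous_on unit_disc g"
    using assms by (auto simp: BMOA_def holomorphic_on_imp_continuous_on)
  have "bmoa_seminorm (\<lambda>z. f z + (- g z)) \<le> bmoa_seminorm f + bmoa_seminorm (\<lambda>z. - g z)"
    by (intro bmoa_seminorm_triangle continuous_on_minus c)
  also have "bmoa_seminorm (\<lambda>z. - g z) = bmoa_seminorm g"
    using bmoa_seminorm_minus[of "\<lambda>_. 0" g] by simp
  finally show ?thesis using assms by (auto simp: BMOA_def less_top[symmetric] top_unique)
qed

lemma Metric_space_BMOA: "Metric_space BMOA bmoa_dist"
proof
  show "0 \<le> bmoa_dist f g" for f g
    by (simp add: bmoa_dist_def bmoa_norm_def)
  show "bmoa_dist f g = bmoa_dist g f" for f g
    using bmoa_seminorm_minus[of f g] by (simp add: bmoa_dist_def bmoa_norm_def norm_minus_commute)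
  show "bmoa_dist f g = 0 \<longleftrightarrow> f = g" if fg: "f \<in> BMOA" "g \<in> BMOA" for f g
  proof
    assume 0: "bmoa_dist f g = 0"
    let ?h = "\<lambda>z. f z - g z"
    have "0 \<le> enn2real (bmoa_seminorm ?h)" by simp
    then have h0: "?h 0 = 0" and "enn2real (bmoa_seminorm ?h) = 0"
      using 0 norm_ge_zero[of "?h 0"] unfolding bmoa_dist_def bmoa_norm_def
      by (auto simp: add_nonneg_eq_0_iff)
    then have s: "bmoa_seminorm ?h = 0"
      using bmoa_seminorm_diff_finite[OF fg] by (auto simp: enn2real_eq_0_iff)
    have "h2_norm (\<lambda>z. ?h (\<sigma> 0 z) - ?h 0) \<le> bmoa_seminorm ?h"
      unfolding bmoa_seminorm_def by (rule SUP_upper[of 0]) simp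
    then have n: "h2_norm (\<lambda>z. ?h (\<sigma> 0 z) - ?h 0) = 0" using s by simp
    have c: "continuous_on unit_disc ?h"
      using fg by (auto simp: BMOA_def holomorphic_on_imp_continuous_on intro!: continuous_on_diff)
    have "f z = g z" if z: "z \<in> unit_disc" for z
    proof (cases "z = 0")
      case False
      have "?h (\<sigma> 0 (- z)) - ?h 0 = 0"
        by (rule h2_norm_eq_0[OF continuous_bmoa_translate[OF c] n]) (use z False in auto)
      then show ?thesis using h0 by (simp add: disc_involution_def)
    qed (use h0 in simp)
    then show "f = g"
      using fg by (intro extensionalityI[of _ unit_disc]) (auto simp: BMOA_def)
  qed (simp add: bmoa_dist_def bmoa_norm_def bmoa_seminorm_def h2_norm_def flip: bot_ennreal)
  show "bmoa_dist f k \<le> bmoa_dist f g + bmoa_dist g k"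
    if "f \<in> BMOA" "g \<in> BMOA" "k \<in> BMOA" for f g k
  proof -
    have c: "continuous_on unit_disc f" "continuous_on unit_disc g" "continuous_on unit_disc k"
      using that by (auto simp: BMOA_def holomorphic_on_imp_continuous_on)
    have fin: "bmoa_seminorm (\<lambda>z. f z - g z) < \<infinity>" "bmoa_seminorm (\<lambda>z. g z - k z) < \<infinity>"
      using that bmoa_seminorm_diff_finite by auto
    have "bmoa_seminorm (\<lambda>z. f z - k z) = bmoa_seminorm (\<lambda>z. (f z - g z) + (g z - k z))"
      by simp
    also have "\<dots> \<le> bmoa_seminorm (\<lambda>z. f z - g z) + bmoa_seminorm (\<lambda>z. g z - k z)"
      by (intro bmoa_seminorm_triangle continuous_on_diff c)
    finally have "enn2real (bmoa_seminorm (\<lambda>z. f z - k z)) \<le>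
        enn2real (bmoa_seminorm (\<lambda>z. f z - g z) + bmoa_seminorm (\<lambda>z. g z - k z))"
      by (rule enn2real_mono) (use fin in auto)
    also have "\<dots> = enn2real (bmoa_seminorm (\<lambda>z. f z - g z)) + enn2real (bmoa_seminorm (\<lambda>z. g z - k z))"
      by (rule enn2real_plus) (use fin in auto)
    finally show ?thesis
      using norm_triangle_ineq[of "f 0 - g 0" "g 0 - k 0"]
      unfolding bmoa_dist_def bmoa_norm_def by simp
  qed
qed

end

theory Submission
  imports Defs
begin

text \<open>
  Write \<open>g = \<phi> \<circ> \<sigma> a\<close>. Condition (L) says that from a point where \<open>|\<phi>|\<close> is close to \<open>1\<close>, the values
  of \<open>\<phi>\<close> on the circle, seen through harmonic measure, hardly move in the pseudohyperbolic metric.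
  The estimate of superlevel sets and the sufficiency of (L) follow from one form of the maximum principle
  (\<open>mean_le_of_stopped_means_le\<close>): if \<open>|g 0| < \<eta>\<close>, a Brownian path from \<open>0\<close> either reaches the circle
  inside \<open>{|g| < \<eta>}\<close> or first hits a point of the level set \<open>{|g| = \<eta>}\<close>, so a mean over the circle is
  controlled by boundary values inside \<open>{|g| \<le> \<eta>}\<close> and by means seen from points of the level set.
  The harmonic extension of the boundary values is replaced by the real part of a polynomial, which is
  harmonic on the whole plane, so that the maximum principle applies on \<open>{|g| < \<eta>}\<close> whatever its shape.

  Superlevel sets. Take a cutoff of \<open>|g|\<close> that vanishes up to some \<open>s \<ge> \<eta>\<close>. It is zero where the path
  ends inside \<open>{|g| \<le> \<eta>}\<close>, and from a point of the level set (L) and Chebyshev's inequality make it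
  small on average (\<open>condition_L_superlevel_small\<close>). This is uniform over the circles of radius
  \<open>r < 1\<close>; Fatou's theorem on radial limits (\<open>Fatou_radial_limits\<close>) passes to the boundary.

  Sufficiency of (L). If \<open>f\<close> is bounded in \<open>BMOA\<close> and uniformly small on \<open>{|w| \<le> \<eta>}\<close>, the same principle
  applied to \<open>|f \<circ> g|\<^sup>2\<close> shows that \<open>f \<circ> \<phi>\<close> is small in \<open>BMOA\<close> (\<open>condition_L_compose_small\<close>). What is
  needed on the level set is that \<open>f \<circ> g\<close> has small oscillation there. Where \<open>g\<close> has moved little,
  this is a growth estimate; the remaining set has small measure, and there uniform integrability of
  \<open>|f \<circ> g|\<^sup>2\<close> helps. That is a weak form of the John--Nirenberg inequality (\<open>bmo_tail_estimate\<close>), which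
  is again a case of the maximum principle, applied to the level sets of \<open>f \<circ> g\<close> itself. Montel's theorem
  turns the estimate into compactness.

  Necessity of (L). The functions \<open>\<sigma> b - b\<close> are bounded in \<open>BMOA\<close> and tend to \<open>0\<close> locally uniformly as
  \<open>|b| \<rightarrow> 1\<close>, so a compact composition operator sends them to \<open>0\<close> in norm. For \<open>b = \<phi> a\<close> that norm
  is at least the quantity in (L).
\<close>

section \<open>Means over the circle and the disc algebra\<close>

abbreviation circle_mean :: "(complex \<Rightarrow> 'a::{banach, second_countable_topology}) \<Rightarrow> 'a" where
  "circle_mean F \<equiv> (LINT \<zeta>|circle_lebesgue. F \<zeta>)"

definition circle_L2 :: "(complex \<Rightarrow> complex) \<Rightarrow> real" where
  "circle_L2 f = sqrt (circle_mean (\<lambda>\<zeta>. (cmod (f \<zeta>))\<^sup>2))"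

definition disc_algebra :: "(complex \<Rightarrow> complex) set" where
  "disc_algebra = {f. continuous_on (cball 0 1) f \<and> f holomorphic_on unit_disc}"

lemma space_circle_lebesgue: "space circle_lebesgue = unit_circle"
  by (simp add: circle_lebesgue_def space_circle_borel)

lemma prob_space_circle_lebesgue: "prob_space circle_lebesgue"
  unfolding circle_lebesgue_def by (rule prob_space.prob_space_completion[OF circle_borel_prob])

lemma circle_mean_const: "circle_mean (\<lambda>_. c) = c" for c :: "'a::{banach, second_countable_topology}"
  using prob_space.prob_space[OF prob_space_circle_lebesgue] by simp

lemma circle_mean_cong:
  assumes "\<And>\<zeta>. cmod \<zeta> = 1 \<Longrightarrow> F \<zeta> = G \<zeta>"
  shows "circle_mean F = circle_mean G"
  by (rule Bochner_Integration.integral_cong) (auto simp: space_circle_lebesgue assms)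

lemma circle_mean_mono:
  fixes F G :: "complex \<Rightarrow> real"
  assumes "continuous_on unit_circle F" "continuous_on unit_circle G"
    and "\<And>\<zeta>. cmod \<zeta> = 1 \<Longrightarrow> F \<zeta> \<le> G \<zeta>"
  shows "circle_mean F \<le> circle_mean G"
  by (rule integral_mono[OF continuous_circle_integrable continuous_circle_integrable])
     (use assms in \<open>auto simp: space_circle_lebesgue\<close>)

lemma circle_mean_le_const:
  fixes F :: "complex \<Rightarrow> real"
  assumes "continuous_on unit_circle F" "\<And>\<zeta>. cmod \<zeta> = 1 \<Longrightarrow> F \<zeta> \<le> c"
  shows "circle_mean F \<le> c"
  using circle_mean_mono[OF assms(1) continuous_on_const, of c] assms(2)
  by (simp only: circle_mean_const) 

lemma circle_mean_add:
  fixes F G :: "complex \<Rightarrow> 'b::{banach, second_countable_topology}"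
  assumes "continuous_on unit_circle F" "continuous_on unit_circle G"
  shows "circle_mean (\<lambda>\<zeta>. F \<zeta> + G \<zeta>) = circle_mean F + circle_mean G"
    and circle_mean_diff: "circle_mean (\<lambda>\<zeta>. F \<zeta> - G \<zeta>) = circle_mean F - circle_mean G"
  using continuous_circle_integrable[OF assms(1)] continuous_circle_integrable[OF assms(2)] by simp_all

lemma circle_mean_cmult:
  fixes F :: "complex \<Rightarrow> real"
  shows "circle_mean (\<lambda>\<zeta>. c * F \<zeta>) = c * circle_mean F"
  by simp

lemma circle_mean_conv_integral:
  fixes F :: "complex \<Rightarrow> complex"
  assumes F: "continuous_on unit_circle F"
    and I: "((\<lambda>t. F (cis t)) has_integral I) {0..2*pi}"
  shows "circle_mean F = I / (2*pi)"
proof (rule complex_eqI)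
  have cR: "continuous_on unit_circle (\<lambda>z. Re (F z))" and cI: "continuous_on unit_circle (\<lambda>z. Im (F z))"
    using F by (auto intro!: continuous_intros)
  have "((\<lambda>t. Re (F (cis t))) has_integral Re I) {0..2*pi}"
       "((\<lambda>t. Im (F (cis t))) has_integral Im I) {0..2*pi}"
    using has_integral_linear[OF I bounded_linear_Re] has_integral_linear[OF I bounded_linear_Im]
    by (simp_all add: o_def)
  then have "integral {0..2*pi} (\<lambda>t. Re (F (cis t))) = Re I"
            "integral {0..2*pi} (\<lambda>t. Im (F (cis t))) = Im I" by auto
  with integral_circle_lebesgue[OF cR] integral_circle_lebesgue[OF cI]
  show "Re (circle_mean F) = Re (I / (2*pi))" "Im (circle_mean F) = Im (I / (2*pi))"
    using continuous_circle_integrable[OF F] by (simp_all add: Re_divide_of_real Im_divide_of_real flip: of_real_mult)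
qed

lemma disc_algebra_continuous:
  assumes "f \<in> disc_algebra"
  shows "continuous_on (cball 0 1) f" "continuous_on unit_circle f" "continuous_on unit_disc f"
  using assms by (auto simp: disc_algebra_def intro: continuous_on_subset)

text \<open>
  The kernel \<open>\<zeta> / (\<zeta> - w)\<close> is Cauchy's \<open>d\<zeta> / (\<zeta> - w)\<close> written with respect to arc length.
\<close>

lemma Cauchy_circle_mean:
  assumes f: "f \<in> disc_algebra" and w: "cmod w < 1"
  shows "circle_mean (\<lambda>\<zeta>. f \<zeta> * \<zeta> / (\<zeta> - w)) = f w"
proof -
  have "((\<lambda>u. f u / (u - w)) has_contour_integral (2 * of_real pi * \<i> * f w)) (circlepath 0 1)"
    by (rule Cauchy_integral_circlepath) (use f w in \<open>auto simp: disc_algebra_def\<close>)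
  then have "((\<lambda>t. f (cis t) / (cis t - w) * \<i> * cis t) has_integral (2 * of_real pi * \<i> * f w)) {0..2*pi}"
    unfolding circlepath_def by (subst (asm) has_contour_integral_part_circlepath_iff) auto
  from has_integral_mult_left[OF this, of "-\<i>"]
  have I: "((\<lambda>t. f (cis t) * cis t / (cis t - w)) has_integral (2 * of_real pi * f w)) {0..2*pi}"
    by (simp add: algebra_simps)
  have "circle_mean (\<lambda>\<zeta>. f \<zeta> * \<zeta> / (\<zeta> - w)) = 2 * of_real pi * f w / (2 * pi)"
    by (rule circle_mean_conv_integral[OF _ I])
       (use w disc_algebra_continuous(2)[OF f] in \<open>auto intro!: continuous_intros\<close>)
  then show ?thesis by simp
qed

lemma mean_value: "f \<in> disc_algebra \<Longrightarrow> circle_mean f = f 0"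
  using Cauchy_circle_mean[of f 0] circle_mean_cong[of "\<lambda>\<zeta>. f \<zeta> * \<zeta> / (\<zeta> - 0)" f]
  by (force)

lemma circle_L2_nonneg: "0 \<le> circle_L2 f"
  by (simp add: circle_L2_def)

lemma circle_L2_power2: "(circle_L2 f)\<^sup>2 = circle_mean (\<lambda>\<zeta>. (cmod (f \<zeta>))\<^sup>2)"
  by (simp add: circle_L2_def)

lemma circle_L2_cong:
  assumes "\<And>\<zeta>. cmod \<zeta> = 1 \<Longrightarrow> cmod (f \<zeta>) = cmod (g \<zeta>)"
  shows "circle_L2 f = circle_L2 g"
  unfolding circle_L2_def by (rule arg_cong[where f = sqrt], rule circle_mean_cong) (simp add: assms)

lemma circle_L2_add_le:
  assumes "continuous_on unit_circle f" "continuous_on unit_circle g"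
  shows "circle_L2 (\<lambda>z. f z + g z) \<le> circle_L2 f + circle_L2 g"
  unfolding circle_L2_def by (rule circle_L2_triangle[OF assms])

lemma circle_L2_le_sup:
  assumes "continuous_on unit_circle f" "\<And>\<zeta>. cmod \<zeta> = 1 \<Longrightarrow> cmod (f \<zeta>) \<le> c" "0 \<le> c"
  shows "circle_L2 f \<le> c"
proof -
  have "circle_mean (\<lambda>\<zeta>. (cmod (f \<zeta>))\<^sup>2) \<le> c\<^sup>2"
    by (rule circle_mean_le_const) (use assms in \<open>auto intro!: continuous_intros power_mono\<close>)
  then show ?thesis unfolding circle_L2_def using assms(3) by (intro real_le_lsqrt) auto
qed

lemma circle_L2_approx:
  assumes "continuous_on unit_circle f" "continuous_on unit_circle g"
    "\<And>\<zeta>. cmod \<zeta> = 1 \<Longrightarrow> cmod (f \<zeta> - g \<zeta>) \<le> c" "0 \<le> c"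
  shows "circle_L2 f \<le> circle_L2 g + c"
proof -
  have "circle_L2 f = circle_L2 (\<lambda>z. g z + (f z - g z))" by simp
  also have "\<dots> \<le> circle_L2 g + circle_L2 (\<lambda>z. f z - g z)"
    by (rule circle_L2_add_le) (use assms in \<open>auto intro!: continuous_intros\<close>)
  also have "circle_L2 (\<lambda>z. f z - g z) \<le> c"
    by (rule circle_L2_le_sup) (use assms in \<open>auto intro!: continuous_intros\<close>)
  finally show ?thesis by simp
qed

text \<open>
  The variance of \<open>|f|\<close> is nonnegative.
\<close>

lemma circle_mean_le_L2:
  assumes "continuous_on unit_circle f"
  shows "circle_mean (\<lambda>\<zeta>. cmod (f \<zeta>)) \<le> circle_L2 f"
proof -
  interpret prob_space circle_lebesgue by (rule prob_space_circle_lebesgue)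
  have "(circle_mean (\<lambda>\<zeta>. cmod (f \<zeta>)))\<^sup>2 \<le> circle_mean (\<lambda>\<zeta>. (cmod (f \<zeta>))\<^sup>2)"
  proof -
    define m where "m = circle_mean (\<lambda>\<zeta>. cmod (f \<zeta>))"
    have i: "integrable circle_lebesgue (\<lambda>\<zeta>. cmod (f \<zeta>))" "integrable circle_lebesgue (\<lambda>\<zeta>. (cmod (f \<zeta>))\<^sup>2)"
      by (intro continuous_circle_integrable continuous_intros assms)+
    have "0 \<le> circle_mean (\<lambda>\<zeta>. (cmod (f \<zeta>) - m)\<^sup>2)" by simp
    also have "\<dots> = circle_mean (\<lambda>\<zeta>. (cmod (f \<zeta>))\<^sup>2 - 2 * m * cmod (f \<zeta>) + m\<^sup>2)"
      by (intro Bochner_Integration.integral_cong) (auto simp: power2_eq_square algebra_simps)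
    also have "\<dots> = circle_mean (\<lambda>\<zeta>. (cmod (f \<zeta>))\<^sup>2) - 2 * m * m + m\<^sup>2"
      using i by (simp add: m_def prob_space)
    finally show ?thesis by (simp add: m_def power2_eq_square)
  qed
  then show ?thesis unfolding circle_L2_def by (rule real_le_rsqrt)
qed

lemma cmod_at_0_le_L2:
  assumes "f \<in> disc_algebra" shows "cmod (f 0) \<le> circle_L2 f"
proof -
  have "cmod (f 0) = cmod (circle_mean f)" by (simp add: mean_value assms)
  also have "\<dots> \<le> circle_mean (\<lambda>\<zeta>. cmod (f \<zeta>))" by (rule integral_norm_bound)
  also have "\<dots> \<le> circle_L2 f" by (rule circle_mean_le_L2[OF disc_algebra_continuous(2)[OF assms]])
  finally show ?thesis .
qed

lemma h2_norm_conv_L2: "h2_norm f = (SUP r\<in>{0<..<1}. ennreal (circle_L2 (\<lambda>\<zeta>. f (of_real r * \<zeta>))))"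
  by (simp add: h2_norm_def circle_L2_def)

text \<open>
  All estimates are made for functions continuous up to the circle; this passes to the Hardy norm.
\<close>

lemma h2_norm_le_iff:
  assumes "0 \<le> B"
  shows "h2_norm f \<le> ennreal B \<longleftrightarrow> (\<forall>r\<in>{0<..<1}. circle_L2 (\<lambda>\<zeta>. f (of_real r * \<zeta>)) \<le> B)"
  unfolding h2_norm_conv_L2 by (simp add: SUP_le_iff ennreal_le_iff[OF assms])

lemma h2_norm_cong:
  assumes "\<And>z. cmod z < 1 \<Longrightarrow> cmod (f z) = cmod (g z)"
  shows "h2_norm f = h2_norm g"
  unfolding h2_norm_conv_L2
  by (intro SUP_cong refl arg_cong[where f = ennreal] circle_L2_cong assms) (simp add: norm_mult)

lemma dilation_disc_algebra:
  assumes "f holomorphic_on unit_disc" "0 < r" "r < 1"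
  shows "(\<lambda>z. f (of_real r * z)) \<in> disc_algebra"
proof -
  have lt: "cmod (of_real r * z) < 1" if "cmod z \<le> 1" for z :: complex
  proof -
    have "r * cmod z \<le> r * 1" by (rule mult_left_mono) (use that assms(2) in auto)
    also have "\<dots> < 1" using assms(3) by simp
    finally show ?thesis using assms(2) by (simp add: norm_mult)
  qed
  then have sub: "(\<lambda>z. of_real r * z) ` cball 0 1 \<subseteq> unit_disc" by auto
  show ?thesis
    unfolding disc_algebra_def
  proof (safe)
    show "continuous_on (cball 0 1) (\<lambda>z. f (of_real r * z))"
      by (rule continuous_on_compose2[OF holomorphic_on_imp_continuous_on[OF assms(1)] _ sub])
         (auto intro!: continuous_intros)
    have "f \<circ> (\<lambda>z. of_real r * z) holomorphic_on unit_disc"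
      by (rule holomorphic_on_compose_gen[OF _ assms(1)]) (use lt in \<open>auto intro!: holomorphic_intros\<close>)
    then show "(\<lambda>z. f (of_real r * z)) holomorphic_on unit_disc" by (simp add: o_def)
  qed
qed

section \<open>Disc maps and the involutions of the disc\<close>

text \<open>
  The analytic maps whose image of the closed disc is a compact part of the open disc. Circles of radius
  \<open>r < 1\<close> and changes of the base point are both treated by composing with such maps, so that
  the estimates concern functions continuous on the closed disc.
\<close>

definition disc_map :: "(complex \<Rightarrow> complex) set" where
  "disc_map = {K \<in> disc_algebra. \<forall>z. cmod z \<le> 1 \<longrightarrow> cmod (K z) < 1}"

lemma disc_algebra_compose:
  assumes f: "f \<in> disc_algebra" and K: "K \<in> disc_algebra"
    and "\<And>z. cmod z \<le> 1 \<Longrightarrow> cmod (K z) \<le> 1" "\<And>z. cmod z < 1 \<Longrightarrow> cmod (K z) < 1"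
  shows "(\<lambda>z. f (K z)) \<in> disc_algebra"
proof -
  have "continuous_on (cball 0 1) (\<lambda>z. f (K z))"
    by (rule continuous_on_compose2[of "cball 0 1" f]) (use assms in \<open>auto simp: disc_algebra_def\<close>)
  moreover have "(f \<circ> K) holomorphic_on unit_disc"
    by (rule holomorphic_on_compose_gen[of _ _ _ unit_disc]) (use assms in \<open>auto simp: disc_algebra_def\<close>)
  ultimately show ?thesis by (simp add: disc_algebra_def o_def)
qed

lemma disc_algebra_compose_disc_map:
  assumes f: "f holomorphic_on unit_disc" and K: "K \<in> disc_map"
  shows "(\<lambda>z. f (K z)) \<in> disc_algebra"
proof -
  have "continuous_on (cball 0 1) (\<lambda>z. f (K z))"
    by (rule continuous_on_compose2[OF holomorphic_on_imp_continuous_on[OF f]])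
       (use K in \<open>auto simp: disc_algebra_def disc_map_def\<close>)
  moreover have "(f \<circ> K) holomorphic_on unit_disc"
    by (rule holomorphic_on_compose_gen[OF _ f]) (use K in \<open>auto simp: disc_algebra_def disc_map_def\<close>)
  ultimately show ?thesis by (simp add: disc_algebra_def o_def)
qed

lemma disc_map_compose:
  assumes "f holomorphic_on unit_disc" "\<And>z. cmod z < 1 \<Longrightarrow> cmod (f z) < 1" "K \<in> disc_map"
  shows "(\<lambda>z. f (K z)) \<in> disc_map"
  using disc_algebra_compose_disc_map[OF assms(1,3)] assms(2,3) by (auto simp: disc_map_def)

lemma disc_map_imp_disc_algebra: "K \<in> disc_map \<Longrightarrow> K \<in> disc_algebra"
  by (simp add: disc_map_def)

lemma dilation_disc_map: "0 < r \<Longrightarrow> r < 1 \<Longrightarrow> (\<lambda>z. of_real r * z) \<in> disc_map"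
proof -
  assume r: "0 < r" "r < 1"
  have "r * cmod z < 1" if "cmod z \<le> 1" for z
  proof -
    have "r * cmod z \<le> r * 1" by (rule mult_left_mono) (use that r in auto)
    also have "\<dots> < 1" using r by simp
    finally show ?thesis .
  qed
  moreover have "(\<lambda>z. of_real r * z) \<in> disc_algebra"
    using dilation_disc_algebra[OF holomorphic_on_ident r] .
  ultimately show ?thesis using r by (simp add: disc_map_def norm_mult)
qed

lemma one_minus_cnj_mult_nonzero:
  assumes "cmod a < 1" "cmod z \<le> 1"
  shows "1 - cnj a * z \<noteq> 0"
proof
  assume "1 - cnj a * z = 0"
  then have "cmod (cnj a * z) = 1" by (metis eq_iff_diff_eq_0 norm_one)
  moreover have "cmod (cnj a * z) \<le> cmod a * 1"
    using assms(2) by (simp add: norm_mult mult_left_le)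
  ultimately show False using assms(1) by simp
qed

text \<open>
  The identity that makes \<open>|\<sigma> a z|\<close> the pseudohyperbolic distance: it gives \<open>|\<sigma> a| = 1\<close> on the circle
  and, below, a lower bound for the distance of \<open>a\<close> to points near the circle.
\<close>

lemma one_minus_disc_involution:
  assumes "cmod a < 1" "cmod z \<le> 1"
  shows "1 - (cmod (\<sigma> a z))\<^sup>2 = (1 - (cmod a)\<^sup>2) * (1 - (cmod z)\<^sup>2) / (cmod (1 - cnj a * z))\<^sup>2"
proof -
  have nz: "cmod (1 - cnj a * z) \<noteq> 0" using one_minus_cnj_mult_nonzero[OF assms] by simp
  have "(cmod (1 - cnj a * z))\<^sup>2 - (cmod (a - z))\<^sup>2 = (1 - (cmod a)\<^sup>2) * (1 - (cmod z)\<^sup>2)"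
    unfolding cmod_power2 by (simp add: power2_eq_square algebra_simps)
  then show ?thesis using nz
    by (simp add: disc_involution_def norm_divide power_divide field_simps)
qed

lemma disc_involution_bounds:
  assumes "cmod a < 1"
  shows "cmod z = 1 \<Longrightarrow> cmod (\<sigma> a z) = 1" "cmod z < 1 \<Longrightarrow> cmod (\<sigma> a z) < 1"
    "cmod z \<le> 1 \<Longrightarrow> cmod (\<sigma> a z) \<le> 1"
proof -
  show 1: "cmod (\<sigma> a z) = 1" if "cmod z = 1"
    using one_minus_disc_involution[OF assms, of z] that by (simp add: power2_eq_1_iff)
      (smt (verit) norm_ge_zero)
  show 2: "cmod (\<sigma> a z) < 1" if "cmod z < 1"
    using disc_involution_in_disc[of a z] assms that by simp
  show "cmod (\<sigma> a z) \<le> 1" if "cmod z \<le> 1"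
    using 1 2 that by (cases "cmod z = 1") auto
qed

lemma disc_involution_self: "\<sigma> a a = 0" and disc_involution_0: "\<sigma> a 0 = a"
  by (auto simp: disc_involution_def)

lemma disc_involution_involution:
  assumes "cmod a < 1" "cmod z \<le> 1"
  shows "\<sigma> a (\<sigma> a z) = z"
proof -
  have n1: "1 - cnj a * z \<noteq> 0" by (rule one_minus_cnj_mult_nonzero[OF assms])
  have n2: "1 - cnj a * a \<noteq> 0" by (rule one_minus_cnj_mult_nonzero) (use assms in auto)
  have "a - (a - z) / (1 - cnj a * z) = z * (1 - cnj a * a) / (1 - cnj a * z)"
       "1 - cnj a * ((a - z) / (1 - cnj a * z)) = (1 - cnj a * a) / (1 - cnj a * z)"
    using n1 by (simp_all add: divide_simps) (simp_all add: algebra_simps)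
  then show ?thesis unfolding disc_involution_def using n1 n2 by simp
qed

lemma disc_involution_holomorphic:
  assumes "cmod a < 1"
  shows "\<sigma> a holomorphic_on unit_disc"
  unfolding disc_involution_def[abs_def]
  by (intro holomorphic_intros) (use one_minus_cnj_mult_nonzero[OF assms] in auto)

lemma disc_involution_disc_algebra:
  assumes "cmod a < 1"
  shows "\<sigma> a \<in> disc_algebra"
proof -
  have "continuous_on (cball 0 1) (\<sigma> a)"
    unfolding disc_involution_def[abs_def]
    by (intro continuous_intros) (use one_minus_cnj_mult_nonzero[OF assms] in auto)
  then show ?thesis using disc_involution_holomorphic[OF assms] by (simp add: disc_algebra_def)
qed

lemma disc_algebra_compose_involution:
  "f \<in> disc_algebra \<Longrightarrow> cmod a < 1 \<Longrightarrow> (\<lambda>z. f (\<sigma> a z)) \<in> disc_algebra"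
  by (rule disc_algebra_compose[OF _ disc_involution_disc_algebra]) (auto simp: disc_involution_bounds)

lemma disc_map_compose_involution:
  "f \<in> disc_map \<Longrightarrow> cmod a < 1 \<Longrightarrow> (\<lambda>z. f (\<sigma> a z)) \<in> disc_map"
  using disc_algebra_compose_involution[of f a] by (auto simp: disc_map_def disc_involution_bounds)

lemma continuous_circle_involution:
  assumes "continuous_on unit_circle F" "cmod a < 1"
  shows "continuous_on unit_circle (\<lambda>z. F (\<sigma> a z))"
  by (rule continuous_on_compose2[OF assms(1)])
     (use disc_involution_disc_algebra[OF assms(2)] in
        \<open>auto simp: disc_involution_bounds assms(2) intro: disc_algebra_continuous\<close>)

lemma disc_algebra_diff_const: "f \<in> disc_algebra \<Longrightarrow> (\<lambda>z. f z - c) \<in> disc_algebra"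
  and disc_algebra_mult: "f \<in> disc_algebra \<Longrightarrow> g \<in> disc_algebra \<Longrightarrow> (\<lambda>z. f z * g z) \<in> disc_algebra"
  and disc_algebra_const: "(\<lambda>z. c) \<in> disc_algebra"
  and disc_algebra_poly: "f \<in> disc_algebra \<Longrightarrow> (\<lambda>z. poly p (f z)) \<in> disc_algebra"
proof -
  show "f \<in> disc_algebra \<Longrightarrow> (\<lambda>z. poly p (f z)) \<in> disc_algebra"
    by (induction p) (auto simp: disc_algebra_def intro!: continuous_intros holomorphic_intros)
qed (auto simp: disc_algebra_def intro!: continuous_intros holomorphic_intros)

section \<open>Littlewood subordination\<close>

text \<open>
  Constants are orthogonal to the functions of the disc algebra that vanish at \<open>0\<close>. Iterating this
  orthogonality yields both Littlewood's theorem and Parseval's identity for polynomials.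
\<close>

lemma mean_square_const_plus:
  assumes f: "f \<in> disc_algebra" "f 0 = 0"
  shows "circle_mean (\<lambda>\<zeta>. (cmod (a + f \<zeta>))\<^sup>2) = (cmod a)\<^sup>2 + circle_mean (\<lambda>\<zeta>. (cmod (f \<zeta>))\<^sup>2)"
proof -
  have c: "continuous_on unit_circle f" by (rule disc_algebra_continuous[OF f(1)])
  have "circle_mean (\<lambda>\<zeta>. (cmod (a + f \<zeta>))\<^sup>2) =
      circle_mean (\<lambda>\<zeta>. (cmod a)\<^sup>2 + (cmod (f \<zeta>))\<^sup>2 + 2 * Re (cnj a * f \<zeta>))"
    by (intro circle_mean_cong) (simp only: cmod_power2, simp add: power2_eq_square algebra_simps)
  also have "\<dots> = circle_mean (\<lambda>_. (cmod a)\<^sup>2) + circle_mean (\<lambda>\<zeta>. (cmod (f \<zeta>))\<^sup>2) +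
      circle_mean (\<lambda>\<zeta>. 2 * Re (cnj a * f \<zeta>))"
    by (subst Bochner_Integration.integral_add,
        (intro continuous_circle_integrable continuous_intros c)+)+ (rule refl)
  also have "\<dots> = (cmod a)\<^sup>2 + circle_mean (\<lambda>\<zeta>. (cmod (f \<zeta>))\<^sup>2) + 2 * circle_mean (\<lambda>\<zeta>. Re (cnj a * f \<zeta>))"
    by (simp only: circle_mean_const Bochner_Integration.integral_mult_right_zero)
  also have "circle_mean (\<lambda>\<zeta>. Re (cnj a * f \<zeta>)) = Re (circle_mean (\<lambda>\<zeta>. cnj a * f \<zeta>))"
    by (intro integral_Re continuous_circle_integrable continuous_intros c)
  also have "circle_mean (\<lambda>\<zeta>. cnj a * f \<zeta>) = 0"
    using mean_value[OF disc_algebra_mult[OF disc_algebra_const f(1)], of "cnj a"] f(2) by simp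
  finally show ?thesis by simp
qed

text \<open>
  Horner's scheme proves Littlewood's theorem for polynomials: with \<open>p z = a + z q z\<close>, the mean square of
  \<open>p \<circ> G\<close> is \<open>|a|\<^sup>2\<close> plus that of \<open>G \<cdot> (q \<circ> G)\<close>. Dropping the factor \<open>|G| \<le> 1\<close> does not decrease it, and for
  \<open>G z = z\<close> nothing is lost.
\<close>

lemma subordination_poly:
  assumes G: "G \<in> disc_algebra" "G 0 = 0" "\<And>\<zeta>. cmod \<zeta> = 1 \<Longrightarrow> cmod (G \<zeta>) \<le> 1"
  shows "circle_mean (\<lambda>\<zeta>. (cmod (poly p (G \<zeta>)))\<^sup>2) \<le> circle_mean (\<lambda>\<zeta>. (cmod (poly p \<zeta>))\<^sup>2)"
proof (induction p)
  case (pCons a p)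
  have A: "(\<lambda>z. K z * poly p (K z)) \<in> disc_algebra" if "K \<in> disc_algebra" for K
    by (intro disc_algebra_mult disc_algebra_poly that)
  have I: "(\<lambda>z. z) \<in> disc_algebra" by (auto simp: disc_algebra_def)
  have "circle_mean (\<lambda>\<zeta>. (cmod (G \<zeta> * poly p (G \<zeta>)))\<^sup>2) \<le> circle_mean (\<lambda>\<zeta>. (cmod (poly p (G \<zeta>)))\<^sup>2)"
  proof (rule circle_mean_mono)
    show "(cmod (G \<zeta> * poly p (G \<zeta>)))\<^sup>2 \<le> (cmod (poly p (G \<zeta>)))\<^sup>2" if "cmod \<zeta> = 1" for \<zeta>
      using G(3)[OF that] by (intro power_mono) (auto simp: norm_mult mult_left_le_one_le)
  qed (intro continuous_intros disc_algebra_continuous A G disc_algebra_poly)+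
  also have "\<dots> \<le> circle_mean (\<lambda>\<zeta>. (cmod (poly p \<zeta>))\<^sup>2)" by (rule pCons.IH)
  also have "\<dots> = circle_mean (\<lambda>\<zeta>. (cmod (\<zeta> * poly p \<zeta>))\<^sup>2)"
    by (rule circle_mean_cong) (simp add: norm_mult)
  finally show ?case
    using mean_square_const_plus[OF A[OF G(1)], of a] mean_square_const_plus[OF A[OF I], of a] G(2)
    by simp
qed simp

definition taylor_coeff :: "(complex \<Rightarrow> complex) \<Rightarrow> nat \<Rightarrow> complex" where
  "taylor_coeff f n = (deriv ^^ n) f 0 / fact n"

lemma taylor_uniform_approx:
  assumes f: "f holomorphic_on unit_disc" and s: "0 < s" "s < 1" and e: "e > 0"
  shows "\<forall>\<^sub>F N in sequentially. \<forall>z\<in>cball 0 s. cmod (f z - (\<Sum>i<N. taylor_coeff f i * z ^ i)) < e"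
proof -
  define c where "c = taylor_coeff f"
  have sums: "(\<lambda>n. c n * z ^ n) sums f z" if "cmod z < 1" for z
    using holomorphic_power_series[OF f, of z] that by (simp add: c_def taylor_coeff_def)
  have "ereal s < conv_radius c"
  proof -
    define t where "t = (1 + s) / 2"
    have t: "s < t" "t < 1" "0 < t" using s by (auto simp: t_def)
    have "summable (\<lambda>n. c n * of_real t ^ n)"
      using sums[of "of_real t"] t by (auto simp: sums_iff)
    from conv_radius_geI[OF this] have "conv_radius c \<ge> ereal t" using t by simp
    moreover have "ereal s < ereal t" using t(1) by simp
    ultimately show ?thesis by (rule order.strict_trans2[rotated])
  qed
  from powser_uniform_limit[OF this, of 0]
  have "uniform_limit (cball 0 s) (\<lambda>n x. \<Sum>i<n. c i * x ^ i) (\<lambda>x. \<Sum>i. c i * x ^ i) sequentially"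
    by (simp only: diff_zero)
  then have "\<forall>\<^sub>F n in sequentially. \<forall>z\<in>cball 0 s. dist (\<Sum>i<n. c i * z ^ i) (\<Sum>i. c i * z ^ i) < e"
    using e by (rule uniform_limitD)
  then show ?thesis
  proof (rule eventually_mono, intro ballI)
    fix N and z :: complex assume N: "\<forall>z\<in>cball 0 s. dist (\<Sum>i<N. c i * z ^ i) (\<Sum>i. c i * z ^ i) < e" and z: "z \<in> cball 0 s"
    have "(\<Sum>i. c i * z ^ i) = f z" using sums[of z] z s by (simp add: sums_iff)
    with bspec[OF N z] show "cmod (f z - (\<Sum>i<N. taylor_coeff f i * z ^ i)) < e"
      by (simp add: dist_norm norm_minus_commute c_def)
  qed
qed

lemma poly_approx_dilation:
  assumes f: "f holomorphic_on unit_disc" and s: "0 < s" "s < 1" and e: "e > 0"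
  obtains p where "\<And>z. cmod z \<le> 1 \<Longrightarrow> cmod (f (of_real s * z) - poly p z) < e"
proof -
  obtain N where N: "\<forall>z\<in>cball 0 s. cmod (f z - (\<Sum>i<N. taylor_coeff f i * z ^ i)) < e"
    using eventually_happens'[OF sequentially_bot taylor_uniform_approx[OF f s e]] by blast
  show thesis
  proof (rule that)
    fix z :: complex assume z: "cmod z \<le> 1"
    have "of_real s * z \<in> cball 0 s" using z s by (simp add: norm_mult mult_left_le)
    moreover have "poly (\<Sum>i<N. monom (taylor_coeff f i * of_real s ^ i) i) z =
        (\<Sum>i<N. taylor_coeff f i * (of_real s * z) ^ i)"
      by (simp add: poly_sum poly_monom power_mult_distrib mult.assoc)
    ultimately show "cmod (f (of_real s * z) - poly (\<Sum>i<N. monom (taylor_coeff f i * of_real s ^ i) i) z) < e"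
      using N by simp
  qed
qed

lemma disc_map_bounded_away:
  assumes "G \<in> disc_map"
  obtains s where "0 < s" "s < 1" "\<And>z. cmod z \<le> 1 \<Longrightarrow> cmod (G z) \<le> s"
proof -
  have "continuous_on (cball 0 1) (\<lambda>z. cmod (G z))"
    using assms by (auto simp: disc_map_def disc_algebra_def intro!: continuous_intros)
  then obtain w where "w \<in> cball 0 1" "\<And>z. z \<in> cball 0 1 \<Longrightarrow> cmod (G z) \<le> cmod (G w)"
    using continuous_attains_sup[of "cball (0::complex) 1" "\<lambda>z. cmod (G z)"] by auto
  moreover from this have "cmod (G w) < 1" using assms by (auto simp: disc_map_def)
  ultimately show thesis by (intro that[of "max (1/2) (cmod (G w))"]) (auto simp: less_max_iff_disj le_max_iff_disj)
qed

text \<open>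
  Since the image of \<open>G\<close> stays in a disc of radius \<open>s < 1\<close>, \<open>k \<circ> G\<close> is the dilation \<open>k (s z)\<close> composed with
  \<open>G / s\<close>. That dilation is a uniform limit of polynomials on the closed disc.
\<close>

lemma Littlewood_subordination:
  assumes k: "k holomorphic_on unit_disc" "h2_norm k \<le> ennreal B" "0 \<le> B"
    and G: "G \<in> disc_map" "G 0 = 0"
  shows "circle_L2 (\<lambda>z. k (G z)) \<le> B"
proof (rule field_le_epsilon)
  fix e :: real assume e: "e > 0"
  obtain s where s: "0 < s" "s < 1" and Gs: "\<And>z. cmod z \<le> 1 \<Longrightarrow> cmod (G z) \<le> s"
    by (rule disc_map_bounded_away[OF G(1)]) blast
  \<comment> \<open>still maps into the closed disc, since \<open>|G| \<le> s\<close>\<close>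
  define L where "L z = G z / of_real s" for z
  have L: "L \<in> disc_algebra" "L 0 = 0"
    using G s by (auto simp: L_def[abs_def] disc_map_def disc_algebra_def intro!: continuous_intros holomorphic_intros)
  have L1: "cmod (L z) \<le> 1" if "cmod z \<le> 1" for z
    using Gs[OF that] s by (simp add: L_def norm_divide)
  obtain p where p: "\<And>z. cmod z \<le> 1 \<Longrightarrow> cmod (k (of_real s * z) - poly p z) < e/2"
    using poly_approx_dilation[OF k(1) s, of "e/2"] e by auto
  have kG: "k (G z) = k (of_real s * L z)" for z using s by (simp add: L_def)
  have ck: "continuous_on unit_circle (\<lambda>z. k (of_real s * z))"
    by (rule disc_algebra_continuous[OF dilation_disc_algebra[OF k(1) s]])
  have "cmod (k (G z) - poly p (L z)) \<le> e/2" if "cmod z = 1" for z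
    using less_imp_le[OF p[OF L1[of z]]] that kG[of z] by simp
  then have "circle_L2 (\<lambda>z. k (G z)) \<le> circle_L2 (\<lambda>z. poly p (L z)) + e/2"
    using e by (intro circle_L2_approx disc_algebra_continuous disc_algebra_poly L
                  disc_algebra_compose_disc_map k G) auto
  also have "circle_L2 (\<lambda>z. poly p (L z)) \<le> circle_L2 (poly p)"
    unfolding circle_L2_def by (intro real_sqrt_le_mono subordination_poly L L1) simp
  also have "\<dots> \<le> circle_L2 (\<lambda>z. k (of_real s * z)) + e/2"
    by (rule circle_L2_approx)
       (use e p ck in \<open>auto intro!: less_imp_le continuous_intros simp: norm_minus_commute\<close>)
  also have "circle_L2 (\<lambda>z. k (of_real s * z)) \<le> B"
    using k(2) s unfolding h2_norm_le_iff[OF k(3)] by auto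
  finally show "circle_L2 (\<lambda>z. k (G z)) \<le> B + e" by simp
qed

text \<open>
  Because \<open>k 0 = 0\<close>, subtracting the mean of \<open>k\<close> from Cauchy's formula leaves the kernel
  \<open>w / (\<zeta> - w)\<close>, which supplies the factor \<open>|w|\<close>. The bound is used for small \<open>w\<close> in the oscillation estimate,
  and for all \<open>w\<close> to obtain local boundedness in Montel's theorem.
\<close>

lemma growth_estimate:
  assumes k: "k holomorphic_on unit_disc" "h2_norm k \<le> ennreal B" "0 \<le> B" "k 0 = 0" and w: "cmod w < 1"
  shows "cmod (k w) \<le> B * cmod w / (1 - cmod w)"
proof -
  have 1: "cmod (k w) \<le> B * cmod (w / r) / (1 - cmod (w / r))" if r: "cmod w < r" "r < 1" for r
  proof -
    have r0: "0 < r" using r(1) by (rule order.strict_trans1[OF norm_ge_zero])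
    define f where "f z = k (of_real r * z)" for z
    define u where "u = w / of_real r"
    have u: "cmod u < 1" using r r0 by (simp add: u_def norm_divide)
    have f: "f \<in> disc_algebra" unfolding f_def by (rule dilation_disc_algebra[OF k(1) r0 r(2)])
    have c: "continuous_on unit_circle f" by (rule disc_algebra_continuous[OF f])
    have nz: "\<zeta> - u \<noteq> 0" if "cmod \<zeta> = 1" for \<zeta> using that u by auto
    have i: "integrable circle_lebesgue (\<lambda>\<zeta>. f \<zeta> * \<zeta> / (\<zeta> - u))" "integrable circle_lebesgue f"
      by (intro continuous_circle_integrable continuous_intros c ballI nz; simp)+
    have "f u = circle_mean (\<lambda>\<zeta>. f \<zeta> * \<zeta> / (\<zeta> - u)) - circle_mean f"
      using mean_value[OF f] Cauchy_circle_mean[OF f u] k(4) by (simp add: f_def)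
    also have "\<dots> = circle_mean (\<lambda>\<zeta>. f \<zeta> * \<zeta> / (\<zeta> - u) - f \<zeta>)" using i by simp
    finally have "cmod (f u) = cmod (circle_mean (\<lambda>\<zeta>. f \<zeta> * \<zeta> / (\<zeta> - u) - f \<zeta>))" by simp
    also have "\<dots> \<le> circle_mean (\<lambda>\<zeta>. cmod (f \<zeta> * \<zeta> / (\<zeta> - u) - f \<zeta>))" by (rule integral_norm_bound)
    also have "\<dots> \<le> circle_mean (\<lambda>\<zeta>. cmod (f \<zeta>) * (cmod u / (1 - cmod u)))"
    proof (rule circle_mean_mono)
      fix \<zeta> :: complex assume z: "cmod \<zeta> = 1"
      have "f \<zeta> * \<zeta> / (\<zeta> - u) - f \<zeta> = f \<zeta> * (u / (\<zeta> - u))"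
        using nz[OF z] by (simp add: field_simps)
      moreover have "cmod u / cmod (\<zeta> - u) \<le> cmod u / (1 - cmod u)"
        using norm_triangle_ineq2[of \<zeta> u] z u by (intro divide_left_mono mult_pos_pos) auto
      ultimately show "cmod (f \<zeta> * \<zeta> / (\<zeta> - u) - f \<zeta>) \<le> cmod (f \<zeta>) * (cmod u / (1 - cmod u))"
        by (simp only: norm_mult norm_divide mult_left_mono norm_ge_zero)
    qed (intro continuous_intros c ballI nz; simp)+
    also have "\<dots> = circle_mean (\<lambda>\<zeta>. cmod (f \<zeta>)) * (cmod u / (1 - cmod u))" by simp
    also have "\<dots> \<le> circle_L2 f * (cmod u / (1 - cmod u))"
      by (intro mult_right_mono circle_mean_le_L2 c) (use u in auto)
    also have "circle_L2 f \<le> B"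
      using k(2) r0 r(2) unfolding h2_norm_le_iff[OF k(3)] f_def[abs_def] by auto
    finally have "cmod (f u) \<le> B * (cmod u / (1 - cmod u))"
      using u by (simp add: mult_right_mono divide_right_mono)
    then show ?thesis using r0 by (simp add: u_def f_def)
  qed
  have "((\<lambda>r::real. B * cmod (w / r) / (1 - cmod (w / r))) \<longlongrightarrow> B * cmod (w / of_real 1) / (1 - cmod (w / of_real 1))) (at_left 1)"
    by (intro tendsto_intros) (use w in auto)
  moreover have "\<forall>\<^sub>F r in at_left 1. cmod (k w) \<le> B * cmod (w / of_real r) / (1 - cmod (w / of_real r))"
    using eventually_at_left_real[OF w] by eventually_elim (use 1 in auto)
  ultimately have "cmod (k w) \<le> B * cmod (w / of_real 1) / (1 - cmod (w / of_real 1))"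
    by (intro tendsto_lowerbound) auto
  then show ?thesis by simp
qed

section \<open>The stopping principle\<close>

text \<open>
  On the circle \<open>\<zeta>\<close> and its conjugate cancel, and a remaining conjugate power may be conjugated back
  because only the real part matters.
\<close>

lemma Re_mult_cnj_poly_on_circle:
  "\<exists>r. \<forall>\<zeta>. cmod \<zeta> = 1 \<longrightarrow> Re (poly p \<zeta> * cnj (poly q \<zeta>)) = Re (poly r \<zeta>)"
proof (induction p q rule: poly_induct2)
  case (pCons a p b q)
  then obtain r where r: "\<And>\<zeta>. cmod \<zeta> = 1 \<Longrightarrow> Re (poly p \<zeta> * cnj (poly q \<zeta>)) = Re (poly r \<zeta>)" by blast
  have "Re (poly (pCons a p) \<zeta> * cnj (poly (pCons b q) \<zeta>)) =
      Re (poly ([:a * cnj b:] + smult (cnj a) (pCons 0 q) + smult (cnj b) (pCons 0 p) + r) \<zeta>)"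
    if "cmod \<zeta> = 1" for \<zeta>
  proof -
    have "poly (pCons a p) \<zeta> * cnj (poly (pCons b q) \<zeta>) =
        a * cnj b + cnj (cnj a * (\<zeta> * poly q \<zeta>)) + cnj b * (\<zeta> * poly p \<zeta>) +
        (\<zeta> * cnj \<zeta>) * (poly p \<zeta> * cnj (poly q \<zeta>))"
      by (simp add: algebra_simps)
    also have "\<zeta> * cnj \<zeta> = 1" using that complex_norm_square[of \<zeta>] by simp
    finally show ?thesis using r[OF that] by (simp only: poly_add poly_smult poly_pCons) (simp add: algebra_simps)
  qed
  then show ?case by blast
qed (auto intro: exI[of _ 0])

text \<open>
  Real parts of polynomials restrict to an algebra on the circle, by
  \<open>Re p \<cdot> Re q = Re (p q + p \<cdot> cnj q) / 2\<close>, so every real polynomial in the two coordinates is one of them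
  and the theorem of Stone and Weierstrass applies. This is an approximate solution of the Dirichlet
  problem by entire functions.
\<close>

lemma circle_approx_Re_poly:
  fixes F :: "complex \<Rightarrow> real"
  assumes "continuous_on unit_circle F" "e > 0"
  obtains p where "\<And>\<zeta>. cmod \<zeta> = 1 \<Longrightarrow> \<bar>F \<zeta> - Re (poly p \<zeta>)\<bar> < e"
proof -
  obtain g where g: "real_polynomial_function g" "\<And>x. x \<in> unit_circle \<Longrightarrow> \<bar>F x - g x\<bar> < e"
    using Stone_Weierstrass_real_polynomial_function[OF compact_sphere assms] by blast
  from g(1) have "\<exists>p. \<forall>\<zeta>. cmod \<zeta> = 1 \<longrightarrow> g \<zeta> = Re (poly p \<zeta>)"
  proof (induction g)
    case (linear f)
    then interpret bounded_linear f .
    have "f \<zeta> = Re (poly [:0, Complex (f 1) (- f \<i>):] \<zeta>)" for \<zeta>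
    proof -
      have "f \<zeta> = f (Re \<zeta> *\<^sub>R 1 + Im \<zeta> *\<^sub>R \<i>)"
        by (rule arg_cong[where f = f]) (simp add: complex_eq_iff)
      also have "\<dots> = Re \<zeta> * f 1 + Im \<zeta> * f \<i>" by (simp only: add scaleR) simp
      finally show ?thesis by simp
    qed
    then show ?case by blast
  next
    case (const c)
    show ?case by (rule exI[of _ "[:of_real c:]"]) simp
  next
    case (add f g)
    then obtain p q where "\<And>\<zeta>. cmod \<zeta> = 1 \<Longrightarrow> f \<zeta> = Re (poly p \<zeta>)" "\<And>\<zeta>. cmod \<zeta> = 1 \<Longrightarrow> g \<zeta> = Re (poly q \<zeta>)"
      by blast
    then show ?case by (intro exI[of _ "p + q"]) simp
  next
    case (mult f g)
    then obtain p q where pq: "\<And>\<zeta>. cmod \<zeta> = 1 \<Longrightarrow> f \<zeta> = Re (poly p \<zeta>)" "\<And>\<zeta>. cmod \<zeta> = 1 \<Longrightarrow> g \<zeta> = Re (poly q \<zeta>)"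
      by blast
    obtain r where r: "\<And>\<zeta>. cmod \<zeta> = 1 \<Longrightarrow> Re (poly p \<zeta> * cnj (poly q \<zeta>)) = Re (poly r \<zeta>)"
      using Re_mult_cnj_poly_on_circle[of p q] by blast
    have "f \<zeta> * g \<zeta> = Re (poly (smult (1/2) (p * q) + smult (1/2) r) \<zeta>)" if "cmod \<zeta> = 1" for \<zeta>
      using r[OF that] pq that by (simp add: field_simps)
    then show ?case by blast
  qed
  with g(2) that show thesis by fastforce
qed

text \<open>
  The mean of a harmonic function after the automorphism \<open>\<sigma> b\<close> is its value at \<open>b\<close>: composition with \<open>\<sigma> b\<close>
  moves the base point from \<open>0\<close> to \<open>b\<close>.
\<close>

lemma mean_value_Re_poly:
  assumes "cmod b < 1"
  shows "circle_mean (\<lambda>\<zeta>. Re (poly p (\<sigma> b \<zeta>))) = Re (poly p b)"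
proof -
  have A: "(\<lambda>z. poly p (\<sigma> b z)) \<in> disc_algebra"
    by (intro disc_algebra_poly disc_involution_disc_algebra assms)
  have "circle_mean (\<lambda>\<zeta>. Re (poly p (\<sigma> b \<zeta>))) = Re (circle_mean (\<lambda>\<zeta>. poly p (\<sigma> b \<zeta>)))"
    by (intro integral_Re continuous_circle_integrable disc_algebra_continuous A)
  also have "\<dots> = Re (poly p b)" by (simp add: mean_value[OF A] disc_involution_0)
  finally show ?thesis .
qed

text \<open>
  The stopping principle. Let \<open>u\<close> be the harmonic extension of \<open>F\<close>; the mean of \<open>F\<close> after \<open>\<sigma> b\<close> is \<open>u b\<close>.
  The set \<open>{|G| < \<eta>}\<close> contains \<open>0\<close>, and its frontier consists of points of the circle with \<open>|G| \<le> \<eta>\<close> and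
  points of the open disc with \<open>|G| = \<eta>\<close>. The hypotheses bound \<open>u\<close> by \<open>A\<close> at both, and the maximum
  principle bounds \<open>u 0\<close>. The proof replaces \<open>u\<close> by the real part of a polynomial.
\<close>

lemma mean_le_of_stopped_means_le:
  fixes F :: "complex \<Rightarrow> real"
  assumes G: "G \<in> disc_algebra" "cmod (G 0) < \<eta>"
    and F: "continuous_on unit_circle F"
    and circle: "\<And>\<zeta>. cmod \<zeta> = 1 \<Longrightarrow> cmod (G \<zeta>) \<le> \<eta> \<Longrightarrow> F \<zeta> \<le> A"
    and level: "\<And>b. cmod b < 1 \<Longrightarrow> cmod (G b) = \<eta> \<Longrightarrow> circle_mean (\<lambda>\<zeta>. F (\<sigma> b \<zeta>)) \<le> A"
  shows "circle_mean F \<le> A"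
proof (rule field_le_epsilon)
  fix e :: real assume e: "e > 0"
  obtain p where p: "\<And>\<zeta>. cmod \<zeta> = 1 \<Longrightarrow> \<bar>F \<zeta> - Re (poly p \<zeta>)\<bar> < e/2"
    using circle_approx_Re_poly[OF F, of "e/2"] e by auto
  define \<Omega> where "\<Omega> = {z \<in> unit_disc. cmod (G z) < \<eta>}"
  have cG: "continuous_on (cball 0 1) G" by (rule disc_algebra_continuous[OF G(1)])
  have "{z \<in> cball 0 1. cmod (G z) \<le> \<eta>} = cball 0 1 \<inter> (\<lambda>z. cmod (G z)) -` {..\<eta>}" by blast
  then have "closed {z \<in> cball 0 1. cmod (G z) \<le> \<eta>}"
    using continuous_closed_preimage[OF continuous_on_norm[OF cG] closed_cball closed_atMost[of \<eta>]]
    by (simp only:)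
  then have cl: "closure \<Omega> \<subseteq> {z \<in> cball 0 1. cmod (G z) \<le> \<eta>}"
    by (rule closure_minimal[rotated]) (auto simp: \<Omega>_def)
  have "\<Omega> = unit_disc \<inter> (\<lambda>z. cmod (G z)) -` {..<\<eta>}" unfolding \<Omega>_def by blast
  then have op: "open \<Omega>"
    using continuous_open_preimage[OF continuous_on_norm[OF disc_algebra_continuous(3)[OF G(1)]] open_ball open_lessThan[of \<eta>]]
    by (simp only:)
  have cp: "continuous_on unit_circle (\<lambda>z. Re (poly p z))" by (intro continuous_intros)
  have "Re (poly p 0) \<le> A + e/2"
  proof (rule maximum_real_frontier[where f = "poly p" and S = \<Omega> and \<xi> = 0])
    show "0 \<in> \<Omega>" using G(2) by (simp add: \<Omega>_def)
    show "bounded \<Omega>" by (rule bounded_subset[of "ball 0 1"]) (auto simp: \<Omega>_def)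
    fix b assume "b \<in> frontier \<Omega>"
    then have "b \<in> closure \<Omega>" "b \<notin> \<Omega>" using op by (auto simp: frontier_def interior_open)
    then have b: "cmod b \<le> 1" "cmod (G b) \<le> \<eta>" "cmod b < 1 \<Longrightarrow> cmod (G b) = \<eta>"
      using cl by (auto simp: \<Omega>_def)
    show "Re (poly p b) \<le> A + e/2"
    proof (cases "cmod b = 1")
      case True
      then show ?thesis using circle[of b] b p[of b] by linarith
    next
      case False
      then have b1: "cmod b < 1" using b by simp
      have "Re (poly p b) = circle_mean (\<lambda>\<zeta>. Re (poly p (\<sigma> b \<zeta>)))"
        by (simp add: mean_value_Re_poly[OF b1])
      also have "\<dots> \<le> circle_mean (\<lambda>\<zeta>. F (\<sigma> b \<zeta>) + e/2)"
      proof (rule circle_mean_mono)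
        show "continuous_on unit_circle (\<lambda>\<zeta>. Re (poly p (\<sigma> b \<zeta>)))"
          using continuous_circle_involution[OF cp b1] .
        show "continuous_on unit_circle (\<lambda>\<zeta>. F (\<sigma> b \<zeta>) + e/2)"
          by (intro continuous_intros continuous_circle_involution F b1)
        show "Re (poly p (\<sigma> b \<zeta>)) \<le> F (\<sigma> b \<zeta>) + e/2" if "cmod \<zeta> = 1" for \<zeta>
          using p[of "\<sigma> b \<zeta>"] disc_involution_bounds(1)[OF b1 that] by linarith
      qed
      also have "\<dots> = circle_mean (\<lambda>\<zeta>. F (\<sigma> b \<zeta>)) + e/2"
        using circle_mean_add[OF continuous_circle_involution[OF F b1] continuous_on_const]
        by (simp only: circle_mean_const)
      finally show ?thesis using level[OF b1 b(3)[OF b1]] by simp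
    qed
  qed (auto intro!: continuous_intros holomorphic_intros)
  moreover have "circle_mean F \<le> circle_mean (\<lambda>\<zeta>. Re (poly p \<zeta>) + e/2)"
  proof (rule circle_mean_mono)
    show "F \<zeta> \<le> Re (poly p \<zeta>) + e/2" if "cmod \<zeta> = 1" for \<zeta> using p[OF that] by linarith
  qed (intro continuous_intros F)+
  moreover have "circle_mean (\<lambda>\<zeta>. Re (poly p \<zeta>) + e/2) = circle_mean (\<lambda>\<zeta>. Re (poly p \<zeta>)) + e/2"
    using circle_mean_add[OF cp continuous_on_const] by (simp only: circle_mean_const)
  moreover have "circle_mean (\<lambda>\<zeta>. Re (poly p \<zeta>)) = Re (poly p 0)"
  proof -
    have A: "(\<lambda>z. poly p z) \<in> disc_algebra" using disc_algebra_poly[of "\<lambda>z. z" p] by (simp add: disc_algebra_def)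
    have "circle_mean (\<lambda>\<zeta>. Re (poly p \<zeta>)) = Re (circle_mean (poly p))"
      by (intro integral_Re continuous_circle_integrable disc_algebra_continuous A)
    then show ?thesis using mean_value[OF A] by simp
  qed
  ultimately show "circle_mean F \<le> A + e" by linarith
qed

section \<open>Mean oscillation and its tails\<close>

text \<open>
  The tail of \<open>|h|\<close> above \<open>l\<close> is not seen before the path reaches \<open>{|h| = l}\<close>; from there its mean square
  is at most \<open>B\<^sup>2\<close>, and the level set is reached with probability at most \<open>B\<^sup>2 / l\<^sup>2\<close>. To encode that
  probability, the function \<open>F\<close> to which the stopping principle is applied subtracts
  \<open>(B\<^sup>2 / l\<^sup>2) |h|\<^sup>2\<close>, whose mean from a point of the level set is at least \<open>B\<^sup>2\<close> by subharmonicity.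
\<close>

lemma bmo_tail_estimate:
  assumes h: "h \<in> disc_algebra" "h 0 = 0" and B: "0 \<le> B" and l: "0 < l"
    and h2: "circle_L2 h \<le> B"
    and osc: "\<And>b. cmod b < 1 \<Longrightarrow> circle_L2 (\<lambda>z. h (\<sigma> b z) - h b) \<le> B"
  shows "circle_mean (\<lambda>\<zeta>. (max 0 (cmod (h \<zeta>) - l))\<^sup>2) \<le> B^4 / l\<^sup>2"
proof -
  define M where "M \<zeta> = (max 0 (cmod (h \<zeta>) - l))\<^sup>2" for \<zeta>
  define q where "q = B\<^sup>2 / l\<^sup>2"
  define F where "F \<zeta> = M \<zeta> - q * (cmod (h \<zeta>))\<^sup>2" for \<zeta>
  have q: "0 \<le> q" "q * l\<^sup>2 = B\<^sup>2" using l by (auto simp: q_def)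
  have ch: "continuous_on unit_circle h" by (rule disc_algebra_continuous[OF h(1)])
  have cM: "continuous_on unit_circle M" unfolding M_def[abs_def] by (intro continuous_intros ch)
  have cF: "continuous_on unit_circle F" unfolding F_def[abs_def] by (intro continuous_intros ch cM)
  have "circle_mean F \<le> 0"
  proof (rule mean_le_of_stopped_means_le[OF h(1) _ cF])
    show "cmod (h 0) < l" using h l by simp
    show "F \<zeta> \<le> 0" if "cmod (h \<zeta>) \<le> l" for \<zeta>
      using that q(1) by (simp add: F_def M_def)
    fix b assume b: "cmod b < 1" "cmod (h b) = l"
    have A: "(\<lambda>z. h (\<sigma> b z)) \<in> disc_algebra" by (rule disc_algebra_compose_involution[OF h(1) b(1)])
    have "circle_mean (\<lambda>\<zeta>. F (\<sigma> b \<zeta>)) \<le>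
        circle_mean (\<lambda>\<zeta>. (cmod (h (\<sigma> b \<zeta>) - h b))\<^sup>2 - q * (cmod (h (\<sigma> b \<zeta>)))\<^sup>2)"
    proof (rule circle_mean_mono)
      show "F (\<sigma> b \<zeta>) \<le> (cmod (h (\<sigma> b \<zeta>) - h b))\<^sup>2 - q * (cmod (h (\<sigma> b \<zeta>)))\<^sup>2" for \<zeta>
        unfolding F_def M_def using norm_triangle_ineq2[of "h (\<sigma> b \<zeta>)" "h b"] b(2)
        by (intro diff_right_mono power_mono) auto
    qed (intro continuous_circle_involution[OF cF b(1)] continuous_intros disc_algebra_continuous[OF A])+
    also have "\<dots> = (circle_L2 (\<lambda>\<zeta>. h (\<sigma> b \<zeta>) - h b))\<^sup>2 - q * (circle_L2 (\<lambda>\<zeta>. h (\<sigma> b \<zeta>)))\<^sup>2"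
      unfolding circle_L2_power2 circle_mean_cmult[symmetric]
      by (intro circle_mean_diff continuous_intros disc_algebra_continuous[OF A])
    also have "\<dots> \<le> B\<^sup>2 - q * l\<^sup>2"
    proof (intro diff_mono mult_left_mono power_mono osc b circle_L2_nonneg q(1))
      show "l \<le> circle_L2 (\<lambda>\<zeta>. h (\<sigma> b \<zeta>))"
        using cmod_at_0_le_L2[OF A] b(2) by (simp add: disc_involution_0)
    qed (use l in auto)
    finally show "circle_mean (\<lambda>\<zeta>. F (\<sigma> b \<zeta>)) \<le> 0" using q(2) by simp
  qed
  moreover have "circle_mean F = circle_mean M - q * (circle_L2 h)\<^sup>2"
    unfolding F_def[abs_def] circle_L2_power2 circle_mean_cmult[symmetric]
    by (intro circle_mean_diff continuous_intros ch cM)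
  ultimately have "circle_mean M \<le> q * (circle_L2 h)\<^sup>2" by simp
  also have "\<dots> \<le> q * B\<^sup>2" by (intro mult_left_mono power_mono h2 circle_L2_nonneg q)
  also have "\<dots> = B^4 / l\<^sup>2" by (simp add: q_def power4_eq_xxxx power2_eq_square)
  finally show ?thesis by (simp add: M_def)
qed

lemma bmoa_seminorm_le_iff:
  "bmoa_seminorm f \<le> X \<longleftrightarrow> (\<forall>a. cmod a < 1 \<longrightarrow> h2_norm (\<lambda>z. f (\<sigma> a z) - f a) \<le> X)"
  unfolding bmoa_seminorm_def by (auto simp: SUP_le_iff)

lemma bmoa_translate_holomorphic:
  assumes "f holomorphic_on unit_disc" "cmod a < 1"
  shows "(\<lambda>z. f (\<sigma> a z) - f a) holomorphic_on unit_disc"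
proof -
  have "(f \<circ> \<sigma> a) holomorphic_on unit_disc"
    by (rule holomorphic_on_compose_gen[OF disc_involution_holomorphic assms(1)])
       (use assms disc_involution_bounds in auto)
  then show ?thesis by (auto intro!: holomorphic_intros simp: o_def)
qed

text \<open>
  Composition with analytic maps into the disc does not increase mean oscillation: after recentring at
  \<open>H 0\<close> by the involution this is Littlewood subordination.
\<close>

lemma bmoa_oscillation_disc_map:
  assumes f: "f holomorphic_on unit_disc" "bmoa_seminorm f \<le> ennreal B" "0 \<le> B" and H: "H \<in> disc_map"
  shows "circle_L2 (\<lambda>z. f (H z) - f (H 0)) \<le> B"
proof -
  have c: "cmod (H 0) < 1" and Hlt: "\<And>z. cmod z \<le> 1 \<Longrightarrow> cmod (H z) < 1" using H by (auto simp: disc_map_def)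
  have "circle_L2 (\<lambda>z. f (\<sigma> (H 0) (\<sigma> (H 0) (H z))) - f (H 0)) \<le> B"
  proof (rule Littlewood_subordination[where k = "\<lambda>z. f (\<sigma> (H 0) z) - f (H 0)"])
    show "(\<lambda>z. \<sigma> (H 0) (H z)) \<in> disc_map"
      by (rule disc_map_compose[OF disc_involution_holomorphic[OF c] _ H]) (rule disc_involution_bounds[OF c])
  qed (use f c in \<open>auto simp: bmoa_seminorm_le_iff disc_involution_self intro: bmoa_translate_holomorphic\<close>)
  also have "circle_L2 (\<lambda>z. f (\<sigma> (H 0) (\<sigma> (H 0) (H z))) - f (H 0)) = circle_L2 (\<lambda>z. f (H z) - f (H 0))"
    by (rule circle_L2_cong) (simp add: disc_involution_involution c less_imp_le Hlt)
  finally show ?thesis .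
qed

text \<open>
  If \<open>H\<close> stays pseudohyperbolically close to \<open>H 0\<close> in mean square, \<open>f \<circ> H\<close> oscillates little, uniformly over
  bounded sets of \<open>BMOA\<close>. With \<open>G = \<sigma> (H 0) \<circ> H\<close> and \<open>h = f \<circ> H - f (H 0)\<close>, the growth estimate handles \<open>|G| \<le> 1/2\<close>. Where
  \<open>|G| > 1/2\<close>, \<open>|h|\<^sup>2\<close> is at most twice its tail above \<open>l\<close> plus \<open>2 l\<^sup>2\<close>, and \<open>1 \<le> 4 |G|\<^sup>2\<close>. The parameter \<open>l\<close>
  is to be taken large first and then \<open>e\<close> small.
\<close>

lemma bmoa_oscillation_small:
  assumes f: "f holomorphic_on unit_disc" "bmoa_seminorm f \<le> ennreal B" "0 \<le> B" and H: "H \<in> disc_map"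
    and e: "circle_L2 (\<lambda>z. \<sigma> (H 0) (H z)) \<le> e" and l: "0 < l"
  shows "(circle_L2 (\<lambda>z. f (H z) - f (H 0)))\<^sup>2 \<le> (4 * B\<^sup>2 + 8 * l\<^sup>2) * e\<^sup>2 + 2 * B^4 / l\<^sup>2"
proof -
  define h where "h z = f (H z) - f (H 0)" for z
  define G where "G z = \<sigma> (H 0) (H z)" for z
  define M where "M \<zeta> = (max 0 (cmod (h \<zeta>) - l))\<^sup>2" for \<zeta>
  have c: "cmod (H 0) < 1" and Hlt: "\<And>z. cmod z \<le> 1 \<Longrightarrow> cmod (H z) < 1" using H by (auto simp: disc_map_def)
  have h: "h \<in> disc_algebra" unfolding h_def
    by (intro disc_algebra_diff_const disc_algebra_compose_disc_map f H)
  have G: "G \<in> disc_map" unfolding G_def[abs_def]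
    by (rule disc_map_compose[OF disc_involution_holomorphic[OF c] _ H]) (rule disc_involution_bounds[OF c])
  have ch: "continuous_on unit_circle h" "continuous_on unit_circle G"
    using h G by (auto intro: disc_algebra_continuous disc_map_imp_disc_algebra)
  have cM: "continuous_on unit_circle M" unfolding M_def[abs_def] by (intro continuous_intros ch)
  have tail: "circle_mean M \<le> B^4 / l\<^sup>2"
    unfolding M_def
  proof (rule bmo_tail_estimate[OF h _ f(3) l])
    show "circle_L2 (\<lambda>z. h (\<sigma> b z) - h b) \<le> B" if "cmod b < 1" for b
      using bmoa_oscillation_disc_map[OF f disc_map_compose_involution[OF H that]]
      by (simp add: h_def disc_involution_0)
    show "circle_L2 h \<le> B" unfolding h_def[abs_def] by (rule bmoa_oscillation_disc_map[OF f H])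
  qed (simp add: h_def)
  have small: "cmod (h z) \<le> 2 * B * cmod (G z)" if "cmod z = 1" "cmod (G z) \<le> 1/2" for z
  proof -
    have "cmod (f (\<sigma> (H 0) (G z)) - f (H 0)) \<le> B * cmod (G z) / (1 - cmod (G z))"
      by (rule growth_estimate[where k = "\<lambda>z. f (\<sigma> (H 0) z) - f (H 0)"])
         (use f c that in \<open>auto simp: bmoa_seminorm_le_iff disc_involution_0 intro: bmoa_translate_holomorphic\<close>)
    also have "\<dots> \<le> B * cmod (G z) / (1/2)"
      by (rule divide_left_mono) (use that f(3) in auto)
    finally show ?thesis using that(1) by (simp add: G_def h_def disc_involution_involution c less_imp_le Hlt)
  qed
  have pt: "(cmod (h z))\<^sup>2 \<le> (4 * B\<^sup>2 + 8 * l\<^sup>2) * (cmod (G z))\<^sup>2 + 2 * M z" if z: "cmod z = 1" for z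
  proof (cases "cmod (G z) \<le> 1/2")
    case True
    have "(cmod (h z))\<^sup>2 \<le> (2 * B * cmod (G z))\<^sup>2"
      by (intro power_mono small z True) simp
    also have "\<dots> = 4 * B\<^sup>2 * (cmod (G z))\<^sup>2" by (simp add: power2_eq_square)
    also have "\<dots> \<le> (4 * B\<^sup>2 + 8 * l\<^sup>2) * (cmod (G z))\<^sup>2" by (intro mult_right_mono) auto
    also have "\<dots> \<le> (4 * B\<^sup>2 + 8 * l\<^sup>2) * (cmod (G z))\<^sup>2 + 2 * M z" by (simp add: M_def)
    finally show ?thesis .
  next
    case False
    have 1: "1 \<le> 4 * (cmod (G z))\<^sup>2"
      using power_mono[of "1/2" "cmod (G z)" 2] False by (simp add: power2_eq_square)
    have "(cmod (h z))\<^sup>2 \<le> (max 0 (cmod (h z) - l) + l)\<^sup>2" using l by (intro power_mono) auto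
    also have "\<dots> \<le> 2 * M z + 2 * l\<^sup>2"
      using sum_squares_ge_zero[of "max 0 (cmod (h z) - l) - l" 0] unfolding M_def
      by (simp add: power2_eq_square algebra_simps)
    also have "2 * l\<^sup>2 \<le> 2 * l\<^sup>2 * (4 * (cmod (G z))\<^sup>2)"
      using mult_left_mono[OF 1, of "2 * l\<^sup>2"] by simp
    also have "\<dots> \<le> (4 * B\<^sup>2 + 8 * l\<^sup>2) * (cmod (G z))\<^sup>2" by (simp add: algebra_simps)
    finally show ?thesis by simp
  qed
  have "(circle_L2 h)\<^sup>2 \<le> circle_mean (\<lambda>z. (4 * B\<^sup>2 + 8 * l\<^sup>2) * (cmod (G z))\<^sup>2 + 2 * M z)"
    unfolding circle_L2_power2 by (rule circle_mean_mono) (intro continuous_intros ch cM pt; assumption)+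
  also have "\<dots> = circle_mean (\<lambda>z. (4 * B\<^sup>2 + 8 * l\<^sup>2) * (cmod (G z))\<^sup>2) + circle_mean (\<lambda>z. 2 * M z)"
    by (intro circle_mean_add continuous_intros ch cM)
  also have "\<dots> = (4 * B\<^sup>2 + 8 * l\<^sup>2) * (circle_L2 G)\<^sup>2 + 2 * circle_mean M"
    by (simp only: circle_L2_power2 Bochner_Integration.integral_mult_right_zero)
  also have "\<dots> \<le> (4 * B\<^sup>2 + 8 * l\<^sup>2) * e\<^sup>2 + 2 * (B^4 / l\<^sup>2)"
    by (intro add_mono mult_left_mono power_mono tail circle_L2_nonneg) (use e in \<open>auto simp: G_def[abs_def]\<close>)
  finally show ?thesis by (simp add: h_def[abs_def])
qed

section \<open>Consequences of condition (L)\<close>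

lemma self_map_less_1: "\<phi> ` unit_disc \<subseteq> unit_disc \<Longrightarrow> cmod z < 1 \<Longrightarrow> cmod (\<phi> z) < 1"
  by (meson image_subset_iff mem_ball_0)

lemma disc_map_self_compose:
  assumes "\<phi> holomorphic_on unit_disc" "\<phi> ` unit_disc \<subseteq> unit_disc" "K \<in> disc_map"
  shows "(\<lambda>z. \<phi> (K z)) \<in> disc_map"
  by (rule disc_map_compose[OF assms(1) self_map_less_1[OF assms(2)] assms(3)])

lemma translated_dilation_disc_map:
  assumes "cmod a < 1" "0 < r" "r < 1"
  shows "(\<lambda>z. \<sigma> a (of_real r * z)) \<in> disc_map"
  by (rule disc_map_compose[OF disc_involution_holomorphic[OF assms(1)] _ dilation_disc_map[OF assms(2,3)]])
     (rule disc_involution_bounds[OF assms(1)])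

lemma bmoa_seminorm_le_iff_L2:
  assumes "0 \<le> B"
  shows "bmoa_seminorm f \<le> ennreal B \<longleftrightarrow>
    (\<forall>a r. cmod a < 1 \<longrightarrow> 0 < r \<longrightarrow> r < 1 \<longrightarrow> circle_L2 (\<lambda>z. f (\<sigma> a (of_real r * z)) - f a) \<le> B)"
  unfolding bmoa_seminorm_le_iff h2_norm_le_iff[OF assms] by auto

lemma bmoa_seminorm_compose_le:
  assumes phi: "\<phi> holomorphic_on unit_disc" "\<phi> ` unit_disc \<subseteq> unit_disc"
    and f: "f holomorphic_on unit_disc" "bmoa_seminorm f \<le> ennreal B" "0 \<le> B"
  shows "bmoa_seminorm (\<lambda>z. f (\<phi> z)) \<le> ennreal B"
  unfolding bmoa_seminorm_le_iff_L2[OF f(3)]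
proof (intro allI impI)
  fix a :: complex and r :: real assume "cmod a < 1" "0 < r" "r < 1"
  from bmoa_oscillation_disc_map[OF f disc_map_self_compose[OF phi translated_dilation_disc_map[OF this]]]
  show "circle_L2 (\<lambda>z. f (\<phi> (\<sigma> a (of_real r * z))) - f (\<phi> a)) \<le> B"
    by (simp add: disc_involution_0)
qed

text \<open>
  The quantity in (L) at \<open>a\<close> controls every disc map \<open>K\<close> based at \<open>a\<close>: \<open>\<phi> \<circ> K\<close> equals
  \<open>(\<phi> \<circ> \<sigma> a) \<circ> (\<sigma> a \<circ> K)\<close>, and \<open>\<sigma> a \<circ> K\<close> vanishes at \<open>0\<close>.
\<close>

lemma condition_L_disc_map:
  assumes phi: "\<phi> holomorphic_on unit_disc" "\<phi> ` unit_disc \<subseteq> unit_disc" and K: "K \<in> disc_map"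
    and L: "h2_norm (\<sigma> (\<phi> (K 0)) \<circ> \<phi> \<circ> \<sigma> (K 0)) \<le> ennreal e" "0 \<le> e"
  shows "circle_L2 (\<lambda>z. \<sigma> (\<phi> (K 0)) (\<phi> (K z))) \<le> e"
proof -
  have a: "cmod (K 0) < 1" and Klt: "\<And>z. cmod z \<le> 1 \<Longrightarrow> cmod (K z) < 1" using K by (auto simp: disc_map_def)
  have c: "cmod (\<phi> (K 0)) < 1" by (rule self_map_less_1[OF phi(2) a])
  have "circle_L2 (\<lambda>z. (\<sigma> (\<phi> (K 0)) \<circ> \<phi> \<circ> \<sigma> (K 0)) (\<sigma> (K 0) (K z))) \<le> e"
  proof (rule Littlewood_subordination[OF _ L])
    have "\<phi> \<circ> \<sigma> (K 0) holomorphic_on unit_disc"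
      by (rule holomorphic_on_compose_gen[OF disc_involution_holomorphic[OF a] phi(1)])
         (use disc_involution_bounds[OF a] in auto)
    then have "\<sigma> (\<phi> (K 0)) \<circ> (\<phi> \<circ> \<sigma> (K 0)) holomorphic_on unit_disc"
      by (rule holomorphic_on_compose_gen[OF _ disc_involution_holomorphic[OF c]])
         (use disc_involution_bounds[OF a] phi(2) in auto)
    then show "\<sigma> (\<phi> (K 0)) \<circ> \<phi> \<circ> \<sigma> (K 0) holomorphic_on unit_disc" by (simp add: o_assoc)
    show "(\<lambda>z. \<sigma> (K 0) (K z)) \<in> disc_map"
      by (rule disc_map_compose[OF disc_involution_holomorphic[OF a] _ K]) (rule disc_involution_bounds[OF a])
  qed (simp add: disc_involution_self)
  also have "circle_L2 (\<lambda>z. (\<sigma> (\<phi> (K 0)) \<circ> \<phi> \<circ> \<sigma> (K 0)) (\<sigma> (K 0) (K z))) =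
      circle_L2 (\<lambda>z. \<sigma> (\<phi> (K 0)) (\<phi> (K z)))"
    by (rule circle_L2_cong) (simp add: disc_involution_involution a less_imp_le Klt)
  finally show ?thesis .
qed

text \<open>
  The level \<open>\<eta>\<close> at which paths will be stopped; it can be chosen above any given \<open>R < 1\<close>.
\<close>

lemma condition_L_level:
  assumes phi: "\<phi> holomorphic_on unit_disc" "\<phi> ` unit_disc \<subseteq> unit_disc" and L: "condition_L \<phi>"
    and e: "0 < e" and R: "R < 1"
  obtains \<eta> where "R < \<eta>" "0 < \<eta>" "\<eta> < 1"
    "\<And>K. K \<in> disc_map \<Longrightarrow> \<eta> \<le> cmod (\<phi> (K 0)) \<Longrightarrow> circle_L2 (\<lambda>z. \<sigma> (\<phi> (K 0)) (\<phi> (K z))) \<le> e"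
proof -
  obtain \<eta>0 where \<eta>0: "\<eta>0 < 1"
    "\<And>a. cmod a < 1 \<Longrightarrow> \<eta>0 < cmod (\<phi> a) \<Longrightarrow> h2_norm (\<sigma> (\<phi> a) \<circ> \<phi> \<circ> \<sigma> a) < ennreal e"
    using L e unfolding condition_L_def vanishes_as_modulus_tends_to_1_def by auto
  obtain \<eta> where \<eta>: "max (max R \<eta>0) 0 < \<eta>" "\<eta> < 1" using dense[of "max (max R \<eta>0) 0" 1] \<eta>0 R by auto
  show thesis
  proof (rule that[of \<eta>])
    fix K assume K: "K \<in> disc_map" "\<eta> \<le> cmod (\<phi> (K 0))"
    have "cmod (K 0) < 1" using K(1) by (auto simp: disc_map_def)
    then show "circle_L2 (\<lambda>z. \<sigma> (\<phi> (K 0)) (\<phi> (K z))) \<le> e"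
      using \<eta>0(2)[of "K 0"] K \<eta> e by (intro condition_L_disc_map phi K less_imp_le[OF \<eta>0(2)]) auto
  qed (use \<eta> in auto)
qed

lemma condition_L_oscillation_small:
  assumes phi: "\<phi> holomorphic_on unit_disc" "\<phi> ` unit_disc \<subseteq> unit_disc" and L: "condition_L \<phi>"
    and B: "0 \<le> B" and d: "0 < d"
  obtains \<eta> where "0 < \<eta>" "\<eta> < 1"
    "\<And>f K. f holomorphic_on unit_disc \<Longrightarrow> bmoa_seminorm f \<le> ennreal B \<Longrightarrow> K \<in> disc_map \<Longrightarrow>
       \<eta> \<le> cmod (\<phi> (K 0)) \<Longrightarrow> circle_L2 (\<lambda>z. f (\<phi> (K z)) - f (\<phi> (K 0))) \<le> d"
proof -
  \<comment> \<open>makes the second term of the oscillation estimate at most half of \<open>d\<^sup>2\<close>\<close>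
  define l where "l = 2 * B\<^sup>2 / d + 1"
  have l: "l > 0" "2 * B\<^sup>2 / d \<le> l" using B d by (auto simp: l_def add_nonneg_pos)
  have "(2 * B\<^sup>2 / d)\<^sup>2 \<le> l\<^sup>2" by (rule power_mono[OF l(2)]) (use d in simp)
  then have l2: "2 * B^4 / l\<^sup>2 \<le> d\<^sup>2 / 2"
    using l(1) d by (simp add: field_simps power2_eq_square power4_eq_xxxx)
  define q where "q = 4 * B\<^sup>2 + 8 * l\<^sup>2"
  have q: "q > 0" using l by (simp add: q_def add_nonneg_pos)
  \<comment> \<open>makes the first term equal to the other half\<close>
  define e where "e = d / sqrt (2 * q)"
  have e: "e > 0" "q * e\<^sup>2 = d\<^sup>2 / 2" using q d by (auto simp: e_def power_divide)
  obtain \<eta> where \<eta>: "0 < \<eta>" "\<eta> < 1"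
    "\<And>K. K \<in> disc_map \<Longrightarrow> \<eta> \<le> cmod (\<phi> (K 0)) \<Longrightarrow> circle_L2 (\<lambda>z. \<sigma> (\<phi> (K 0)) (\<phi> (K z))) \<le> e"
    by (rule condition_L_level[OF phi L e(1), of 0]) auto
  show thesis
  proof (rule that[OF \<eta>(1,2)])
    fix f K assume f: "f holomorphic_on unit_disc" "bmoa_seminorm f \<le> ennreal B"
      and K: "K \<in> disc_map" "\<eta> \<le> cmod (\<phi> (K 0))"
    have "(circle_L2 (\<lambda>z. f (\<phi> (K z)) - f (\<phi> (K 0))))\<^sup>2 \<le> q * e\<^sup>2 + 2 * B^4 / l\<^sup>2"
      unfolding q_def using bmoa_oscillation_small[OF f B disc_map_self_compose[OF phi K(1)] \<eta>(3)[OF K] l(1)] .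
    also have "\<dots> \<le> d\<^sup>2" using l2 e(2) by simp
    finally show "circle_L2 (\<lambda>z. f (\<phi> (K z)) - f (\<phi> (K 0))) \<le> d"
      by (rule power2_le_imp_le) (use d in simp)
  qed
qed

text \<open>
  The estimate behind sufficiency. Base points with \<open>|\<phi>| \<ge> \<eta>\<close> are covered by the oscillation estimate
  alone. For the others, stop \<open>H = \<phi> \<circ> K\<close> at level \<open>\<eta>\<close>: the mean square of \<open>f \<circ> H\<close> seen from a
  point \<open>b\<close> of the level set is small because both \<open>f (H b)\<close> and the oscillation from \<open>b\<close> are small.
\<close>

lemma condition_L_compose_small:
  assumes phi: "\<phi> holomorphic_on unit_disc" "\<phi> ` unit_disc \<subseteq> unit_disc" and L: "condition_L \<phi>"
    and B: "0 \<le> B" and d: "0 < d"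
  obtains \<eta> \<kappa> where "0 < \<eta>" "\<eta> < 1" "0 < \<kappa>"
    "\<And>f. f holomorphic_on unit_disc \<Longrightarrow> bmoa_seminorm f \<le> ennreal B \<Longrightarrow>
       (\<And>w. cmod w \<le> \<eta> \<Longrightarrow> cmod (f w) \<le> \<kappa>) \<Longrightarrow> bmoa_seminorm (\<lambda>z. f (\<phi> z)) \<le> ennreal d"
proof -
  have d4: "d / 4 > 0" using d by simp
  obtain \<eta> where \<eta>: "0 < \<eta>" "\<eta> < 1" and osc:
    "\<And>f K. f holomorphic_on unit_disc \<Longrightarrow> bmoa_seminorm f \<le> ennreal B \<Longrightarrow> K \<in> disc_map \<Longrightarrow>
       \<eta> \<le> cmod (\<phi> (K 0)) \<Longrightarrow> circle_L2 (\<lambda>z. f (\<phi> (K z)) - f (\<phi> (K 0))) \<le> d / 4"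
    by (rule condition_L_oscillation_small[OF phi L B d4]) blast
  show thesis
  proof (rule that[OF \<eta> d4])
    fix f assume f: "f holomorphic_on unit_disc" "bmoa_seminorm f \<le> ennreal B"
      and small: "\<And>w. cmod w \<le> \<eta> \<Longrightarrow> cmod (f w) \<le> d / 4"
    have "circle_L2 (\<lambda>z. f (\<phi> (K z)) - f (\<phi> (K 0))) \<le> d" if K: "K \<in> disc_map" for K
    proof (cases "\<eta> \<le> cmod (\<phi> (K 0))")
      case True
      then show ?thesis using osc[OF f K] d by simp
    next
      case False
      define H where "H z = \<phi> (K z)" for z
      have H: "H \<in> disc_map" unfolding H_def[abs_def] by (rule disc_map_self_compose[OF phi K])
      have fH: "(\<lambda>z. f (H z)) \<in> disc_algebra" by (rule disc_algebra_compose_disc_map[OF f(1) H])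
      have cfH: "continuous_on unit_circle (\<lambda>z. f (H z))" by (rule disc_algebra_continuous[OF fH])
      have "circle_mean (\<lambda>z. (cmod (f (H z)))\<^sup>2) \<le> (d/2)\<^sup>2"
      proof (rule mean_le_of_stopped_means_le[OF disc_map_imp_disc_algebra[OF H]])
        show "cmod (H 0) < \<eta>" using False by (simp add: H_def)
        show "continuous_on unit_circle (\<lambda>z. (cmod (f (H z)))\<^sup>2)" by (intro continuous_intros cfH)
        show "(cmod (f (H z)))\<^sup>2 \<le> (d/2)\<^sup>2" if "cmod (H z) \<le> \<eta>" for z
          using small[OF that] d by (intro power_mono) auto
        fix b assume b: "cmod b < 1" "cmod (H b) = \<eta>"
        have Hb: "continuous_on unit_circle (\<lambda>z. f (H (\<sigma> b z)))"
          by (rule continuous_circle_involution[OF cfH b(1)])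
        have "circle_L2 (\<lambda>z. f (H (\<sigma> b z)) - f (H b)) \<le> d / 4"
          using osc[OF f disc_map_compose_involution[OF K b(1)]] b(2) by (simp add: H_def disc_involution_0)
        moreover have "circle_L2 (\<lambda>z. f (H b)) \<le> d / 4"
          by (rule circle_L2_le_sup) (use small[of "H b"] b d in auto)
        moreover have "circle_L2 (\<lambda>z. (f (H (\<sigma> b z)) - f (H b)) + f (H b)) \<le>
            circle_L2 (\<lambda>z. f (H (\<sigma> b z)) - f (H b)) + circle_L2 (\<lambda>z. f (H b))"
          by (rule circle_L2_add_le) (intro continuous_intros Hb)+
        ultimately have "circle_L2 (\<lambda>z. f (H (\<sigma> b z))) \<le> d / 2" by simp
        then have "(circle_L2 (\<lambda>z. f (H (\<sigma> b z))))\<^sup>2 \<le> (d/2)\<^sup>2" by (intro power_mono circle_L2_nonneg)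
        then show "circle_mean (\<lambda>z. (cmod (f (H (\<sigma> b z))))\<^sup>2) \<le> (d/2)\<^sup>2" by (simp only: circle_L2_power2)
      qed
      then have "circle_L2 (\<lambda>z. f (H z)) \<le> d/2"
        unfolding circle_L2_def using d by (intro real_le_lsqrt) auto
      moreover have "circle_L2 (\<lambda>z. f (H z) - f (H 0)) \<le> circle_L2 (\<lambda>z. f (H z)) + d / 4"
        by (rule circle_L2_approx)
           (use small[of "H 0"] False d in \<open>auto simp: H_def intro!: continuous_intros cfH[unfolded H_def]\<close>)
      ultimately show ?thesis using d by (simp add: H_def)
    qed
    from this[OF translated_dilation_disc_map]
    show "bmoa_seminorm (\<lambda>z. f (\<phi> z)) \<le> ennreal d"
      unfolding bmoa_seminorm_le_iff_L2[OF less_imp_le[OF d]] by (auto simp: disc_involution_0)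
  qed
qed

text \<open>
  Points close enough to the circle have pseudohyperbolic distance at least \<open>1/2\<close> from the
  circle of radius \<open>\<eta>\<close>.
\<close>

lemma disc_involution_far_from_level:
  assumes "0 \<le> \<eta>" "\<eta> < 1"
  obtains t where "t < 1" "\<And>c w. cmod c = \<eta> \<Longrightarrow> cmod w < 1 \<Longrightarrow> t < cmod w \<Longrightarrow> 1/2 \<le> cmod (\<sigma> c w)"
proof -
  \<comment> \<open>solves \<open>(1 - \<eta>\<^sup>2) q / (1 - \<eta>)\<^sup>2 = 1 - (1/2)\<^sup>2\<close>; \<open>1 - \<eta>\<close> is a lower bound for \<open>|1 - cnj c w|\<close>\<close>
  define q where "q = 3/4 * ((1 - \<eta>)\<^sup>2 / (1 - \<eta>\<^sup>2))"
  have e2: "\<eta>\<^sup>2 < 1" using assms by (simp add: power_less_one_iff abs_square_less_1)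
  have cancel: "3/4 * (x / y) * y = 3/4 * x" if "y \<noteq> 0" for x y :: real using that by simp
  have q: "0 < q" "q * (1 - \<eta>\<^sup>2) = 3/4 * (1 - \<eta>)\<^sup>2"
    unfolding q_def using assms e2 cancel[of "1 - \<eta>\<^sup>2"] by auto
  show thesis
  proof (rule that[of "sqrt (1 - q)"])
    show "sqrt (1 - q) < 1" using q by simp
    fix c w assume c: "cmod c = \<eta>" and w: "cmod w < 1" and sw: "sqrt (1 - q) < cmod w"
    have "1 - q \<le> (cmod w)\<^sup>2" using sw by (metis less_imp_le norm_ge_zero sqrt_le_D)
    then have "(1 - \<eta>\<^sup>2) * (1 - (cmod w)\<^sup>2) \<le> (1 - \<eta>\<^sup>2) * q" using e2 by (intro mult_left_mono) auto
    also have "\<dots> = 3/4 * (1 - \<eta>)\<^sup>2" using q(2) by (simp add: mult.commute)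
    also have "\<dots> \<le> 3/4 * (cmod (1 - cnj c * w))\<^sup>2"
    proof (intro mult_left_mono power_mono)
      have "\<eta> * cmod w \<le> \<eta> * 1" using w assms by (intro mult_left_mono) auto
      then show "1 - \<eta> \<le> cmod (1 - cnj c * w)"
        using norm_triangle_ineq2[of 1 "cnj c * w"] c by (simp add: norm_mult)
    qed (use assms in auto)
    finally have "(1 - \<eta>\<^sup>2) * (1 - (cmod w)\<^sup>2) / (cmod (1 - cnj c * w))\<^sup>2 \<le> 3/4"
      using one_minus_cnj_mult_nonzero[of c w] c w assms by (simp add: divide_le_eq)
    then have "1 - (cmod (\<sigma> c w))\<^sup>2 \<le> 3/4"
      using one_minus_disc_involution[of c w] c w assms by simp
    then have "(1/2)\<^sup>2 \<le> (cmod (\<sigma> c w))\<^sup>2" by (simp add: power2_eq_square)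
    then show "1/2 \<le> cmod (\<sigma> c w)" by (rule power2_le_imp_le) simp
  qed
qed

lemma sets_superlevel_circle:
  fixes F :: "complex \<Rightarrow> real"
  assumes "continuous_on unit_circle F"
  shows "{\<zeta> \<in> unit_circle. t < F \<zeta>} \<in> sets circle_lebesgue"
proof -
  have "F \<in> borel_measurable circle_lebesgue"
    by (rule borel_measurable_integrable[OF continuous_circle_integrable[OF assms]])
  then have "{\<zeta> \<in> space circle_lebesgue. t < F \<zeta>} \<in> sets circle_lebesgue" by measurable
  then show ?thesis by (simp add: space_circle_lebesgue Collect_conj_eq)
qed

lemma emeasure_circle_le_mean:
  fixes F :: "complex \<Rightarrow> real"
  assumes F: "continuous_on unit_circle F" and A: "A \<in> sets circle_lebesgue"
    and le: "\<And>\<zeta>. cmod \<zeta> = 1 \<Longrightarrow> indicator A \<zeta> \<le> F \<zeta>"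
  shows "emeasure circle_lebesgue A \<le> ennreal (circle_mean F)"
proof -
  interpret prob_space circle_lebesgue by (rule prob_space_circle_lebesgue)
  have "measure circle_lebesgue A = circle_mean (indicator A)"
    using A sets.sets_into_space[OF A] by (simp add: Int_absorb2)
  also have "\<dots> \<le> circle_mean F"
    by (rule integral_mono)
       (use A le F in \<open>auto simp: space_circle_lebesgue emeasure_eq_measure intro: continuous_circle_integrable\<close>)
  finally show ?thesis by (simp add: emeasure_eq_measure ennreal_leI)
qed

text \<open>
  The interior form of the first assertion, with \<open>K\<close> covering all circles of radius \<open>r < 1\<close> and all base
  points with \<open>|\<phi>| \<le> R\<close> at once. From a point of the level set \<open>{|\<phi> \<circ> K| = \<eta>}\<close>, reaching modulus beyond \<open>s\<close> means
  moving by pseudohyperbolic distance at least \<open>1/2\<close>, which (L) and Chebyshev's inequality make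
  unlikely.
\<close>

lemma condition_L_superlevel_small:
  assumes phi: "\<phi> holomorphic_on unit_disc" "\<phi> ` unit_disc \<subseteq> unit_disc" and L: "condition_L \<phi>"
    and R: "R < 1" and d: "0 < d"
  obtains t where "t < 1"
    "\<And>K. K \<in> disc_map \<Longrightarrow> cmod (\<phi> (K 0)) \<le> R \<Longrightarrow>
       emeasure circle_lebesgue {\<zeta> \<in> unit_circle. t < cmod (\<phi> (K \<zeta>))} \<le> ennreal d"
proof -
  define e where "e = sqrt d / 2"
  have e: "e > 0" "4 * e\<^sup>2 = d" using d by (auto simp: e_def power_divide)
  obtain \<eta> where \<eta>: "R < \<eta>" "0 < \<eta>" "\<eta> < 1" and osc:
    "\<And>K. K \<in> disc_map \<Longrightarrow> \<eta> \<le> cmod (\<phi> (K 0)) \<Longrightarrow> circle_L2 (\<lambda>z. \<sigma> (\<phi> (K 0)) (\<phi> (K z))) \<le> e"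
    by (rule condition_L_level[OF phi L e(1) R]) auto
  obtain t0 where t0: "t0 < 1" "\<And>c w. cmod c = \<eta> \<Longrightarrow> cmod w < 1 \<Longrightarrow> t0 < cmod w \<Longrightarrow> 1/2 \<le> cmod (\<sigma> c w)"
    by (rule disc_involution_far_from_level[of \<eta>]) (use \<eta> in auto)
  define s where "s = max t0 \<eta>"
  define t where "t = (1 + s) / 2"
  have s: "s < 1" "t0 \<le> s" "\<eta> \<le> s" using t0 \<eta> by (auto simp: s_def)
  have t: "s < t" "t < 1" using s by (auto simp: t_def)
  \<comment> \<open>continuous cutoff: \<open>0\<close> up to \<open>s\<close>, \<open>1\<close> from \<open>t\<close> on\<close>
  define \<Phi> where "\<Phi> x = min 1 (max 0 ((x - s) / (t - s)))" for x :: real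
  have \<Phi>: "x \<le> s \<Longrightarrow> \<Phi> x = 0" "\<Phi> x \<le> 1" "t \<le> x \<Longrightarrow> \<Phi> x = 1" "0 \<le> \<Phi> x" for x
    using t by (auto simp: \<Phi>_def divide_nonpos_pos min_def max_def divide_simps)
  show thesis
  proof (rule that[OF t(2)])
    fix K assume K: "K \<in> disc_map" "cmod (\<phi> (K 0)) \<le> R"
    define H where "H z = \<phi> (K z)" for z
    have H: "H \<in> disc_map" unfolding H_def[abs_def] by (rule disc_map_self_compose[OF phi K(1)])
    have Hlt: "cmod (H z) < 1" if "cmod z \<le> 1" for z using H that by (auto simp: disc_map_def)
    have cH: "continuous_on unit_circle H" by (rule disc_algebra_continuous[OF disc_map_imp_disc_algebra[OF H]])
    have cF: "continuous_on unit_circle (\<lambda>z. \<Phi> (cmod (H z)))"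
      unfolding \<Phi>_def by (intro continuous_intros cH) (use t in auto)
    have "circle_mean (\<lambda>z. \<Phi> (cmod (H z))) \<le> d"
    proof (rule mean_le_of_stopped_means_le[OF disc_map_imp_disc_algebra[OF H] _ cF])
      show "cmod (H 0) < \<eta>" using K \<eta> by (simp add: H_def)
      show "\<Phi> (cmod (H z)) \<le> d" if "cmod (H z) \<le> \<eta>" for z
        using \<Phi>(1)[of "cmod (H z)"] that s d by simp
      fix b assume b: "cmod b < 1" "cmod (H b) = \<eta>"
      have Hb: "(\<lambda>z. H (\<sigma> b z)) \<in> disc_map" by (rule disc_map_compose_involution[OF H b(1)])
      have A: "(\<lambda>z. \<sigma> (H b) (H (\<sigma> b z))) \<in> disc_algebra"
        by (rule disc_algebra_compose_disc_map[OF disc_involution_holomorphic Hb]) (use b \<eta> in auto)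
      have "circle_mean (\<lambda>z. \<Phi> (cmod (H (\<sigma> b z)))) \<le> circle_mean (\<lambda>z. 4 * (cmod (\<sigma> (H b) (H (\<sigma> b z))))\<^sup>2)"
      proof (rule circle_mean_mono)
        fix z :: complex assume z: "cmod z = 1"
        show "\<Phi> (cmod (H (\<sigma> b z))) \<le> 4 * (cmod (\<sigma> (H b) (H (\<sigma> b z))))\<^sup>2"
        proof (cases "cmod (H (\<sigma> b z)) \<le> s")
          case False
          have "1/2 \<le> cmod (\<sigma> (H b) (H (\<sigma> b z)))"
            by (rule t0(2)[OF b(2)]) (use False s Hlt z b disc_involution_bounds(3)[OF b(1)] in auto)
          from power_mono[OF this, of 2] have "1 \<le> 4 * (cmod (\<sigma> (H b) (H (\<sigma> b z))))\<^sup>2"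
            by (simp add: power2_eq_square)
          then show ?thesis using \<Phi>(2)[of "cmod (H (\<sigma> b z))"] by linarith
        qed (simp add: \<Phi>)
      qed (intro continuous_circle_involution[OF cF b(1)] continuous_intros disc_algebra_continuous[OF A])+
      also have "\<dots> = 4 * (circle_L2 (\<lambda>z. \<sigma> (H b) (H (\<sigma> b z))))\<^sup>2"
        by (simp only: circle_mean_cmult circle_L2_power2)
      also have "\<dots> \<le> 4 * e\<^sup>2"
      proof (intro mult_left_mono power_mono circle_L2_nonneg)
        show "circle_L2 (\<lambda>z. \<sigma> (H b) (H (\<sigma> b z))) \<le> e"
          using osc[OF disc_map_compose_involution[OF K(1) b(1)]] b(2) by (simp add: H_def disc_involution_0)
      qed simp
      finally show "circle_mean (\<lambda>z. \<Phi> (cmod (H (\<sigma> b z)))) \<le> d"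
        using e(2) by simp
    qed
    then have "ennreal (circle_mean (\<lambda>z. \<Phi> (cmod (H z)))) \<le> ennreal d" by (rule ennreal_leI)
    moreover have "emeasure circle_lebesgue {\<zeta> \<in> unit_circle. t < cmod (H \<zeta>)} \<le>
        ennreal (circle_mean (\<lambda>z. \<Phi> (cmod (H z))))"
    proof (rule emeasure_circle_le_mean[OF cF])
      show "{\<zeta> \<in> unit_circle. t < cmod (H \<zeta>)} \<in> sets circle_lebesgue"
        by (intro sets_superlevel_circle continuous_intros cH)
      show "indicator {\<zeta> \<in> unit_circle. t < cmod (H \<zeta>)} \<zeta> \<le> \<Phi> (cmod (H \<zeta>))" for \<zeta>
        using \<Phi>[of "cmod (H \<zeta>)"] by (auto simp: indicator_def)
    qed
    ultimately show "emeasure circle_lebesgue {\<zeta> \<in> unit_circle. t < cmod (\<phi> (K \<zeta>))} \<le> ennreal d"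
      unfolding H_def by (rule order_trans[rotated])
  qed
qed

section \<open>Normal families in BMOA\<close>

lemma bmoa_seminorm_cong:
  assumes "\<And>z. cmod z < 1 \<Longrightarrow> f z = g z"
  shows "bmoa_seminorm f = bmoa_seminorm g"
  unfolding bmoa_seminorm_def
  by (intro SUP_cong refl h2_norm_cong arg_cong[where f = cmod] arg_cong2[where f = "(-)"] assms)
     (auto simp: disc_involution_bounds)

lemma bmoa_growth:
  assumes f: "f holomorphic_on unit_disc" "bmoa_seminorm f \<le> ennreal B" "0 \<le> B" and w: "cmod w < 1"
  shows "cmod (f w - f 0) \<le> B * cmod w / (1 - cmod w)"
proof -
  have "cmod (f (\<sigma> 0 (- w)) - f 0) \<le> B * cmod (- w) / (1 - cmod (- w))"
    by (rule growth_estimate[where k = "\<lambda>z. f (\<sigma> 0 z) - f 0"])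
       (use f w in \<open>auto simp: bmoa_seminorm_le_iff disc_involution_0 intro: bmoa_translate_holomorphic\<close>)
  then show ?thesis by (simp add: disc_involution_def)
qed

lemma BMOA_holomorphic: "f \<in> BMOA \<Longrightarrow> f holomorphic_on unit_disc"
  and BMOA_continuous: "f \<in> BMOA \<Longrightarrow> continuous_on unit_disc f"
  by (auto simp: BMOA_def holomorphic_on_imp_continuous_on)

lemma restrict_in_BMOA:
  assumes "f holomorphic_on unit_disc" "bmoa_seminorm f \<le> ennreal B"
  shows "restrict f unit_disc \<in> BMOA"
proof -
  have "restrict f unit_disc holomorphic_on unit_disc"
    using holomorphic_cong[OF refl, of unit_disc "restrict f unit_disc" f] assms(1) by simp
  moreover have "bmoa_seminorm (restrict f unit_disc) < \<infinity>"
    using assms(2) bmoa_seminorm_cong[of "restrict f unit_disc" f] by (auto simp: order.strict_trans1)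
  ultimately show ?thesis by (simp add: BMOA_def)
qed

lemma bmoa_seminorm_diff_le:
  assumes "f \<in> BMOA" "g \<in> BMOA" "bmoa_seminorm f \<le> ennreal B" "bmoa_seminorm g \<le> ennreal C" "0 \<le> B" "0 \<le> C"
  shows "bmoa_seminorm (\<lambda>z. f z - g z) \<le> ennreal (B + C)"
proof -
  have "bmoa_seminorm (\<lambda>z. f z + (- g z)) \<le> bmoa_seminorm f + bmoa_seminorm (\<lambda>z. - g z)"
    by (intro bmoa_seminorm_triangle continuous_on_minus BMOA_continuous assms)
  also have "bmoa_seminorm (\<lambda>z. - g z) = bmoa_seminorm g"
    using bmoa_seminorm_minus[of "\<lambda>_. 0" g] by simp
  also have "bmoa_seminorm f + bmoa_seminorm g \<le> ennreal B + ennreal C" by (intro add_mono assms)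
  finally show ?thesis using assms by (simp add: ennreal_plus)
qed

lemma bmoa_dist_le:
  assumes "bmoa_seminorm (\<lambda>z. f z - g z) \<le> ennreal C" "0 \<le> C"
  shows "bmoa_dist f g \<le> cmod (f 0 - g 0) + C"
  using enn2real_mono[OF assms(1)] assms(2) by (simp add: bmoa_dist_def bmoa_norm_def)

lemma bmoa_seminorm_le_dist:
  assumes "f \<in> BMOA" "g \<in> BMOA"
  shows "bmoa_seminorm (\<lambda>z. f z - g z) \<le> ennreal (bmoa_dist f g)" "cmod (f 0 - g 0) \<le> bmoa_dist f g"
proof -
  have "bmoa_seminorm (\<lambda>z. f z - g z) = ennreal (enn2real (bmoa_seminorm (\<lambda>z. f z - g z)))"
    using bmoa_seminorm_diff_finite[OF assms] by simp
  also have "\<dots> \<le> ennreal (bmoa_dist f g)" by (intro ennreal_leI) (simp add: bmoa_dist_def bmoa_norm_def)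
  finally show "bmoa_seminorm (\<lambda>z. f z - g z) \<le> ennreal (bmoa_dist f g)" .
  show "cmod (f 0 - g 0) \<le> bmoa_dist f g" by (simp add: bmoa_dist_def bmoa_norm_def)
qed

lemma BMOA_mbounded_bound:
  assumes "Metric_space.mbounded BMOA bmoa_dist S"
  obtains C where "0 \<le> C" "S \<subseteq> BMOA" "\<And>f. f \<in> S \<Longrightarrow> bmoa_seminorm f \<le> ennreal C" "\<And>f. f \<in> S \<Longrightarrow> cmod (f 0) \<le> C"
proof -
  interpret Metric_space BMOA bmoa_dist by (rule Metric_space_BMOA)
  obtain x B where B: "0 < B" "S \<subseteq> mcball x B" using assms unfolding mbounded_pos by blast
  define C where "C = B + enn2real (bmoa_seminorm x) + cmod (x 0)"
  show thesis
  proof (rule that)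
    show "0 \<le> C" using B by (simp add: C_def)
    show "S \<subseteq> BMOA" using B by (auto simp: in_mcball)
    fix f assume "f \<in> S"
    then have f: "f \<in> BMOA" "x \<in> BMOA" "bmoa_dist f x \<le> B" using B by (auto simp: in_mcball commute)
    have x: "bmoa_seminorm x = ennreal (enn2real (bmoa_seminorm x))"
      using f(2) by (simp add: BMOA_def)
    have "bmoa_seminorm f = bmoa_seminorm (\<lambda>z. (f z - x z) + x z)" by simp
    also have "\<dots> \<le> bmoa_seminorm (\<lambda>z. f z - x z) + bmoa_seminorm x"
      by (intro bmoa_seminorm_triangle continuous_intros BMOA_continuous f)
    also have "\<dots> \<le> ennreal B + ennreal (enn2real (bmoa_seminorm x))"
      using bmoa_seminorm_le_dist(1)[OF f(1,2)] ennreal_leI[OF f(3)] x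
      by (intro add_mono) (auto intro: order_trans)
    also have "\<dots> = ennreal (B + enn2real (bmoa_seminorm x))" using B by (intro ennreal_plus[symmetric]) auto
    also have "\<dots> \<le> ennreal C" by (intro ennreal_leI) (simp add: C_def)
    finally show "bmoa_seminorm f \<le> ennreal C" .
    have "cmod (f 0) \<le> cmod (f 0 - x 0) + cmod (x 0)" using norm_triangle_ineq[of "f 0 - x 0" "x 0"] by simp
    also have "\<dots> \<le> B + cmod (x 0)" using bmoa_seminorm_le_dist(2)[OF f(1,2)] f(3) by simp
    also have "\<dots> \<le> C" by (simp add: C_def)
    finally show "cmod (f 0) \<le> C" .
  qed
qed

text \<open>
  The seminorm is a supremum of means over compact circles, and each of them is continuous under locally
  uniform convergence.
\<close>

lemma bmoa_seminorm_uniform_limit: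
  assumes f: "\<And>n. f n holomorphic_on unit_disc" "\<And>n. bmoa_seminorm (f n) \<le> ennreal C" "0 \<le> C"
    and g: "g holomorphic_on unit_disc"
    and lim: "\<And>K. compact K \<Longrightarrow> K \<subseteq> unit_disc \<Longrightarrow> uniform_limit K f g sequentially"
  shows "bmoa_seminorm g \<le> ennreal C"
  unfolding bmoa_seminorm_le_iff_L2[OF f(3)]
proof (intro allI impI)
  fix a :: complex and r :: real assume ar: "cmod a < 1" "0 < r" "r < 1"
  define K where "K z = \<sigma> a (of_real r * z)" for z
  have K: "K \<in> disc_map" unfolding K_def[abs_def] by (rule translated_dilation_disc_map[OF ar])
  define X where "X = insert a (K ` cball 0 1)"
  have X: "compact X" "X \<subseteq> unit_disc" unfolding X_def
    using K ar by (auto intro!: compact_continuous_image compact_insert simp: disc_map_def disc_algebra_def)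
  show "circle_L2 (\<lambda>z. g (\<sigma> a (of_real r * z)) - g a) \<le> C"
  proof (rule field_le_epsilon)
    fix e :: real assume e: "e > 0"
    have "\<forall>\<^sub>F n in sequentially. \<forall>x\<in>X. dist (f n x) (g x) < e/2"
      by (rule uniform_limitD[OF lim[OF X]]) (use e in simp)
    then obtain n where n: "\<And>x. x \<in> X \<Longrightarrow> dist (f n x) (g x) < e/2"
      using eventually_happens'[OF sequentially_bot] by blast
    have c: "continuous_on unit_circle (\<lambda>z. h (K z) - h a)" if "h holomorphic_on unit_disc" for h
      by (intro continuous_intros disc_algebra_continuous disc_algebra_compose_disc_map that K)
    have "circle_L2 (\<lambda>z. g (K z) - g a) \<le> circle_L2 (\<lambda>z. f n (K z) - f n a) + e"
    proof (rule circle_L2_approx[OF c[OF g] c[OF f(1)]])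
      fix \<zeta> :: complex assume "cmod \<zeta> = 1"
      then have "K \<zeta> \<in> X" "a \<in> X" by (auto simp: X_def)
      from n[OF this(1)] n[OF this(2)]
      have "cmod (g (K \<zeta>) - f n (K \<zeta>)) < e/2" "cmod (f n a - g a) < e/2"
        by (simp_all add: dist_norm norm_minus_commute)
      then have "cmod ((g (K \<zeta>) - f n (K \<zeta>)) + (f n a - g a)) \<le> e"
        using norm_triangle_ineq[of "g (K \<zeta>) - f n (K \<zeta>)" "f n a - g a"] by linarith
      moreover have "(g (K \<zeta>) - f n (K \<zeta>)) + (f n a - g a) = g (K \<zeta>) - g a - (f n (K \<zeta>) - f n a)" by simp
      ultimately show "cmod (g (K \<zeta>) - g a - (f n (K \<zeta>) - f n a)) \<le> e" by (simp only:)
    qed (use e in simp)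
    also have "circle_L2 (\<lambda>z. f n (K z) - f n a) \<le> C"
      using f(2)[of n] ar unfolding bmoa_seminorm_le_iff_L2[OF f(3)] K_def by blast
    finally show "circle_L2 (\<lambda>z. g (\<sigma> a (of_real r * z)) - g a) \<le> C + e" by (simp add: K_def)
  qed
qed

text \<open>
  The growth estimate bounds the sequence locally uniformly, so Montel's theorem applies, and the limit
  stays in the ball by semicontinuity.
\<close>

lemma BMOA_normal_family:
  assumes f: "\<And>n. f n \<in> BMOA" "\<And>n. bmoa_seminorm (f n) \<le> ennreal C" "\<And>n. cmod (f n 0) \<le> C" "0 \<le> C"
  obtains g and r :: "nat \<Rightarrow> nat" where "g \<in> BMOA" "bmoa_seminorm g \<le> ennreal C" "strict_mono r"
    "\<And>K. compact K \<Longrightarrow> K \<subseteq> unit_disc \<Longrightarrow> uniform_limit K (\<lambda>n. f (r n)) g sequentially"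
proof -
  define \<H> where "\<H> = {h. h holomorphic_on unit_disc \<and>
     (\<forall>z. cmod z < 1 \<longrightarrow> cmod (h z) \<le> C + C * cmod z / (1 - cmod z))}"
  have rng: "range f \<subseteq> \<H>"
  proof -
    have "cmod (f n z) \<le> C + C * cmod z / (1 - cmod z)" if "cmod z < 1" for n z
      using norm_triangle_ineq[of "f n 0" "f n z - f n 0"] f(3)[of n]
        bmoa_growth[OF BMOA_holomorphic[OF f(1)] f(2,4) that, of n] by simp
    then show ?thesis using BMOA_holomorphic[OF f(1)] by (auto simp: \<H>_def)
  qed
  have bnd: "\<exists>B. \<forall>h\<in>\<H>. \<forall>z\<in>K. norm (h z) \<le> B" if K: "compact K" "K \<subseteq> unit_disc" for K
  proof -
    have "continuous_on K (\<lambda>z. C + C * cmod z / (1 - cmod z))"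
      using K(2) by (intro continuous_intros) auto
    from compact_imp_bounded[OF compact_continuous_image[OF this K(1)]]
    obtain B where "\<And>z. z \<in> K \<Longrightarrow> \<bar>C + C * cmod z / (1 - cmod z)\<bar> \<le> B"
      by (auto simp: bounded_iff)
    moreover have "norm (h z) \<le> C + C * cmod z / (1 - cmod z)" if "h \<in> \<H>" "z \<in> K" for h z
      using that K(2) by (auto simp: \<H>_def)
    ultimately have "norm (h z) \<le> B" if "h \<in> \<H>" "z \<in> K" for h z
      using that abs_ge_self order_trans by meson
    then show ?thesis by blast
  qed
  obtain g r where gr: "g holomorphic_on unit_disc" "strict_mono (r :: nat \<Rightarrow> nat)"
    "\<And>K. compact K \<Longrightarrow> K \<subseteq> unit_disc \<Longrightarrow> uniform_limit K (f \<circ> r) g sequentially"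
    by (rule Montel[OF open_ball _ bnd rng, of 0 1]) (auto simp: \<H>_def)
  define G where "G = restrict g unit_disc"
  have lim: "uniform_limit K (\<lambda>n. f (r n)) g sequentially" if "compact K" "K \<subseteq> unit_disc" for K
    using gr(3)[OF that] by (simp add: o_def)
  have sg: "bmoa_seminorm g \<le> ennreal C"
    by (rule bmoa_seminorm_uniform_limit[OF BMOA_holomorphic[OF f(1)] f(2,4) gr(1) lim])
  show thesis
  proof (rule that[of G r])
    show "G \<in> BMOA" unfolding G_def by (rule restrict_in_BMOA[OF gr(1) sg])
    show "bmoa_seminorm G \<le> ennreal C" using sg bmoa_seminorm_cong[of G g] by (simp add: G_def)
    show "uniform_limit K (\<lambda>n. f (r n)) G sequentially" if "compact K" "K \<subseteq> unit_disc" for K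
    proof (rule uniform_limit_cong'[THEN iffD1, OF _ _ lim[OF that]])
      show "g x = G x" if "x \<in> K" for x using that \<open>K \<subseteq> unit_disc\<close> by (auto simp: G_def)
    qed simp
  qed (rule gr(2))
qed

section \<open>Compactness of the composition operator\<close>

lemma composition_operator_BMOA:
  assumes phi: "\<phi> holomorphic_on unit_disc" "\<phi> ` unit_disc \<subseteq> unit_disc" and f: "f \<in> BMOA"
  shows "composition_operator \<phi> f \<in> BMOA"
proof -
  have "bmoa_seminorm f \<le> ennreal (enn2real (bmoa_seminorm f))" using f by (simp add: BMOA_def)
  from bmoa_seminorm_compose_le[OF phi BMOA_holomorphic[OF f] this]
  have "bmoa_seminorm (f \<circ> \<phi>) \<le> ennreal (enn2real (bmoa_seminorm f))" by (simp add: o_def)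
  then show ?thesis unfolding composition_operator_def
    by (rule restrict_in_BMOA[rotated])
       (rule holomorphic_on_compose_gen[OF phi(1) BMOA_holomorphic[OF f] phi(2)])
qed

lemma composition_operator_apply: "cmod z < 1 \<Longrightarrow> composition_operator \<phi> f z = f (\<phi> z)"
  by (simp add: composition_operator_def)

lemma composition_operator_subsequence_convergent:
  assumes phi: "\<phi> holomorphic_on unit_disc" "\<phi> ` unit_disc \<subseteq> unit_disc" and L: "condition_L \<phi>"
    and f: "\<And>n. f n \<in> BMOA" "\<And>n. bmoa_seminorm (f n) \<le> ennreal C" "\<And>n. cmod (f n 0) \<le> C" "0 \<le> C"
  obtains g and r :: "nat \<Rightarrow> nat" where "g \<in> BMOA" "strict_mono r"
    "(\<lambda>n. bmoa_dist (composition_operator \<phi> (f (r n))) g) \<longlonglongrightarrow> 0"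
proof -
  obtain g r where g: "g \<in> BMOA" "bmoa_seminorm g \<le> ennreal C" and r: "strict_mono (r :: nat \<Rightarrow> nat)"
    and lim: "\<And>K. compact K \<Longrightarrow> K \<subseteq> unit_disc \<Longrightarrow> uniform_limit K (\<lambda>n. f (r n)) g sequentially"
    by (rule BMOA_normal_family[of f, OF f]) blast
  have phi0: "cmod (\<phi> 0) < 1" by (rule self_map_less_1[OF phi(2)]) simp
  have "(\<lambda>n. bmoa_dist (composition_operator \<phi> (f (r n))) (composition_operator \<phi> g)) \<longlonglongrightarrow> 0"
  proof (rule tendstoI)
    fix e :: real assume e: "0 < e"
    then have e2: "0 < e / 2" "0 \<le> C + C" using f(4) by auto
    obtain \<eta> \<kappa> where \<eta>: "0 < \<eta>" "\<eta> < 1" "0 < \<kappa>" and small: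
      "\<And>h. h holomorphic_on unit_disc \<Longrightarrow> bmoa_seminorm h \<le> ennreal (C + C) \<Longrightarrow>
       (\<And>w. cmod w \<le> \<eta> \<Longrightarrow> cmod (h w) \<le> \<kappa>) \<Longrightarrow> bmoa_seminorm (\<lambda>z. h (\<phi> z)) \<le> ennreal (e / 2)"
      by (rule condition_L_compose_small[OF phi L e2(2,1)]) blast
    have "\<forall>\<^sub>F n in sequentially. \<forall>x\<in>cball 0 \<eta>. dist (f (r n) x) (g x) < \<kappa>"
      by (rule uniform_limitD[OF lim]) (use \<eta> in auto)
    moreover have "\<forall>\<^sub>F n in sequentially. \<forall>x\<in>{\<phi> 0}. dist (f (r n) x) (g x) < e / 2"
      by (rule uniform_limitD[OF lim]) (use phi0 e in auto)
    ultimately show "\<forall>\<^sub>F n in sequentially.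
        dist (bmoa_dist (composition_operator \<phi> (f (r n))) (composition_operator \<phi> g)) 0 < e"
    proof eventually_elim
      case (elim n)
      have "bmoa_seminorm (\<lambda>z. f (r n) (\<phi> z) - g (\<phi> z)) \<le> ennreal (e / 2)"
      proof (rule small)
        show "(\<lambda>z. f (r n) z - g z) holomorphic_on unit_disc"
          by (intro holomorphic_intros BMOA_holomorphic f g)
        show "bmoa_seminorm (\<lambda>z. f (r n) z - g z) \<le> ennreal (C + C)"
          by (intro bmoa_seminorm_diff_le f g)
      qed (use elim in \<open>auto simp: dist_norm less_imp_le\<close>)
      then have "bmoa_seminorm (\<lambda>z. composition_operator \<phi> (f (r n)) z - composition_operator \<phi> g z) \<le> ennreal (e / 2)"
        by (subst bmoa_seminorm_cong[where g = "\<lambda>z. f (r n) (\<phi> z) - g (\<phi> z)"])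
           (auto simp: composition_operator_apply)
      from bmoa_dist_le[OF this]
      have "bmoa_dist (composition_operator \<phi> (f (r n))) (composition_operator \<phi> g) \<le>
          cmod (f (r n) (\<phi> 0) - g (\<phi> 0)) + e / 2"
        using e by (simp add: composition_operator_apply)
      also have "\<dots> < e" using elim by (simp add: dist_norm)
      finally show ?case using Metric_space.nonneg[OF Metric_space_BMOA] by simp
    qed
  qed
  then show thesis by (rule that[OF composition_operator_BMOA[OF phi g(1)] r])
qed

text \<open>
  The Bolzano--Weierstrass criterion: an infinite subset of the image contains an injective sequence,
  and a limit of a subsequence of an injective sequence is an accumulation point of the set.
\<close>

lemma condition_L_imp_compact:
  assumes phi: "\<phi> holomorphic_on unit_disc" "\<phi> ` unit_disc \<subseteq> unit_disc" and L: "condition_L \<phi>"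
  shows "compact_operator BMOA bmoa_dist (composition_operator \<phi>)"
  unfolding compact_operator_def
proof (intro conjI allI impI)
  interpret Metric_space BMOA bmoa_dist by (rule Metric_space_BMOA)
  show "composition_operator \<phi> ` BMOA \<subseteq> BMOA" using composition_operator_BMOA[OF phi] by blast
  fix S assume "mbounded S"
  then obtain C where C: "0 \<le> C" "S \<subseteq> BMOA" "\<And>f. f \<in> S \<Longrightarrow> bmoa_seminorm f \<le> ennreal C"
    "\<And>f. f \<in> S \<Longrightarrow> cmod (f 0) \<le> C" by (rule BMOA_mbounded_bound) blast
  show "compactin mtopology (mtopology closure_of (composition_operator \<phi> ` S))"
    unfolding compact_closure_of_eq_Bolzano_Weierstrass
  proof (intro allI impI, elim conjE)
    fix A assume A: "infinite A" "A \<subseteq> composition_operator \<phi> ` S"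
    obtain y :: "nat \<Rightarrow> complex \<Rightarrow> complex" where y: "inj y" "range y \<subseteq> A"
      using infinite_countable_subset[OF A(1)] by blast
    have "\<forall>n. \<exists>f. f \<in> S \<and> y n = composition_operator \<phi> f" using y A(2) by blast
    then obtain f where f: "\<And>n. f n \<in> S" "\<And>n. y n = composition_operator \<phi> (f n)" by metis
    obtain g and r :: "nat \<Rightarrow> nat" where g: "g \<in> BMOA" and r: "strict_mono r"
      and lim: "(\<lambda>n. bmoa_dist (composition_operator \<phi> (f (r n))) g) \<longlonglongrightarrow> 0"
      by (rule composition_operator_subsequence_convergent[of \<phi> f C, OF phi L]) (use C f in auto)
    have "g \<in> mtopology derived_set_of A"
      unfolding metric_derived_set_of
    proof (safe intro!: g)
      fix \<epsilon> :: real assume "0 < \<epsilon>"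
      then obtain N where N: "\<And>n. n \<ge> N \<Longrightarrow> bmoa_dist (y (r n)) g < \<epsilon>"
        using lim[THEN tendstoD, of \<epsilon>] by (auto simp: eventually_sequentially f(2))
      \<comment> \<open>so at most one of two consecutive terms is the limit itself\<close>
      have "y (r N) \<noteq> y (r (Suc N))" using r y(1) by (metis injD n_not_Suc_n strict_mono_eq)
      then obtain n where n: "n \<ge> N" "y (r n) \<noteq> g" by (metis le_Suc_eq order_refl)
      have "y (r n) \<in> BMOA" using C(2) f composition_operator_BMOA[OF phi] by auto
      then show "\<exists>x\<in>A. x \<noteq> g \<and> x \<in> mball g \<epsilon>"
        using N[OF n(1)] n(2) g y(2) by (intro bexI[of _ "y (r n)"]) (auto simp: in_mball commute)
    qed
    then show "mtopology derived_set_of A \<noteq> {}" by blast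
  qed
qed

text \<open>
  The test functions are \<open>h = \<sigma> b - b\<close> with \<open>b = \<phi> a\<close>, for base points \<open>a\<close> along which \<open>|\<phi> a| \<rightarrow> 1\<close> while the
  quantity in (L) stays above \<open>\<epsilon>\<close>. A norm limit of their images must agree with the pointwise limit \<open>0\<close>;
  but the seminorm of \<open>h \<circ> \<phi>\<close> dominates the mean oscillation at \<open>a\<close>, which is the quantity in (L).
\<close>

lemma compact_imp_condition_L:
  assumes phi: "\<phi> holomorphic_on unit_disc" "\<phi> ` unit_disc \<subseteq> unit_disc"
    and cpt: "compact_operator BMOA bmoa_dist (composition_operator \<phi>)"
  shows "condition_L \<phi>"
proof (rule ccontr)
  interpret Metric_space BMOA bmoa_dist by (rule Metric_space_BMOA)
  assume "\<not> condition_L \<phi>"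
  then obtain \<epsilon> where \<epsilon>: "0 < \<epsilon>" and
    nL: "\<And>\<eta>. \<eta> < 1 \<Longrightarrow> \<exists>a. cmod a < 1 \<and> \<eta> < cmod (\<phi> a) \<and> ennreal \<epsilon> \<le> h2_norm (\<sigma> (\<phi> a) \<circ> \<phi> \<circ> \<sigma> a)"
    unfolding condition_L_def vanishes_as_modulus_tends_to_1_def not_all not_imp not_ex
    by (metis (no_types, lifting) linorder_not_less mem_ball_0)
  have "\<forall>n. \<exists>a. cmod a < 1 \<and> 1 - inverse (real (Suc n)) < cmod (\<phi> a) \<and> ennreal \<epsilon> \<le> h2_norm (\<sigma> (\<phi> a) \<circ> \<phi> \<circ> \<sigma> a)"
    by (intro allI nL) simp
  then obtain a where a: "\<And>n. cmod (a n) < 1" "\<And>n. 1 - inverse (real (Suc n)) < cmod (\<phi> (a n))"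
    "\<And>n. ennreal \<epsilon> \<le> h2_norm (\<sigma> (\<phi> (a n)) \<circ> \<phi> \<circ> \<sigma> (a n))" by metis
  define b where "b n = \<phi> (a n)" for n
  have b: "cmod (b n) < 1" for n unfolding b_def by (rule self_map_less_1[OF phi(2) a(1)])
  have b_lim: "(\<lambda>n. cmod (b n)) \<longlonglongrightarrow> 1"
  proof (rule tendsto_sandwich)
    show "(\<lambda>n. 1 - inverse (real (Suc n))) \<longlonglongrightarrow> 1"
      using tendsto_diff[OF tendsto_const LIMSEQ_inverse_real_of_nat, of 1] by simp
    show "\<forall>\<^sub>F n in sequentially. 1 - inverse (real (Suc n)) \<le> cmod (b n)"
      using a(2) by (intro always_eventually allI) (simp add: b_def less_imp_le)
    show "\<forall>\<^sub>F n in sequentially. cmod (b n) \<le> 1"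
      using b by (intro always_eventually allI) (simp add: less_imp_le)
  qed (rule tendsto_const)
  define h where "h n z = \<sigma> (b n) z - b n" for n z
  define f where "f n = restrict (h n) unit_disc" for n
  have h_hol: "h n holomorphic_on unit_disc" for n
    unfolding h_def[abs_def] by (intro holomorphic_intros disc_involution_holomorphic b)
  have h_semi: "bmoa_seminorm (h n) \<le> ennreal 2" for n
    unfolding bmoa_seminorm_le_iff_L2[OF zero_le_numeral]
  proof (intro allI impI)
    fix u :: complex and r :: real assume ur: "cmod u < 1" "0 < r" "r < 1"
    note K = translated_dilation_disc_map[OF ur]
    show "circle_L2 (\<lambda>z. h n (\<sigma> u (of_real r * z)) - h n u) \<le> 2"
    proof (rule circle_L2_le_sup)
      show "continuous_on unit_circle (\<lambda>z. h n (\<sigma> u (of_real r * z)) - h n u)"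
        by (intro continuous_intros disc_algebra_continuous disc_algebra_compose_disc_map h_hol K)
      fix z :: complex assume z: "cmod z = 1"
      have "cmod (\<sigma> u (of_real r * z)) < 1" using K z by (simp add: disc_map_def)
      then have "cmod (\<sigma> (b n) (\<sigma> u (of_real r * z))) < 1" "cmod (\<sigma> (b n) u) < 1"
        using disc_involution_bounds(2)[OF b] ur by auto
      then show "cmod (h n (\<sigma> u (of_real r * z)) - h n u) \<le> 2"
        using norm_triangle_ineq4[of "\<sigma> (b n) (\<sigma> u (of_real r * z))" "\<sigma> (b n) u"] by (simp add: h_def)
    qed simp
  qed
  have f_BMOA: "f n \<in> BMOA" for n unfolding f_def by (rule restrict_in_BMOA[OF h_hol h_semi])
  have zero: "restrict (\<lambda>_. 0) unit_disc \<in> BMOA"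
  proof (rule restrict_in_BMOA[OF holomorphic_on_const])
    show "bmoa_seminorm (\<lambda>_. 0) \<le> ennreal 0"
      unfolding bmoa_seminorm_le_iff_L2[OF order_refl] by (simp add: circle_L2_def)
  qed
  have "bmoa_dist (f n) (restrict (\<lambda>_. 0) unit_disc) \<le> 2" for n
  proof -
    have "bmoa_seminorm (\<lambda>z. f n z - restrict (\<lambda>_. 0) unit_disc z) = bmoa_seminorm (h n)"
      by (rule bmoa_seminorm_cong) (simp add: f_def)
    with h_semi[of n] bmoa_dist_le[of "f n" "restrict (\<lambda>_. 0) unit_disc" 2]
    show ?thesis by (simp add: f_def h_def disc_involution_0)
  qed
  then have "mbounded (range f)"
    unfolding mbounded_def
    by (intro exI[of _ "restrict (\<lambda>_. 0) unit_disc"] exI[of _ 2])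
       (auto simp: in_mcball zero f_BMOA commute)
  then have "compactin mtopology (mtopology closure_of (composition_operator \<phi> ` range f))"
    using cpt unfolding compact_operator_def by blast
  moreover have TB: "composition_operator \<phi> (f n) \<in> BMOA" for n by (rule composition_operator_BMOA[OF phi f_BMOA])
  then have "range (\<lambda>n. composition_operator \<phi> (f n)) \<subseteq> mtopology closure_of (composition_operator \<phi> ` range f)"
    by (intro order_trans[OF _ closure_of_subset]) auto
  ultimately obtain l and r :: "nat \<Rightarrow> nat" where r: "strict_mono r"
    and lim: "limitin mtopology ((\<lambda>n. composition_operator \<phi> (f n)) \<circ> r) l sequentially"
    unfolding compactin_sequentially by blast
  have l: "l \<in> BMOA" using lim by (simp add: limitin_metric)
  have dist0: "(\<lambda>n. bmoa_dist (composition_operator \<phi> (f (r n))) l) \<longlonglongrightarrow> 0"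
  proof (rule tendstoI)
    fix e :: real assume "0 < e"
    with lim have "\<forall>\<^sub>F n in sequentially. bmoa_dist (composition_operator \<phi> (f (r n))) l < e"
      by (auto simp: limitin_metric elim: eventually_mono)
    then show "\<forall>\<^sub>F n in sequentially. dist (bmoa_dist (composition_operator \<phi> (f (r n))) l) 0 < e"
      by (rule eventually_mono) simp
  qed
  have l0: "l z = 0" if z: "cmod z < 1" for z
  proof -
    define k where "k n w = composition_operator \<phi> (f (r n)) w - l w" for n w
    have k_le: "cmod (k n z) \<le> bmoa_dist (composition_operator \<phi> (f (r n))) l * (1 + cmod z / (1 - cmod z))" for n
    proof -
      have "cmod (k n z - k n 0) \<le> bmoa_dist (composition_operator \<phi> (f (r n))) l * cmod z / (1 - cmod z)"
      proof (rule bmoa_growth[OF _ _ nonneg z])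
        show "k n holomorphic_on unit_disc"
          unfolding k_def[abs_def] by (intro holomorphic_on_diff BMOA_holomorphic TB l)
        show "bmoa_seminorm (k n) \<le> ennreal (bmoa_dist (composition_operator \<phi> (f (r n))) l)"
          unfolding k_def[abs_def] by (rule bmoa_seminorm_le_dist(1)[OF TB l])
      qed
      moreover have "cmod (k n 0) \<le> bmoa_dist (composition_operator \<phi> (f (r n))) l"
        unfolding k_def by (rule bmoa_seminorm_le_dist(2)[OF TB l])
      ultimately show ?thesis using norm_triangle_ineq[of "k n z - k n 0" "k n 0"] by (simp add: algebra_simps)
    qed
    have "(\<lambda>n. bmoa_dist (composition_operator \<phi> (f (r n))) l * (1 + cmod z / (1 - cmod z))) \<longlonglongrightarrow> 0"
      by (rule tendsto_mult_left_zero[OF dist0])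
    then have 1: "(\<lambda>n. k n z) \<longlonglongrightarrow> 0"
      by (rule Lim_null_comparison[OF always_eventually[OF allI[OF k_le]]])
    define w where "w = \<phi> z"
    have w: "cmod w < 1" unfolding w_def by (rule self_map_less_1[OF phi(2) z])
    have h_le: "cmod (h n w) \<le> (1 - (cmod (b n))\<^sup>2) / (1 - cmod w)" for n
    proof -
      have nz: "1 - cnj (b n) * w \<noteq> 0" by (rule one_minus_cnj_mult_nonzero) (use b w in auto)
      have "h n w = - (w * (1 - cnj (b n) * b n)) / (1 - cnj (b n) * w)"
        using nz by (simp add: h_def disc_involution_def divide_simps) (simp add: algebra_simps)
      also have "1 - cnj (b n) * b n = of_real (1 - (cmod (b n))\<^sup>2)"
        using complex_norm_square[of "b n"] by (simp add: mult.commute)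
      finally have "cmod (h n w) = cmod w * \<bar>1 - (cmod (b n))\<^sup>2\<bar> / cmod (1 - cnj (b n) * w)"
        by (simp only: norm_divide norm_minus_cancel norm_mult norm_of_real)
      also have "\<dots> \<le> (1 - (cmod (b n))\<^sup>2) / (1 - cmod w)"
      proof (rule frac_le)
        have "(cmod (b n))\<^sup>2 \<le> 1" using b[of n] by (simp add: abs_square_le_1 less_imp_le)
        then show "cmod w * \<bar>1 - (cmod (b n))\<^sup>2\<bar> \<le> 1 - (cmod (b n))\<^sup>2" "0 \<le> 1 - (cmod (b n))\<^sup>2"
          using w by (auto simp: mult_left_le_one_le less_imp_le)
        have "cmod (b n) * cmod w \<le> 1 * cmod w" by (intro mult_right_mono) (use b in \<open>auto simp: less_imp_le\<close>)
        then show "1 - cmod w \<le> cmod (1 - cnj (b n) * w)"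
          using norm_triangle_ineq2[of 1 "cnj (b n) * w"] by (simp add: norm_mult)
      qed (use w in simp)
      finally show ?thesis .
    qed
    have "(\<lambda>n. (1 - (cmod (b n))\<^sup>2) / (1 - cmod w)) \<longlonglongrightarrow> (1 - 1\<^sup>2) / (1 - cmod w)"
      by (intro tendsto_intros b_lim) (use w in auto)
    then have "(\<lambda>n. (1 - (cmod (b n))\<^sup>2) / (1 - cmod w)) \<longlonglongrightarrow> 0" by simp
    then have "(\<lambda>n. h n w) \<longlonglongrightarrow> 0"
      by (rule Lim_null_comparison[OF always_eventually[OF allI[OF h_le]]])
    from LIMSEQ_subseq_LIMSEQ[OF this r] have 2: "(\<lambda>n. h (r n) w) \<longlonglongrightarrow> 0" by (simp only: o_def)
    have "k n z = h (r n) w - l z" for n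
      using z w by (simp add: k_def composition_operator_apply f_def w_def)
    then have "(\<lambda>n. h (r n) w - k n z) \<longlonglongrightarrow> l z" by simp
    from LIMSEQ_unique[OF this tendsto_diff[OF 2 1]] show "l z = 0" by simp
  qed
  from dist0 \<epsilon> have "\<forall>\<^sub>F n in sequentially. dist (bmoa_dist (composition_operator \<phi> (f (r n))) l) 0 < \<epsilon>"
    by (rule tendstoD)
  then obtain n where n: "bmoa_dist (composition_operator \<phi> (f (r n))) l < \<epsilon>"
    using eventually_happens'[OF sequentially_bot] by (fastforce simp: dist_norm)
  have "ennreal \<epsilon> \<le> h2_norm (\<sigma> (b (r n)) \<circ> \<phi> \<circ> \<sigma> (a (r n)))" unfolding b_def by (rule a(3))
  also have "\<dots> = h2_norm (\<lambda>z. h (r n) (\<phi> (\<sigma> (a (r n)) z)) - h (r n) (\<phi> (a (r n))))"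
    by (rule h2_norm_cong) (simp add: h_def b_def disc_involution_self)
  also have "\<dots> \<le> bmoa_seminorm (\<lambda>z. h (r n) (\<phi> z))"
    unfolding bmoa_seminorm_def by (rule SUP_upper) (use a(1) in simp)
  also have "\<dots> = bmoa_seminorm (\<lambda>z. composition_operator \<phi> (f (r n)) z - l z)"
    by (rule bmoa_seminorm_cong) (simp add: l0 composition_operator_apply f_def self_map_less_1[OF phi(2)])
  also have "\<dots> \<le> ennreal (bmoa_dist (composition_operator \<phi> (f (r n))) l)"
    by (rule bmoa_seminorm_le_dist[OF TB l])
  also have "\<dots> < ennreal \<epsilon>" using n \<epsilon> by (simp add: ennreal_less_iff nonneg)
  finally show False by simp
qed

section \<open>The radial maximal function\<close>

text \<open>
  Cauchy's kernel differs from the Poisson kernel by \<open>cnj b \<zeta> / (1 - cnj b \<zeta>)\<close>, whose product with \<open>u\<close> is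
  analytic and vanishes at \<open>0\<close>, so it contributes nothing to the mean.
\<close>

lemma Poisson_formula:
  assumes u: "u \<in> disc_algebra" and b: "cmod b < 1"
  shows "circle_mean (\<lambda>\<zeta>. u \<zeta> * of_real ((1 - (cmod b)\<^sup>2) / (cmod (1 - cnj b * \<zeta>))\<^sup>2)) = u b"
proof -
  have c: "continuous_on unit_circle u" by (rule disc_algebra_continuous[OF u])
  have nz: "\<zeta> - b \<noteq> 0" "1 - cnj b * \<zeta> \<noteq> 0" if "cmod \<zeta> = 1" for \<zeta>
    using that b one_minus_cnj_mult_nonzero[OF b] by auto
  define k where "k z = u z * (cnj b * z / (1 - cnj b * z))" for z
  have k: "k \<in> disc_algebra"
    unfolding k_def[abs_def] using u one_minus_cnj_mult_nonzero[OF b]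
    by (auto simp: disc_algebra_def intro!: continuous_intros holomorphic_intros)
  have "u b = circle_mean (\<lambda>\<zeta>. u \<zeta> * \<zeta> / (\<zeta> - b)) + circle_mean k"
    using Cauchy_circle_mean[OF u b] mean_value[OF k] by (simp add: k_def)
  also have "\<dots> = circle_mean (\<lambda>\<zeta>. u \<zeta> * \<zeta> / (\<zeta> - b) + k \<zeta>)"
    by (intro circle_mean_add[symmetric] continuous_intros c disc_algebra_continuous[OF k]) (use nz in auto)
  also have "\<dots> = circle_mean (\<lambda>\<zeta>. u \<zeta> * of_real ((1 - (cmod b)\<^sup>2) / (cmod (1 - cnj b * \<zeta>))\<^sup>2))"
  proof (rule circle_mean_cong)
    fix \<zeta> :: complex assume z: "cmod \<zeta> = 1"
    have zz: "\<zeta> * cnj \<zeta> = 1" using complex_norm_square[of \<zeta>] z by simp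
    have "\<zeta> - b = \<zeta> * cnj (1 - cnj b * \<zeta>)" using zz by (simp add: algebra_simps)
    moreover have "\<zeta> \<noteq> 0" using z by auto
    ultimately have "\<zeta> / (\<zeta> - b) = 1 / cnj (1 - cnj b * \<zeta>)" by simp
    moreover have "1 / cnj A + x / A = (A + x * cnj A) / (A * cnj A)" if "A \<noteq> 0" for A x :: complex
      using that by (simp add: field_simps)
    ultimately have "\<zeta> / (\<zeta> - b) + cnj b * \<zeta> / (1 - cnj b * \<zeta>) =
        ((1 - cnj b * \<zeta>) + cnj b * \<zeta> * cnj (1 - cnj b * \<zeta>)) / ((1 - cnj b * \<zeta>) * cnj (1 - cnj b * \<zeta>))"
      using nz(2)[OF z] by (simp only:)
    also have "(1 - cnj b * \<zeta>) + cnj b * \<zeta> * cnj (1 - cnj b * \<zeta>) = 1 - cnj b * b * (\<zeta> * cnj \<zeta>)"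
      by (simp add: algebra_simps)
    also have "\<dots> = of_real (1 - (cmod b)\<^sup>2)"
      using complex_norm_square[of b] by (simp add: zz mult.commute)
    also have "(1 - cnj b * \<zeta>) * cnj (1 - cnj b * \<zeta>) = of_real ((cmod (1 - cnj b * \<zeta>))\<^sup>2)"
      by (rule complex_norm_square[symmetric])
    finally have "\<zeta> / (\<zeta> - b) + cnj b * \<zeta> / (1 - cnj b * \<zeta>) =
      of_real ((1 - (cmod b)\<^sup>2) / (cmod (1 - cnj b * \<zeta>))\<^sup>2)" by simp
    moreover have "u \<zeta> * \<zeta> / (\<zeta> - b) + k \<zeta> = u \<zeta> * (\<zeta> / (\<zeta> - b) + cnj b * \<zeta> / (1 - cnj b * \<zeta>))"
      by (simp add: k_def algebra_simps)
    ultimately show "u \<zeta> * \<zeta> / (\<zeta> - b) + k \<zeta> = u \<zeta> * of_real ((1 - (cmod b)\<^sup>2) / (cmod (1 - cnj b * \<zeta>))\<^sup>2)"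
      by simp
  qed
  finally show ?thesis by simp
qed

lemma continuous_on_circle_cis:
  assumes "continuous_on unit_circle F" "continuous_on S g"
  shows "continuous_on S (\<lambda>t. F (cis (g t)))"
  by (rule continuous_on_compose2[OF assms(1)]) (auto intro!: continuous_intros assms)

lemma circle_mean_symmetric:
  fixes F :: "complex \<Rightarrow> real"
  assumes F: "continuous_on unit_circle F"
  shows "circle_mean F = integral {0..pi} (\<lambda>t. F (cis t) + F (cis (- t))) / (2 * pi)"
proof -
  define h where "h t = F (cis t)" for t
  have ch: "continuous_on S h" for S unfolding h_def by (intro continuous_on_circle_cis F continuous_on_id)
  have i1: "h integrable_on {0..pi}" and i2: "(\<lambda>t. h (- t)) integrable_on {0..pi}"
    by (intro integrable_continuous_real ch continuous_on_compose2[OF ch[of UNIV]] continuous_intros; simp)+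
  have "integral {0..2*pi} h = integral {0..pi} h + integral {pi..2*pi} h"
    by (intro Henstock_Kurzweil_Integration.integral_combine[symmetric] integrable_continuous_real ch) auto
  also have "integral {pi..2*pi} h = integral {-(2*pi)..-pi} (\<lambda>x. h (- x))" by (rule Henstock_Kurzweil_Integration.integral_reflect_real[symmetric])
  also have "\<dots> = integral {-(2*pi) - (-(2*pi))..-pi - (-(2*pi))} (\<lambda>x. h (- (x + (-(2*pi)))))"
    by (rule integral_shift_real_ivl[symmetric])
  also have "\<dots> = integral {0..pi} (\<lambda>x. h (- x))"
  proof -
    have "cis (- (x + (-(2*pi)))) = cis (- x)" for x
      by (simp add: cis.ctr complex_eq_iff)
    then show ?thesis by (simp add: h_def)
  qed
  also have "integral {0..pi} h + \<dots> = integral {0..pi} (\<lambda>x. h x + h (- x))"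
    by (rule Henstock_Kurzweil_Integration.integral_add[OF i1 i2, symmetric])
  finally show ?thesis using integral_circle_lebesgue[OF F] by (simp add: h_def)
qed

text \<open>
  The radial values of \<open>u\<close> are bounded by the Hardy--Littlewood maximal function, here with constant \<open>1\<close>.
  With \<open>v\<close> the sum of \<open>|u|\<close> at angles \<open>\<plusminus>t\<close> from the ray, the hypothesis says
  \<open>D t = 2 M t - \<integral>\<^sub>0\<^sup>t v \<ge> 0\<close>. Since the Poisson kernel \<open>p\<close> decreases on \<open>[0, \<pi>]\<close>, integrating \<open>D' p\<close> by parts
  gives \<open>\<integral> (2 M - v) p \<ge> 0\<close>, and the mean of the kernel is \<open>1\<close>.
\<close>

lemma radial_bound_of_centered_averages:
  assumes u: "u \<in> disc_algebra" and r: "0 \<le> r" "r < 1"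
    and avg: "\<And>t. 0 \<le> t \<Longrightarrow> t \<le> pi \<Longrightarrow>
      integral {0..t} (\<lambda>s. cmod (u (cis (\<theta> + s))) + cmod (u (cis (\<theta> - s)))) \<le> 2 * t * M"
  shows "cmod (u (of_real r * cis \<theta>)) \<le> M"
proof -
  define w where "w z = u (cis \<theta> * z)" for z
  have "(\<lambda>z. cis \<theta> * z) \<in> disc_algebra" by (auto simp: disc_algebra_def intro!: continuous_intros holomorphic_intros)
  then have w: "w \<in> disc_algebra" unfolding w_def
    by (rule disc_algebra_compose[OF u]) (auto simp: norm_mult)
  have cw: "continuous_on unit_circle w" by (rule disc_algebra_continuous[OF w])
  \<comment> \<open>the Poisson kernel on the circle, and below as a function of the angle\<close>
  define P where "P \<zeta> = (1 - r\<^sup>2) / (cmod (1 - of_real r * \<zeta>))\<^sup>2" for \<zeta>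
  define p where "p t = (1 - r\<^sup>2) / (1 - 2 * r * cos t + r\<^sup>2)" for t
  define v where "v t = cmod (w (cis t)) + cmod (w (cis (- t)))" for t
  have r2: "r\<^sup>2 < 1" using r by (simp add: abs_square_less_1)
  have den: "1 - 2 * r * cos t + r\<^sup>2 > 0" for t
  proof -
    have "2 * r * cos t \<le> 2 * r * 1" by (intro mult_left_mono) (use r in auto)
    moreover have "(1 - r)\<^sup>2 > 0" using r by simp
    ultimately show ?thesis by (simp add: power2_eq_square algebra_simps)
  qed
  have Pp: "P (cis t) = p t" "P (cis (- t)) = p t" for t
  proof -
    have "(cmod (1 - of_real r * cis x))\<^sup>2 = 1 - 2 * r * cos x + r\<^sup>2" for x
    proof -
      have "(cmod (1 - of_real r * cis x))\<^sup>2 = (1 - r * cos x)\<^sup>2 + (r * sin x)\<^sup>2"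
        unfolding cmod_power2 by simp
      also have "\<dots> = 1 - 2 * r * cos x + r\<^sup>2 * ((sin x)\<^sup>2 + (cos x)\<^sup>2)"
        by algebra
      finally show ?thesis by simp
    qed
    from this[of t] this[of "-t"] show "P (cis t) = p t" "P (cis (- t)) = p t"
      by (simp_all add: P_def p_def)
  qed
  have pe: "p (- t) = p t" for t by (simp add: p_def)
  have nz: "1 - of_real r * \<zeta> \<noteq> 0" if "cmod \<zeta> = 1" for \<zeta>
    using one_minus_cnj_mult_nonzero[of "of_real r" \<zeta>] that r by simp
  have cP: "continuous_on unit_circle P"
    unfolding P_def[abs_def] by (intro continuous_intros) (use nz in auto)
  have P0: "P \<zeta> \<ge> 0" for \<zeta> using r2 by (simp add: P_def)
  have cv: "continuous_on S v" for S
    unfolding v_def[abs_def] by (intro continuous_intros continuous_on_circle_cis cw)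
  have cp: "continuous_on S p" for S
    unfolding p_def[abs_def] using den by (intro continuous_intros) (auto simp: less_imp_neq[symmetric])
  have "cmod (w (of_real r)) = cmod (circle_mean (\<lambda>\<zeta>. w \<zeta> * of_real (P \<zeta>)))"
    using Poisson_formula[OF w, of "of_real r"] r by (simp add: P_def)
  also have "\<dots> \<le> circle_mean (\<lambda>\<zeta>. cmod (w \<zeta> * of_real (P \<zeta>)))" by (rule integral_norm_bound)
  also have "\<dots> = circle_mean (\<lambda>\<zeta>. cmod (w \<zeta>) * P \<zeta>)"
    by (rule circle_mean_cong) (simp add: norm_mult P0)
  also have "\<dots> = integral {0..pi} (\<lambda>t. v t * p t) / (2 * pi)"
    by (subst circle_mean_symmetric) (intro continuous_intros cw cP, simp add: Pp pe v_def distrib_right)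
  finally have 1: "2 * pi * cmod (w (of_real r)) \<le> integral {0..pi} (\<lambda>t. v t * p t)"
    by (simp add: field_simps)
  have "circle_mean (\<lambda>\<zeta>. of_real (P \<zeta>)) = (1::complex)"
    using Poisson_formula[OF disc_algebra_const[of 1], of "of_real r"] r by (simp add: P_def)
  then have "circle_mean P = 1"
    by (metis (mono_tags, lifting) of_real_eq_1_iff integral_complex_of_real)
  then have 2: "integral {0..pi} (\<lambda>t. 2 * p t) = 2 * pi"
    using circle_mean_symmetric[OF cP] by (simp add: Pp pe field_simps)
  define D where "D t = 2 * M * t - integral {0..t} v" for t
  define p' where "p' t = - ((1 - r\<^sup>2) * (2 * r * sin t)) / (1 - 2 * r * cos t + r\<^sup>2)\<^sup>2" for t
  have v_eq: "v = (\<lambda>s. cmod (u (cis (\<theta> + s))) + cmod (u (cis (\<theta> - s))))"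
    by (rule ext) (simp add: v_def w_def cis_mult)
  have D0: "D t \<ge> 0" if "0 \<le> t" "t \<le> pi" for t
    using avg[OF that] by (simp add: D_def v_eq mult_ac)
  have cp': "continuous_on S p'" for S
    unfolding p'_def[abs_def] using den by (intro continuous_intros) (auto simp: less_imp_neq[symmetric])
  have dp: "(p has_real_derivative p' t) (at t within X)" for t X
    unfolding p_def[abs_def] p'_def using den[of t]
    by (auto intro!: derivative_eq_intros simp: power2_eq_square)
  have dD: "(D has_real_derivative (2 * M - v t)) (at t within {0..pi})" if "t \<in> {0..pi}" for t
    unfolding D_def[abs_def]
    by (rule derivative_eq_intros refl integral_has_real_derivative[OF cv that])+ simp
  have cD: "continuous_on {0..pi} D" using dD by (intro DERIV_continuous_on) 
  have "((\<lambda>t. (2 * M - v t) * p t + p' t * D t) has_integral (D pi * p pi - D 0 * p 0)) {0..pi}"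
    by (rule fundamental_theorem_of_calculus)
       (auto intro!: DERIV_mult' dD dp simp flip: has_real_derivative_iff_has_vector_derivative
             intro: DERIV_cong[OF DERIV_mult[OF dD dp]])
  moreover have i1: "(\<lambda>t. (2 * M - v t) * p t) integrable_on {0..pi}"
    and i2: "(\<lambda>t. p' t * D t) integrable_on {0..pi}"
    by (intro integrable_continuous_real continuous_intros cv cp cp' cD)+
  ultimately have "integral {0..pi} (\<lambda>t. (2 * M - v t) * p t) + integral {0..pi} (\<lambda>t. p' t * D t) = D pi * p pi"
    using Henstock_Kurzweil_Integration.integral_add[OF i1 i2] by (simp add: D_def integral_unique)
  moreover have "integral {0..pi} (\<lambda>t. p' t * D t) \<le> integral {0..pi} (\<lambda>t. 0)"
  proof (rule integral_le[OF i2])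
    fix t assume t: "t \<in> {0..pi}"
    have "p' t \<le> 0" unfolding p'_def using t r r2 sin_ge_zero[of t]
      by (intro divide_nonpos_nonneg) auto
    then show "p' t * D t \<le> 0" using D0[of t] t by (intro mult_nonpos_nonneg) auto
  qed (rule integrable_0)
  moreover have "D pi * p pi \<ge> 0" using D0[of pi] den[of pi] r2 by (auto simp: p_def)
  ultimately have "0 \<le> integral {0..pi} (\<lambda>t. (2 * M - v t) * p t)" by simp
  also have "\<dots> = integral {0..pi} (\<lambda>t. M * (2 * p t) - v t * p t)" by (simp add: algebra_simps)
  also have "\<dots> = M * integral {0..pi} (\<lambda>t. 2 * p t) - integral {0..pi} (\<lambda>t. v t * p t)"
    by (subst Henstock_Kurzweil_Integration.integral_diff)
       (intro integrable_continuous_real continuous_intros cv cp, intro integrable_continuous_real continuous_intros cv cp, simp)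
  finally have "2 * pi * cmod (w (of_real r)) \<le> 2 * pi * M"
    using 1 unfolding 2 by (simp only: mult.commute[of M])
  then have "cmod (w (of_real r)) \<le> M" by simp
  then show ?thesis by (simp add: w_def mult.commute)
qed

lemma emeasure_circle_lebesgue:
  assumes "E \<in> sets circle_borel"
  shows "emeasure circle_lebesgue E = emeasure lborel ({0..2*pi} \<inter> cis -` E) / ennreal (2 * pi)"
proof -
  have E: "E \<in> sets (restrict_space borel unit_circle)" using assms by (simp add: sets_circle_borel)
  have "cis -` E \<inter> space lborel \<in> sets lborel" by (rule measurable_sets[OF cis_measurable E])
  then have m: "cis -` E \<in> sets borel" by simp
  have "emeasure circle_lebesgue E = emeasure circle_borel E"
    unfolding circle_lebesgue_def using assms by (simp add: emeasure_completion main_part_sets)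
  also have "\<dots> = emeasure (uniform_measure lborel {0..2*pi}) (cis -` E)"
    unfolding circle_borel_def using E cis_measurable
    by (subst emeasure_distr) auto
  also have "\<dots> = emeasure lborel ({0..2*pi} \<inter> cis -` E) / emeasure lborel {0..2*pi}"
    using m by (subst emeasure_uniform_measure) auto
  finally show ?thesis by simp
qed

lemma integral_centered_interval:
  fixes W :: "real \<Rightarrow> real"
  assumes W: "continuous_on UNIV W" and t: "0 \<le> t"
  shows "integral {0..t} (\<lambda>s. W (\<theta> + s) + W (\<theta> - s)) = integral {\<theta> - t..\<theta> + t} W"
proof -
  have c: "continuous_on S (\<lambda>s. W (g s))" if "continuous_on S g" for S g
    by (rule continuous_on_compose2[OF W that]) auto
  have "integral {\<theta> - t..\<theta> + t} W = integral {\<theta> - t..\<theta>} W + integral {\<theta>..\<theta> + t} W"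
    using t by (intro Henstock_Kurzweil_Integration.integral_combine[symmetric] integrable_continuous_real
        continuous_on_subset[OF W]) auto
  also have "integral {\<theta>..\<theta> + t} W = integral {0..t} (\<lambda>s. W (\<theta> + s))"
    using integral_shift_real_ivl[of \<theta> \<theta> "\<theta> + t" W] by (simp add: add.commute)
  also have "integral {\<theta> - t..\<theta>} W = integral {- t..0} (\<lambda>s. W (\<theta> + s))"
    using integral_shift_real_ivl[of "\<theta> - t" \<theta> \<theta> W] by (simp add: add.commute)
  also have "\<dots> = integral {0..t} (\<lambda>s. W (\<theta> - s))"
    using Henstock_Kurzweil_Integration.integral_reflect_real[of t 0 "\<lambda>s. W (\<theta> - s)"] by simp
  also have "integral {0..t} (\<lambda>s. W (\<theta> - s)) + integral {0..t} (\<lambda>s. W (\<theta> + s)) =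
      integral {0..t} (\<lambda>s. W (\<theta> - s) + W (\<theta> + s))"
    by (intro Henstock_Kurzweil_Integration.integral_add[symmetric] integrable_continuous_real c continuous_intros)
  finally show ?thesis by (simp add: add.commute)
qed

lemma integral_three_periods:
  fixes W :: "real \<Rightarrow> real"
  assumes W: "continuous_on UNIV W" "\<And>x. W (x + 2 * pi) = W x"
  shows "integral {-(2*pi)..4*pi} W = 3 * integral {0..2*pi} W"
proof -
  have i: "W integrable_on {a..b}" for a b by (intro integrable_continuous_real continuous_on_subset[OF W(1)]) auto
  have "integral {-(2*pi)..4*pi} W = integral {-(2*pi)..0} W + integral {0..4*pi} W"
    by (intro Henstock_Kurzweil_Integration.integral_combine[symmetric] i) auto
  also have "integral {0..4*pi} W = integral {0..2*pi} W + integral {2*pi..4*pi} W"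
    by (intro Henstock_Kurzweil_Integration.integral_combine[symmetric] i) auto
  also have "integral {-(2*pi)..0} W = integral {0..2*pi} W"
    using integral_shift_real_ivl[of 0 "2*pi" "2*pi" W] W(2) by simp
  also have "integral {2*pi..4*pi} W = integral {0..2*pi} W"
    using integral_shift_real_ivl[of "2*pi" "2*pi" "4*pi" W] W(2) by simp
  finally show ?thesis by simp
qed

text \<open>
  If the radial maximal function is at least \<open>l\<close> at an angle, some centred interval carries mean of \<open>|u|\<close>
  at least \<open>l/2\<close>. Compactness of the exceptional set gives finitely many such intervals; Vitali's lemma
  extracts disjoint ones whose fivefold enlargements still cover. They lie in
  \<open>[-2\<pi>, 4\<pi>]\<close>, three periods, whence the constant \<open>30 = 10 \<cdot> 3\<close>. The restriction \<open>r \<le> s < 1\<close> makes the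
  set compact.
\<close>

lemma radial_maximal_weak_type:
  assumes u: "u \<in> disc_algebra" and l: "0 < l" and s: "0 \<le> s" "s < 1"
  defines "E \<equiv> {\<zeta> \<in> unit_circle. \<exists>r\<in>{0..s}. l \<le> cmod (u (of_real r * \<zeta>))}"
  shows "E \<in> sets circle_borel"
    and "emeasure circle_lebesgue E \<le> ennreal (30 / l * circle_mean (\<lambda>\<zeta>. cmod (u \<zeta>)))"
proof -
  have cu: "continuous_on (cball 0 1) u" "continuous_on unit_circle u" by (rule disc_algebra_continuous[OF u])+
  have le1: "cmod (of_real r * \<zeta>) \<le> 1" if "r \<in> {0..s}" "cmod \<zeta> = 1" for r \<zeta>
    using that s by (simp add: norm_mult)
  define Z where "Z = {x \<in> unit_circle \<times> {0..s}. l \<le> cmod (u (of_real (snd x) * fst x))}"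
  have "continuous_on (unit_circle \<times> {0..s}) (\<lambda>x. cmod (u (of_real (snd x) * fst x)))"
    by (intro continuous_on_norm continuous_on_compose2[OF cu(1)] continuous_intros) (use le1 in auto)
  then have "closedin (top_of_set (unit_circle \<times> {0..s})) Z"
    using continuous_closedin_preimage[of "unit_circle \<times> {0..s}" "\<lambda>x. cmod (u (of_real (snd x) * fst x))" "{l..}"]
    by (simp add: Z_def vimage_def Int_def)
  then have "compact Z"
    by (rule closedin_compact[rotated]) (intro compact_Times compact_sphere compact_Icc)
  then have "compact (fst ` Z)" by (intro compact_continuous_image continuous_intros)
  moreover have EZ: "fst ` Z = E" by (force simp: Z_def E_def)
  ultimately have E: "compact E" by simp
  have "E = E \<inter> unit_circle" by (auto simp: E_def)
  then show EB: "E \<in> sets circle_borel"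
    using E by (auto simp: sets_circle_borel sets_restrict_space intro!: image_eqI[of _ _ E] borel_compact)
  define W where "W x = cmod (u (cis x))" for x
  have W: "continuous_on S W" for S
    unfolding W_def by (intro continuous_on_norm continuous_on_circle_cis cu continuous_on_id)
  have iW: "W integrable_on {a..b}" for a b by (intro integrable_continuous_real W)
  have W0: "W x \<ge> 0" for x by (simp add: W_def)
  have Wper: "W (x + 2 * pi) = W x" for x by (simp add: W_def cis.ctr complex_eq_iff)
  define T where "T = {0..2*pi} \<inter> cis -` E"
  have T: "compact T"
  proof -
    have "closed (cis -` E)"
      by (intro closed_vimage compact_imp_closed E continuous_intros)
    then show ?thesis unfolding T_def by (intro compact_Int_closed compact_Icc)
  qed
  have "\<exists>t. 0 < t \<and> t \<le> pi \<and> l * t \<le> integral {\<theta> - t..\<theta> + t} W" if theta: "\<theta> \<in> T" for \<theta>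
  proof (rule ccontr)
    assume neg: "\<not> ?thesis"
    obtain r where r: "0 \<le> r" "r < 1" "l \<le> cmod (u (of_real r * cis \<theta>))"
      using theta s by (auto simp: T_def E_def)
    have "cmod (u (of_real r * cis \<theta>)) \<le> l / 2"
    proof (rule radial_bound_of_centered_averages[OF u r(1,2)])
      fix t :: real assume t: "0 \<le> t" "t \<le> pi"
      have "integral {0..t} (\<lambda>s. W (\<theta> + s) + W (\<theta> - s)) \<le> 2 * t * (l / 2)"
      proof (cases "t = 0")
        case False
        then have "integral {\<theta> - t..\<theta> + t} W < l * t" using neg t by (meson not_le order_le_less)
        then show ?thesis using t by (simp add: integral_centered_interval[OF W] mult.commute)
      qed simp
      then show "integral {0..t} (\<lambda>s. cmod (u (cis (\<theta> + s))) + cmod (u (cis (\<theta> - s)))) \<le> 2 * t * (l / 2)"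
        by (simp add: W_def)
    qed
    with r(3) l show False by simp
  qed
  then obtain \<tau> where \<tau>: "\<And>\<theta>. \<theta> \<in> T \<Longrightarrow> 0 < \<tau> \<theta>" "\<And>\<theta>. \<theta> \<in> T \<Longrightarrow> \<tau> \<theta> \<le> pi"
    "\<And>\<theta>. \<theta> \<in> T \<Longrightarrow> l * \<tau> \<theta> \<le> integral {\<theta> - \<tau> \<theta>..\<theta> + \<tau> \<theta>} W" by metis
  obtain K where K: "K \<subseteq> T" "finite K" "T \<subseteq> (\<Union>\<theta>\<in>K. ball \<theta> (\<tau> \<theta>))"
    by (rule compactE_image[OF T, of T "\<lambda>\<theta>. ball \<theta> (\<tau> \<theta>)"]) (use \<tau> in auto)
  have TK: "T \<subseteq> (\<Union>i\<in>K. cball i (\<tau> i))"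
    by (rule order_trans[OF K(3)]) (intro UN_mono order_refl ball_subset_cball)
  obtain C where C: "C \<subseteq> K"
     "pairwise (\<lambda>i j. disjnt (cball i (\<tau> i)) (cball j (\<tau> j))) C" "T \<subseteq> (\<Union>i\<in>C. cball i (5 * \<tau> i))"
    by (rule Vitali_covering_lemma_cballs[OF TK, of pi]) (use K \<tau> in blast)+
  have CT: "C \<subseteq> T" "finite C" using C K finite_subset by auto
  define J where "J i = {i - \<tau> i..i + \<tau> i}" for i
  have dj: "disjnt (J i) (J j)" if "i \<in> C" "j \<in> C" "i \<noteq> j" for i j
    using C(2) that by (auto simp: pairwise_def J_def cball_eq_atLeastAtMost)
  have hasU: "(W has_integral (\<Sum>i\<in>C. integral (J i) W)) (\<Union>i\<in>C. J i)"
  proof (rule has_integral_UN[OF CT(2)])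
    show "(W has_integral integral (J i) W) (J i)" for i
      unfolding J_def using iW by (simp add: integrable_integral)
    show "pairwise (\<lambda>i i'. negligible (J i \<inter> J i')) C"
      using dj by (auto simp: pairwise_def disjnt_def)
  qed
  have "emeasure lborel T \<le> emeasure lborel (\<Union>i\<in>C. cball i (5 * \<tau> i))"
    by (rule emeasure_mono[OF C(3)]) (use CT in auto)
  also have "\<dots> \<le> (\<Sum>i\<in>C. emeasure lborel (cball i (5 * \<tau> i)))"
    by (rule emeasure_subadditive_finite) (use CT in auto)
  also have "\<dots> = (\<Sum>i\<in>C. ennreal (10 * \<tau> i))"
    using CT \<tau>(1) by (intro sum.cong refl) (auto simp: cball_eq_atLeastAtMost less_imp_le)
  also have "\<dots> = ennreal (\<Sum>i\<in>C. 10 * \<tau> i)"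
    using CT \<tau>(1) by (intro sum_ennreal) (auto simp: less_imp_le)
  also have "\<dots> \<le> ennreal (10 / l * (3 * integral {0..2*pi} W))"
  proof (rule ennreal_leI)
    have "(\<Sum>i\<in>C. 10 * \<tau> i) = 10 / l * (\<Sum>i\<in>C. l * \<tau> i)"
      using l by (simp add: sum_distrib_left)
    also have "(\<Sum>i\<in>C. l * \<tau> i) \<le> (\<Sum>i\<in>C. integral (J i) W)"
      using CT \<tau>(3) by (intro sum_mono) (auto simp: J_def)
    also have "\<dots> = integral (\<Union>i\<in>C. J i) W"
      using hasU by (simp add: integral_unique)
    also have "\<dots> \<le> integral {-(2*pi)..4*pi} W"
    proof (rule integral_subset_le)
      show "(\<Union>i\<in>C. J i) \<subseteq> {-(2*pi)..4*pi}"
      proof (safe)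
        fix i x assume i: "i \<in> C" "x \<in> J i"
        then have "i \<in> T" using CT(1) by blast
        then have "\<tau> i \<le> pi" "i \<in> {0..2*pi}" using \<tau>(2) by (simp_all add: T_def)
        then show "x \<in> {-(2*pi)..4*pi}" using i(2) by (auto simp: J_def)
      qed
    qed (use hasU iW W0 in \<open>auto simp: has_integral_integrable\<close>)
    also have "\<dots> = 3 * integral {0..2*pi} W" by (rule integral_three_periods[OF W Wper])
    finally show "(\<Sum>i\<in>C. 10 * \<tau> i) \<le> 10 / l * (3 * integral {0..2*pi} W)"
      using l by (simp add: mult_left_mono divide_right_mono)
  qed
  finally have "emeasure lborel T \<le> ennreal (10 / l * (3 * integral {0..2*pi} W))" .
  then have "emeasure circle_lebesgue E \<le> ennreal (10 / l * (3 * integral {0..2*pi} W)) / ennreal (2 * pi)"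
    unfolding emeasure_circle_lebesgue[OF EB] T_def by (rule divide_right_mono_ennreal)
  also have "\<dots> = ennreal (30 / l * (integral {0..2*pi} W / (2*pi)))"
    using l W0 by (subst divide_ennreal) (auto intro!: integral_nonneg iW mult_nonneg_nonneg simp: field_simps)
  also have "integral {0..2*pi} W / (2*pi) = circle_mean (\<lambda>\<zeta>. cmod (u \<zeta>))"
    using integral_circle_lebesgue[OF continuous_on_norm[OF cu(2)]] by (simp add: W_def[abs_def])
  finally show "emeasure circle_lebesgue E \<le> ennreal (30 / l * circle_mean (\<lambda>\<zeta>. cmod (u \<zeta>)))" .
qed

section \<open>Radial limits\<close>

text \<open>
  Parseval's identity for polynomials, by orthogonality of the constants.
\<close>

lemma mean_square_polynomial:
  "circle_mean (\<lambda>\<zeta>. (cmod (\<Sum>i<N. c i * \<zeta> ^ i))\<^sup>2) = (\<Sum>i<N. (cmod (c i))\<^sup>2)"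
proof (induction N arbitrary: c)
  case (Suc N)
  define q where "q z = z * (\<Sum>i<N. c (Suc i) * z ^ i)" for z
  have q: "q \<in> disc_algebra" "q 0 = 0"
    by (auto simp: q_def[abs_def] disc_algebra_def intro!: continuous_intros holomorphic_intros)
  have "circle_mean (\<lambda>\<zeta>. (cmod (\<Sum>i<Suc N. c i * \<zeta> ^ i))\<^sup>2) = circle_mean (\<lambda>\<zeta>. (cmod (c 0 + q \<zeta>))\<^sup>2)"
    by (simp add: q_def sum.lessThan_Suc_shift sum_distrib_left mult_ac del: sum.lessThan_Suc)
  also have "\<dots> = (cmod (c 0))\<^sup>2 + circle_mean (\<lambda>\<zeta>. (cmod (q \<zeta>))\<^sup>2)"
    by (rule mean_square_const_plus[OF q])
  also have "circle_mean (\<lambda>\<zeta>. (cmod (q \<zeta>))\<^sup>2) = circle_mean (\<lambda>\<zeta>. (cmod (\<Sum>i<N. c (Suc i) * \<zeta> ^ i))\<^sup>2)"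
    by (rule circle_mean_cong) (simp add: q_def norm_mult)
  also have "\<dots> = (\<Sum>i<N. (cmod (c (Suc i)))\<^sup>2)" by (rule Suc.IH)
  finally show ?case by (simp add: sum.lessThan_Suc_shift del: sum.lessThan_Suc)
qed simp

lemma Bessel_inequality:
  assumes f: "f holomorphic_on unit_disc" "h2_norm f \<le> ennreal B" "0 \<le> B"
  shows "(\<Sum>i<N. (cmod (taylor_coeff f i))\<^sup>2) \<le> B\<^sup>2"
proof -
  define a where "a = taylor_coeff f"
  have 1: "(\<Sum>i<N. (cmod (a i) * s ^ i)\<^sup>2) \<le> B\<^sup>2" if s: "0 < s" "s < 1" for s
  proof -
    have "sqrt (\<Sum>i<N. (cmod (a i) * s ^ i)\<^sup>2) \<le> B"
    proof (rule field_le_epsilon)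
      fix e :: real assume e: "0 < e"
      obtain n where n: "N \<le> n" "\<forall>z\<in>cball 0 s. cmod (f z - (\<Sum>i<n. a i * z ^ i)) < e"
        using eventually_happens'[OF sequentially_bot eventually_conj[OF eventually_ge_at_top[of N]
              taylor_uniform_approx[OF f(1) s e]]] by (auto simp: a_def)
      define p where "p z = (\<Sum>i<n. (a i * of_real s ^ i) * z ^ i)" for z :: complex
      have "(\<Sum>i<N. (cmod (a i) * s ^ i)\<^sup>2) \<le> (\<Sum>i<n. (cmod (a i) * s ^ i)\<^sup>2)"
        using n(1) by (intro sum_mono2) auto
      also have "\<dots> = (circle_L2 p)\<^sup>2"
        unfolding circle_L2_power2 p_def mean_square_polynomial
        using s by (simp add: norm_mult norm_power)
      finally have "sqrt (\<Sum>i<N. (cmod (a i) * s ^ i)\<^sup>2) \<le> circle_L2 p"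
        by (rule real_le_lsqrt[OF circle_L2_nonneg])
      also have "\<dots> \<le> circle_L2 (\<lambda>z. f (of_real s * z)) + e"
      proof (rule circle_L2_approx)
        show "continuous_on unit_circle p" unfolding p_def by (intro continuous_intros)
        show "continuous_on unit_circle (\<lambda>z. f (of_real s * z))"
          by (rule disc_algebra_continuous[OF dilation_disc_algebra[OF f(1) s]])
        show "cmod (p z - f (of_real s * z)) \<le> e" if "cmod z = 1" for z
        proof -
          have "of_real s * z \<in> cball 0 s" using that s by (simp add: norm_mult)
          from bspec[OF n(2) this] show ?thesis
            by (simp add: p_def power_mult_distrib norm_minus_commute mult.assoc)
        qed
      qed (use e in simp)
      also have "circle_L2 (\<lambda>z. f (of_real s * z)) \<le> B"
        using f(2) s unfolding h2_norm_le_iff[OF f(3)] by auto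
      finally show "sqrt (\<Sum>i<N. (cmod (a i) * s ^ i)\<^sup>2) \<le> B + e" by simp
    qed
    then show ?thesis by (rule sqrt_le_D)
  qed
  have "((\<lambda>s. \<Sum>i<N. (cmod (a i) * s ^ i)\<^sup>2) \<longlongrightarrow> (\<Sum>i<N. (cmod (a i) * 1 ^ i)\<^sup>2)) (at_left 1)"
    by (intro tendsto_intros)
  moreover have "\<forall>\<^sub>F s in at_left 1. (\<Sum>i<N. (cmod (a i) * s ^ i)\<^sup>2) \<le> B\<^sup>2"
    using eventually_at_left_real[OF zero_less_one] by (rule eventually_mono) (use 1 in auto)
  ultimately have "(\<Sum>i<N. (cmod (a i) * 1 ^ i)\<^sup>2) \<le> B\<^sup>2"
    by (rule tendsto_upperbound) simp
  then show ?thesis by (simp add: a_def)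
qed

text \<open>
  In terms of Taylor coefficients \<open>a i\<close>, the mean square is at most the sum of
  \<open>|a i|\<^sup>2 (1 - \<rho>\<^sup>i)\<^sup>2\<close>, whatever \<open>s\<close> is: the tail is small since the coefficients are square summable, and
  finitely many terms tend to \<open>0\<close> as \<open>\<rho> \<rightarrow> 1\<close>.
\<close>

lemma dilation_L2_close:
  assumes f: "f holomorphic_on unit_disc" "h2_norm f \<le> ennreal B" "0 \<le> B" and e: "0 < e"
  obtains \<rho> where "0 < \<rho>" "\<rho> < 1"
    "\<And>s. 0 < s \<Longrightarrow> s < 1 \<Longrightarrow> circle_L2 (\<lambda>\<zeta>. f (of_real s * \<zeta>) - f (of_real \<rho> * (of_real s * \<zeta>))) \<le> e"
proof -
  define a where "a = taylor_coeff f"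
  have "summable (\<lambda>i. (cmod (a i))\<^sup>2)"
  proof (rule bounded_imp_summable[where B = "B\<^sup>2"])
    show "(\<Sum>i\<le>n. (cmod (a i))\<^sup>2) \<le> B\<^sup>2" for n
      using Bessel_inequality[OF f, of "Suc n"] unfolding a_def lessThan_Suc_atMost .
  qed simp
  then obtain N where N: "\<And>m n. N \<le> m \<Longrightarrow> norm (\<Sum>i=m..<n. (cmod (a i))\<^sup>2) < e\<^sup>2 / 8"
    unfolding summable_Cauchy using e by (meson zero_less_divide_iff zero_less_numeral zero_less_power)
  have "((\<lambda>\<rho>. \<Sum>i<N. (cmod (a i) * (1 - \<rho> ^ i))\<^sup>2) \<longlongrightarrow> (\<Sum>i<N. (cmod (a i) * (1 - 1 ^ i))\<^sup>2)) (at_left (1::real))"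
    by (intro tendsto_intros)
  then have "((\<lambda>\<rho>. \<Sum>i<N. (cmod (a i) * (1 - \<rho> ^ i))\<^sup>2) \<longlongrightarrow> 0) (at_left (1::real))" by simp
  then have "\<forall>\<^sub>F \<rho> in at_left (1::real). (\<Sum>i<N. (cmod (a i) * (1 - \<rho> ^ i))\<^sup>2) < e\<^sup>2 / 8"
    by (rule order_tendstoD) (use e in simp)
  then have "\<forall>\<^sub>F \<rho> in at_left (1::real). \<rho> \<in> {0<..<1} \<and> (\<Sum>i<N. (cmod (a i) * (1 - \<rho> ^ i))\<^sup>2) < e\<^sup>2 / 8"
    by (intro eventually_conj eventually_at_left_real) simp_all
  then obtain \<rho> where \<rho>: "0 < \<rho>" "\<rho> < 1" "(\<Sum>i<N. (cmod (a i) * (1 - \<rho> ^ i))\<^sup>2) < e\<^sup>2 / 8"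
    using eventually_happens'[OF trivial_limit_at_left_real] by (auto simp only: greaterThanLessThan_iff)
  show thesis
  proof (rule that[OF \<rho>(1,2)])
    fix s :: real assume s: "0 < s" "s < 1"
    have e4: "0 < e / 4" using e by simp
    obtain n where n: "N \<le> n" "\<forall>z\<in>cball 0 s. cmod (f z - (\<Sum>i<n. a i * z ^ i)) < e / 4"
      using eventually_happens'[OF sequentially_bot eventually_conj[OF eventually_ge_at_top[of N]
            taylor_uniform_approx[OF f(1) s e4]]] by (auto simp: a_def)
    define p where "p z = (\<Sum>i<n. (a i * of_real (s ^ i * (1 - \<rho> ^ i))) * z ^ i)" for z :: complex
    have \<rho>i: "0 \<le> 1 - \<rho> ^ i" "1 - \<rho> ^ i \<le> 1" "0 \<le> s ^ i" "s ^ i \<le> 1" for i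
      using \<rho> s by (auto simp: power_le_one)
    have "(circle_L2 p)\<^sup>2 = (\<Sum>i<n. (cmod (a i) * (s ^ i * (1 - \<rho> ^ i)))\<^sup>2)"
      unfolding circle_L2_power2 p_def mean_square_polynomial norm_mult norm_of_real
      using \<rho>i by (simp add: abs_mult)
    also have "\<dots> = (\<Sum>i<N. (cmod (a i) * (s ^ i * (1 - \<rho> ^ i)))\<^sup>2) + (\<Sum>i=N..<n. (cmod (a i) * (s ^ i * (1 - \<rho> ^ i)))\<^sup>2)"
      using n(1) by (simp add: lessThan_atLeast0 sum.atLeastLessThan_concat)
    also have "\<dots> \<le> (\<Sum>i<N. (cmod (a i) * (1 - \<rho> ^ i))\<^sup>2) + (\<Sum>i=N..<n. (cmod (a i))\<^sup>2)"
    proof (intro add_mono sum_mono power_mono)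
      fix i
      show "cmod (a i) * (s ^ i * (1 - \<rho> ^ i)) \<le> cmod (a i) * (1 - \<rho> ^ i)"
        using \<rho>i[of i] by (intro mult_left_mono mult_left_le_one_le) auto
      have "s ^ i * (1 - \<rho> ^ i) \<le> 1 * 1" using \<rho>i[of i] by (intro mult_mono) auto
      then show "cmod (a i) * (s ^ i * (1 - \<rho> ^ i)) \<le> cmod (a i)"
        using mult_left_mono[of "s ^ i * (1 - \<rho> ^ i)" 1 "cmod (a i)"] by simp
    qed (use \<rho>i in auto)
    also have "\<dots> \<le> e\<^sup>2 / 8 + e\<^sup>2 / 8"
      using \<rho>(3) N[of N n] by (intro add_mono) (auto simp: less_imp_le)
    also have "\<dots> = (e / 2)\<^sup>2" by (simp add: power2_eq_square)
    finally have p: "circle_L2 p \<le> e / 2" by (rule power2_le_imp_le) (use e in simp)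
    have cont: "continuous_on unit_circle (\<lambda>\<zeta>. f (of_real t * \<zeta>))" if "0 < t" "t < 1" for t
      by (rule disc_algebra_continuous[OF dilation_disc_algebra[OF f(1) that]])
    have "\<rho> * s < 1 * 1" using \<rho> s by (intro mult_strict_mono) auto
    then have "continuous_on unit_circle (\<lambda>\<zeta>. f (of_real (\<rho> * s) * \<zeta>))"
      using \<rho> s by (intro cont) auto
    then have cont2: "continuous_on unit_circle (\<lambda>\<zeta>. f (of_real \<rho> * (of_real s * \<zeta>)))"
      by (simp add: mult.assoc)
    have "circle_L2 (\<lambda>\<zeta>. f (of_real s * \<zeta>) - f (of_real \<rho> * (of_real s * \<zeta>))) \<le> circle_L2 p + e / 2"
    proof (rule circle_L2_approx)
      show "continuous_on unit_circle p" unfolding p_def by (intro continuous_intros)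
      fix z :: complex assume z: "cmod z = 1"
      have b: "of_real s * z \<in> cball 0 s" using z s by (simp add: norm_mult)
      have b': "of_real \<rho> * (of_real s * z) \<in> cball 0 s"
        using z s \<rho> by (simp add: norm_mult mult_left_le_one_le)
      have "p z = (\<Sum>i<n. a i * (of_real s * z) ^ i) - (\<Sum>i<n. a i * (of_real \<rho> * (of_real s * z)) ^ i)"
        by (simp add: p_def power_mult_distrib algebra_simps sum_subtractf[symmetric])
      then have "f (of_real s * z) - f (of_real \<rho> * (of_real s * z)) - p z =
         (f (of_real s * z) - (\<Sum>i<n. a i * (of_real s * z) ^ i)) -
         (f (of_real \<rho> * (of_real s * z)) - (\<Sum>i<n. a i * (of_real \<rho> * (of_real s * z)) ^ i))"
        by simp
      also have "cmod \<dots> \<le> e / 4 + e / 4"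
        by (rule order_trans[OF norm_triangle_ineq4])
           (intro add_mono less_imp_le[OF bspec[OF n(2) b]] less_imp_le[OF bspec[OF n(2) b']])
      finally show "cmod (f (of_real s * z) - f (of_real \<rho> * (of_real s * z)) - p z) \<le> e / 2" by simp
    qed (use e cont[OF s] cont2 in \<open>auto intro!: continuous_intros\<close>)
    with p show "circle_L2 (\<lambda>\<zeta>. f (of_real s * \<zeta>) - f (of_real \<rho> * (of_real s * \<zeta>))) \<le> e" by simp
  qed
qed

text \<open>
  Dilate by \<open>q < 1\<close> and restrict to radii at most \<open>q\<close>: as \<open>q \<rightarrow> 1\<close>, these exceptional sets increase to the one
  for all radii below \<open>1\<close>.
\<close>

lemma radial_maximal_weak_type_disc:
  assumes f: "f holomorphic_on unit_disc" and l: "0 < l"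
    and A: "\<And>s. 0 < s \<Longrightarrow> s < 1 \<Longrightarrow> circle_L2 (\<lambda>\<zeta>. f (of_real s * \<zeta>)) \<le> A"
  obtains W where "W \<in> sets circle_lebesgue" "emeasure circle_lebesgue W \<le> ennreal (30 / l * A)"
    "\<And>\<zeta> r. cmod \<zeta> = 1 \<Longrightarrow> \<zeta> \<notin> W \<Longrightarrow> 0 \<le> r \<Longrightarrow> r < 1 \<Longrightarrow> cmod (f (of_real r * \<zeta>)) < l"
proof -
  define q where "q n = 1 - inverse (real (Suc (Suc n)))" for n
  have q: "0 < q n" "q n < 1" "q n \<le> q (Suc n)" for n by (auto simp: q_def field_simps)
  have q_lim: "q \<longlonglongrightarrow> 1"
    using tendsto_diff[OF tendsto_const LIMSEQ_Suc[OF LIMSEQ_inverse_real_of_nat], of 1] by (simp add: q_def[abs_def])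
  define E where "E n = {\<zeta> \<in> unit_circle. \<exists>r\<in>{0..q n}. l \<le> cmod (f (of_real (q n) * (of_real r * \<zeta>)))}" for n
  have D: "(\<lambda>z. f (of_real (q n) * z)) \<in> disc_algebra" for n by (rule dilation_disc_algebra[OF f q(1,2)])
  have EB: "E n \<in> sets circle_borel" for n
    unfolding E_def by (rule radial_maximal_weak_type(1)[OF D l less_imp_le[OF q(1)] q(2)])
  have E: "E n \<in> sets circle_lebesgue" for n
    using EB unfolding circle_lebesgue_def by (rule sets_completionI_sets)
  have Em: "emeasure circle_lebesgue (E n) \<le> ennreal (30 / l * A)" for n
  proof -
    have "emeasure circle_lebesgue (E n) \<le> ennreal (30 / l * circle_mean (\<lambda>\<zeta>. cmod (f (of_real (q n) * \<zeta>))))"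
      unfolding E_def by (rule radial_maximal_weak_type(2)[OF D l less_imp_le[OF q(1)] q(2)])
    also have "\<dots> \<le> ennreal (30 / l * A)"
      using l by (intro ennreal_leI mult_left_mono order_trans[OF circle_mean_le_L2 A] q
          disc_algebra_continuous[OF D]) auto
    finally show ?thesis .
  qed
  have "incseq E"
  proof (rule incseq_SucI, rule subsetI)
    fix n \<zeta> assume "\<zeta> \<in> E n"
    then obtain r where r: "cmod \<zeta> = 1" "0 \<le> r" "r \<le> q n" "l \<le> cmod (f (of_real (q n) * (of_real r * \<zeta>)))"
      by (auto simp: E_def)
    define r' where "r' = q n * r / q (Suc n)"
    have "r' \<le> q (Suc n) * r / q (Suc n)" unfolding r'_def
      by (intro divide_right_mono mult_right_mono q(3) r(2) less_imp_le[OF q(1)])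
    also have "\<dots> = r" using q(1)[of "Suc n"] by simp
    finally have "r' \<in> {0..q (Suc n)}" using r q(3)[of n] q(1)[of n] q(1)[of "Suc n"] by (auto simp: r'_def)
    moreover have eq: "complex_of_real (q n) * (of_real r * \<zeta>) = of_real (q (Suc n)) * (of_real r' * \<zeta>)"
      using q(1)[of "Suc n"] by (simp add: r'_def)
    moreover have "\<zeta> \<in> unit_circle" using r(1) by simp
    ultimately show "\<zeta> \<in> E (Suc n)" using r(4) unfolding E_def eq by blast
  qed
  show thesis
  proof (rule that[of "\<Union>n. E n"])
    show "(\<Union>n. E n) \<in> sets circle_lebesgue" using E by blast
    have "emeasure circle_lebesgue (\<Union>n. E n) = (SUP n. emeasure circle_lebesgue (E n))"
      by (rule SUP_emeasure_incseq[symmetric]) (use E \<open>incseq E\<close> in auto)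
    also have "\<dots> \<le> ennreal (30 / l * A)" by (rule SUP_least) (rule Em)
    finally show "emeasure circle_lebesgue (\<Union>n. E n) \<le> ennreal (30 / l * A)" .
    fix \<zeta> :: complex and r :: real assume z: "cmod \<zeta> = 1" "\<zeta> \<notin> (\<Union>n. E n)" and r: "0 \<le> r" "r < 1"
    have "(\<lambda>n. q n * q n) \<longlonglongrightarrow> 1 * 1" by (intro tendsto_mult q_lim)
    then have "\<forall>\<^sub>F n in sequentially. r < q n * q n" using r by (intro order_tendstoD) auto
    then obtain n where n: "r < q n * q n" using eventually_happens'[OF sequentially_bot] by blast
    have mem: "r / q n \<in> {0..q n}" using n r q(1)[of n] by (simp add: divide_le_eq less_imp_le)
    have eq: "complex_of_real (q n) * (of_real (r / q n) * \<zeta>) = of_real r * \<zeta>"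
      using q(1)[of n] by simp
    show "cmod (f (of_real r * \<zeta>)) < l"
    proof (rule ccontr)
      assume "\<not> cmod (f (of_real r * \<zeta>)) < l"
      then have "l \<le> cmod (f (of_real (q n) * (of_real (r / q n) * \<zeta>)))" unfolding eq by simp
      then have "\<zeta> \<in> E n" unfolding E_def using mem z(1) by (intro CollectI conjI bexI[of _ "r / q n"]) simp_all
      with z(2) show False by blast
    qed
  qed
qed

text \<open>
  The dilation \<open>f (\<rho> z)\<close> is continuous up to the circle and has no oscillation there; the maximal
  inequality controls the difference \<open>f z - f (\<rho> z)\<close>, which is small in mean square.
\<close>

lemma radial_oscillation_small_outside:
  assumes f: "f holomorphic_on unit_disc" "h2_norm f \<le> ennreal B" "0 \<le> B" and l: "0 < l" and d: "0 < d"
  obtains W where "W \<in> sets circle_lebesgue" "emeasure circle_lebesgue W \<le> ennreal d"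
    "\<And>\<zeta>. cmod \<zeta> = 1 \<Longrightarrow> \<zeta> \<notin> W \<Longrightarrow> \<exists>r0<1. \<forall>r r'. r0 < r \<longrightarrow> r < 1 \<longrightarrow> r0 < r' \<longrightarrow> r' < 1 \<longrightarrow>
       cmod (f (of_real r * \<zeta>) - f (of_real r' * \<zeta>)) \<le> 3 * l"
proof -
  \<comment> \<open>the constant of the maximal inequality then yields exactly \<open>d\<close>\<close>
  define A where "A = d * l / 30"
  have A: "0 < A" "30 / l * A = d" using l d by (auto simp: A_def)
  obtain \<rho> where \<rho>: "0 < \<rho>" "\<rho> < 1"
    "\<And>s. 0 < s \<Longrightarrow> s < 1 \<Longrightarrow> circle_L2 (\<lambda>\<zeta>. f (of_real s * \<zeta>) - f (of_real \<rho> * (of_real s * \<zeta>))) \<le> A"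
    by (rule dilation_L2_close[OF f A(1)]) blast
  define g where "g z = f z - f (of_real \<rho> * z)" for z
  have fr: "(\<lambda>z. f (of_real \<rho> * z)) \<in> disc_algebra" by (rule dilation_disc_algebra[OF f(1) \<rho>(1,2)])
  then have g: "g holomorphic_on unit_disc"
    unfolding g_def[abs_def] by (intro holomorphic_intros f) (simp add: disc_algebra_def)
  obtain W where W: "W \<in> sets circle_lebesgue" "emeasure circle_lebesgue W \<le> ennreal (30 / l * A)"
    "\<And>\<zeta> r. cmod \<zeta> = 1 \<Longrightarrow> \<zeta> \<notin> W \<Longrightarrow> 0 \<le> r \<Longrightarrow> r < 1 \<Longrightarrow> cmod (g (of_real r * \<zeta>)) < l"
    by (rule radial_maximal_weak_type_disc[OF g l, of A]) (use \<rho>(3) in \<open>auto simp: g_def\<close>)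
  show thesis
  proof (rule that[OF W(1)])
    show "emeasure circle_lebesgue W \<le> ennreal d" using W(2) A(2) by simp
    fix \<zeta> :: complex assume z: "cmod \<zeta> = 1" "\<zeta> \<notin> W"
    have "continuous_on {0..1} (\<lambda>r. f (of_real \<rho> * (of_real r * \<zeta>)))"
      by (rule continuous_on_compose2[OF disc_algebra_continuous(1)[OF fr]])
         (use z in \<open>auto intro!: continuous_intros simp: norm_mult\<close>)
    then have "uniformly_continuous_on {0..1} (\<lambda>r. f (of_real \<rho> * (of_real r * \<zeta>)))"
      by (rule compact_uniformly_continuous) simp
    then obtain \<delta> where \<delta>: "0 < \<delta>" "\<And>r r'. r \<in> {0..1} \<Longrightarrow> r' \<in> {0..1} \<Longrightarrow> dist r' r < \<delta> \<Longrightarrow>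
        dist (f (of_real \<rho> * (of_real r' * \<zeta>))) (f (of_real \<rho> * (of_real r * \<zeta>))) < l"
      unfolding uniformly_continuous_on_def using l by meson
    show "\<exists>r0<1. \<forall>r r'. r0 < r \<longrightarrow> r < 1 \<longrightarrow> r0 < r' \<longrightarrow> r' < 1 \<longrightarrow>
       cmod (f (of_real r * \<zeta>) - f (of_real r' * \<zeta>)) \<le> 3 * l"
    proof (intro exI[of _ "max 0 (1 - \<delta>)"] conjI allI impI)
      fix r r' assume r: "max 0 (1 - \<delta>) < r" "r < 1" "max 0 (1 - \<delta>) < r'" "r' < 1"
      have "dist (f (of_real \<rho> * (of_real r * \<zeta>))) (f (of_real \<rho> * (of_real r' * \<zeta>))) < l"
        by (rule \<delta>(2)) (use r in \<open>auto simp: dist_real_def\<close>)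
      moreover have "f (of_real r * \<zeta>) - f (of_real r' * \<zeta>) = g (of_real r * \<zeta>) - g (of_real r' * \<zeta>) +
          (f (of_real \<rho> * (of_real r * \<zeta>)) - f (of_real \<rho> * (of_real r' * \<zeta>)))"
        by (simp add: g_def)
      moreover have "cmod (g (of_real r * \<zeta>)) < l" "cmod (g (of_real r' * \<zeta>)) < l"
        using W(3)[OF z] r by auto
      ultimately show "cmod (f (of_real r * \<zeta>) - f (of_real r' * \<zeta>)) \<le> 3 * l"
        using norm_triangle_ineq[of "g (of_real r * \<zeta>) - g (of_real r' * \<zeta>)"
            "f (of_real \<rho> * (of_real r * \<zeta>)) - f (of_real \<rho> * (of_real r' * \<zeta>))"]
          norm_triangle_ineq4[of "g (of_real r * \<zeta>)" "g (of_real r' * \<zeta>)"]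
        by (simp add: dist_norm)
    qed (use \<delta> in simp)
  qed
qed

lemma oscillation_imp_limit_at_left:
  fixes h :: "real \<Rightarrow> complex"
  assumes "\<And>e. 0 < e \<Longrightarrow> \<exists>r0<1. \<forall>r r'. r0 < r \<longrightarrow> r < 1 \<longrightarrow> r0 < r' \<longrightarrow> r' < 1 \<longrightarrow> cmod (h r - h r') \<le> e"
  shows "\<exists>L. (h \<longlongrightarrow> L) (at_left 1)"
proof -
  define q where "q n = 1 - inverse (real (Suc n))" for n
  have q: "q n < 1" for n by (simp add: q_def)
  have q_lim: "q \<longlonglongrightarrow> 1"
    using tendsto_diff[OF tendsto_const LIMSEQ_inverse_real_of_nat, of 1] by (simp add: q_def[abs_def])
  have ev: "\<exists>N. \<forall>n\<ge>N. r0 < q n" if "r0 < 1" for r0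
    using order_tendstoD(1)[OF q_lim that] by (simp add: eventually_sequentially)
  have "Cauchy (\<lambda>n. h (q n))"
  proof (rule CauchyI)
    fix e :: real assume "0 < e"
    then obtain r0 where r0: "r0 < 1" "\<And>r r'. r0 < r \<Longrightarrow> r < 1 \<Longrightarrow> r0 < r' \<Longrightarrow> r' < 1 \<Longrightarrow> cmod (h r - h r') \<le> e / 2"
      using assms[of "e / 2"] by auto
    obtain N where "\<And>n. n \<ge> N \<Longrightarrow> r0 < q n" using ev[OF r0(1)] by blast
    then have "norm (h (q m) - h (q n)) < e" if "m \<ge> N" "n \<ge> N" for m n
      using r0(2)[of "q m" "q n"] q that \<open>0 < e\<close> by fastforce
    then show "\<exists>M. \<forall>m\<ge>M. \<forall>n\<ge>M. norm (h (q m) - h (q n)) < e" by blast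
  qed
  then obtain L where L: "(\<lambda>n. h (q n)) \<longlonglongrightarrow> L" by (auto simp: Cauchy_convergent_iff convergent_def)
  have "(h \<longlongrightarrow> L) (at_left 1)"
  proof (rule tendstoI)
    fix e :: real assume "0 < e"
    then obtain r0 where r0: "r0 < 1" "\<And>r r'. r0 < r \<Longrightarrow> r < 1 \<Longrightarrow> r0 < r' \<Longrightarrow> r' < 1 \<Longrightarrow> cmod (h r - h r') \<le> e / 2"
      using assms[of "e / 2"] by auto
    obtain N where N: "\<And>n. n \<ge> N \<Longrightarrow> r0 < q n" using ev[OF r0(1)] by blast
    have "dist (h r) L < e" if r: "r0 < r" "r < 1" for r
    proof -
      have "(\<lambda>n. cmod (h r - h (q n))) \<longlonglongrightarrow> cmod (h r - L)" by (intro tendsto_intros L)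
      then have "cmod (h r - L) \<le> e / 2"
        by (rule LIMSEQ_le_const2) (use N r0(2) r q in blast)
      then show ?thesis using \<open>0 < e\<close> by (simp add: dist_norm)
    qed
    then show "\<forall>\<^sub>F r in at_left 1. dist (h r) L < e"
      using r0(1) by (auto simp: eventually_at_left[OF r0(1)])
  qed
  then show ?thesis by blast
qed

text \<open>
  The set where the radial oscillation exceeds a fixed size is contained in sets of arbitrarily small
  measure, hence null; the completeness of the measure makes it measurable.
\<close>

theorem Fatou_radial_limits:
  assumes f: "f holomorphic_on unit_disc" "h2_norm f < \<infinity>"
  obtains N where "N \<in> null_sets circle_lebesgue"
    "\<And>\<zeta>. cmod \<zeta> = 1 \<Longrightarrow> \<zeta> \<notin> N \<Longrightarrow> \<exists>L. ((\<lambda>r. f (of_real r * \<zeta>)) \<longlongrightarrow> L) (at_left 1)"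
proof -
  define B where "B = enn2real (h2_norm f)"
  have B: "h2_norm f \<le> ennreal B" "0 \<le> B" using f(2) by (auto simp: B_def)
  define small where "small \<zeta> m \<longleftrightarrow> (\<exists>r0<1. \<forall>r r'. r0 < r \<longrightarrow> r < 1 \<longrightarrow> r0 < r' \<longrightarrow> r' < 1 \<longrightarrow>
       cmod (f (of_real r * \<zeta>) - f (of_real r' * \<zeta>)) \<le> 3 * inverse (real (Suc m)))" for \<zeta> :: complex and m
  define bad where "bad m = {\<zeta> \<in> unit_circle. \<not> small \<zeta> m}" for m
  have "bad m \<in> null_sets circle_lebesgue" for m
  proof -
    have "\<exists>W. W \<in> sets circle_lebesgue \<and> emeasure circle_lebesgue W \<le> ennreal (inverse (real (Suc k))) \<and> bad m \<subseteq> W" for k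
    proof -
      obtain W where "W \<in> sets circle_lebesgue" "emeasure circle_lebesgue W \<le> ennreal (inverse (real (Suc k)))"
        "\<And>\<zeta>. cmod \<zeta> = 1 \<Longrightarrow> \<zeta> \<notin> W \<Longrightarrow> small \<zeta> m"
        unfolding small_def
        by (rule radial_oscillation_small_outside[OF f(1) B, of "inverse (real (Suc m))" "inverse (real (Suc k))"]) auto
      then show ?thesis by (intro exI[of _ W]) (auto simp: bad_def)
    qed
    then obtain W where W: "\<And>k. W k \<in> sets circle_lebesgue"
      "\<And>k. emeasure circle_lebesgue (W k) \<le> ennreal (inverse (real (Suc k)))" "\<And>k. bad m \<subseteq> W k" by metis
    have S: "(\<Inter>k. W k) \<in> sets circle_lebesgue" using W(1) by (intro sets.countable_INT) auto
    have "emeasure circle_lebesgue (\<Inter>k. W k) \<le> ennreal (inverse (real (Suc k)))" for k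
      by (rule order_trans[OF emeasure_mono W(2)[of k]]) (use W(1) in auto)
    moreover have "(\<lambda>k. ennreal (inverse (real (Suc k)))) \<longlonglongrightarrow> ennreal 0"
      by (intro tendsto_ennrealI LIMSEQ_inverse_real_of_nat)
    ultimately have "emeasure circle_lebesgue (\<Inter>k. W k) \<le> ennreal 0"
      by (intro LIMSEQ_le_const) auto
    then have "(\<Inter>k. W k) \<in> null_sets circle_lebesgue" using S by (auto simp: null_sets_def)
    then show ?thesis unfolding circle_lebesgue_def
      by (rule null_sets_completion_subset[rotated]) (use W(3) in blast)
  qed
  then have N: "(\<Union>m. bad m) \<in> null_sets circle_lebesgue" by (rule null_sets_UN)
  show thesis
  proof (rule that[OF N])
    fix \<zeta> :: complex assume z: "cmod \<zeta> = 1" "\<zeta> \<notin> (\<Union>m. bad m)"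
    then have sm: "small \<zeta> m" for m by (auto simp: bad_def)
    show "\<exists>L. ((\<lambda>r. f (of_real r * \<zeta>)) \<longlongrightarrow> L) (at_left 1)"
    proof (rule oscillation_imp_limit_at_left)
      fix e :: real assume "0 < e"
      then obtain m where m: "inverse (real (Suc m)) < e / 3" using reals_Archimedean[of "e / 3"] by auto
      from sm[of m] obtain r0 where "r0 < 1" "\<And>r r'. r0 < r \<Longrightarrow> r < 1 \<Longrightarrow> r0 < r' \<Longrightarrow> r' < 1 \<Longrightarrow>
       cmod (f (of_real r * \<zeta>) - f (of_real r' * \<zeta>)) \<le> 3 * inverse (real (Suc m))"
        unfolding small_def by blast
      moreover have "3 * inverse (real (Suc m)) \<le> e" using m by simp
      ultimately show "\<exists>r0<1. \<forall>r r'. r0 < r \<longrightarrow> r < 1 \<longrightarrow> r0 < r' \<longrightarrow> r' < 1 \<longrightarrow>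
          cmod (f (of_real r * \<zeta>) - f (of_real r' * \<zeta>)) \<le> e" by (meson order_trans)
    qed
  qed
qed

text \<open>
  Off a null set, \<open>|f| > t\<close> for the radial limit forces \<open>|f (r \<zeta>)| > s\<close> for all \<open>r\<close> close to \<open>1\<close>, so the superlevel
  set lies in the limit inferior of interior superlevel sets. Points without a radial limit, where
  \<open>radial_limit\<close> takes an unspecified value, lie in the null set.
\<close>

lemma emeasure_radial_limit_superlevel_le:
  assumes f: "f holomorphic_on unit_disc" "h2_norm f < \<infinity>" and t: "s \<le> t"
    and d: "\<And>r. 0 < r \<Longrightarrow> r < 1 \<Longrightarrow> emeasure circle_lebesgue {\<zeta> \<in> unit_circle. s < cmod (f (of_real r * \<zeta>))} \<le> d"
  shows "emeasure circle_lebesgue {\<zeta> \<in> unit_circle. t < cmod (radial_limit f \<zeta>)} \<le> d"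
proof -
  obtain N where N: "N \<in> null_sets circle_lebesgue"
    "\<And>\<zeta>. cmod \<zeta> = 1 \<Longrightarrow> \<zeta> \<notin> N \<Longrightarrow> \<exists>L. ((\<lambda>r. f (of_real r * \<zeta>)) \<longlongrightarrow> L) (at_left 1)"
    by (rule Fatou_radial_limits[OF f]) blast
  define q where "q n = 1 - inverse (real (Suc (Suc n)))" for n
  have q: "0 < q n" "q n < 1" for n by (auto simp: q_def field_simps)
  have q_lim: "q \<longlonglongrightarrow> 1"
    using tendsto_diff[OF tendsto_const LIMSEQ_Suc[OF LIMSEQ_inverse_real_of_nat], of 1] by (simp add: q_def[abs_def])
  define X where "X n = {\<zeta> \<in> unit_circle. s < cmod (f (of_real (q n) * \<zeta>))}" for n
  define Y where "Y m = (\<Inter>n\<in>{m..}. X n)" for m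
  have X: "X n \<in> sets circle_lebesgue" for n unfolding X_def
    by (intro sets_superlevel_circle continuous_intros disc_algebra_continuous dilation_disc_algebra f q)
  have Y: "Y m \<in> sets circle_lebesgue" for m unfolding Y_def using X by (intro sets.countable_INT') auto
  have sub: "{\<zeta> \<in> unit_circle. t < cmod (radial_limit f \<zeta>)} \<subseteq> (\<Union>m. Y m) \<union> N"
  proof
    fix \<zeta> assume z: "\<zeta> \<in> {\<zeta> \<in> unit_circle. t < cmod (radial_limit f \<zeta>)}"
    show "\<zeta> \<in> (\<Union>m. Y m) \<union> N"
    proof (cases "\<zeta> \<in> N")
      case False
      with z N(2) obtain L where L: "((\<lambda>r. f (of_real r * \<zeta>)) \<longlongrightarrow> L) (at_left 1)" by auto
      then have "radial_limit f \<zeta> = L" unfolding radial_limit_def by (intro tendsto_Lim) simp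
      then have "t < cmod L" using z by simp
      have "filterlim q (at_left 1) sequentially"
        using q q_lim by (intro tendsto_imp_filterlim_at_left) auto
      from filterlim_compose[OF L this] have "(\<lambda>n. cmod (f (of_real (q n) * \<zeta>))) \<longlonglongrightarrow> cmod L"
        by (intro tendsto_norm)
      then have "\<forall>\<^sub>F n in sequentially. s < cmod (f (of_real (q n) * \<zeta>))"
        using \<open>t < cmod L\<close> t by (intro order_tendstoD) auto
      then obtain m where "\<And>n. n \<ge> m \<Longrightarrow> s < cmod (f (of_real (q n) * \<zeta>))" by (auto simp: eventually_sequentially)
      then have "\<zeta> \<in> Y m" using z by (auto simp: Y_def X_def)
      then show ?thesis by blast
    qed simp
  qed
  have "emeasure circle_lebesgue {\<zeta> \<in> unit_circle. t < cmod (radial_limit f \<zeta>)} \<le> emeasure circle_lebesgue ((\<Union>m. Y m) \<union> N)"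
    by (rule emeasure_mono[OF sub]) (use Y N(1) in \<open>auto dest: null_setsD2\<close>)
  also have "\<dots> = emeasure circle_lebesgue (\<Union>m. Y m)"
    by (rule emeasure_Un_null_set) (use Y N(1) in auto)
  also have "\<dots> = (SUP m. emeasure circle_lebesgue (Y m))"
    by (rule SUP_emeasure_incseq[symmetric]) (use Y in \<open>auto simp: Y_def incseq_def\<close>)
  also have "\<dots> \<le> d"
  proof (rule SUP_least)
    fix m
    have "emeasure circle_lebesgue (Y m) \<le> emeasure circle_lebesgue (X m)"
      by (rule emeasure_mono) (use X in \<open>auto simp: Y_def\<close>)
    also have "\<dots> \<le> d" unfolding X_def by (rule d[OF q])
    finally show "emeasure circle_lebesgue (Y m) \<le> d" .
  qed
  finally show ?thesis .
qed

section \<open>Superlevel sets on the boundary\<close>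

lemma h2_norm_bounded_finite:
  assumes "f holomorphic_on unit_disc" "\<And>z. cmod z < 1 \<Longrightarrow> cmod (f z) \<le> C" "0 \<le> C"
  shows "h2_norm f < \<infinity>"
proof -
  have "h2_norm f \<le> ennreal C"
    unfolding h2_norm_le_iff[OF assms(3)]
    by (intro ballI circle_L2_le_sup disc_algebra_continuous dilation_disc_algebra assms) (auto simp: norm_mult)
  then show ?thesis by (simp add: order.strict_trans1)
qed

lemma ennreal_pos_real_below:
  fixes x :: ennreal
  assumes x: "0 < x"
  obtains d where "0 < d" "ennreal d < x"
proof -
  obtain y where y: "0 < y" "y < x" using dense[OF x] by blast
  have "y < top" by (rule order.strict_trans2[OF y(2) top_greatest])
  then have "0 < enn2real y" "ennreal (enn2real y) = y" using y(1) by (simp_all add: enn2real_positive_iff)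
  then show thesis using y(2) by (intro that[of "enn2real y"]) simp_all
qed

lemma condition_L_imp_boundary_superlevel_vanishes:
  assumes phi: "\<phi> holomorphic_on unit_disc" "\<phi> ` unit_disc \<subseteq> unit_disc" and L: "condition_L \<phi>" and R: "R < 1"
  shows "((\<lambda>t::real. SUP a\<in>{a \<in> unit_disc. cmod (\<phi> a) \<le> R}.
           emeasure circle_lebesgue {\<zeta> \<in> unit_circle. cmod (radial_limit (\<phi> \<circ> \<sigma> a) \<zeta>) > t}) \<longlongrightarrow> 0) (at_left 1)"
    (is "(?S \<longlongrightarrow> 0) _")
proof (rule order_tendstoI)
  fix x :: ennreal assume x: "0 < x"
  obtain d where d: "0 < d" "ennreal d < x" by (rule ennreal_pos_real_below[OF x])
  obtain s where s: "s < 1" and small: "\<And>K. K \<in> disc_map \<Longrightarrow> cmod (\<phi> (K 0)) \<le> R \<Longrightarrow>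
       emeasure circle_lebesgue {\<zeta> \<in> unit_circle. s < cmod (\<phi> (K \<zeta>))} \<le> ennreal d"
    by (rule condition_L_superlevel_small[OF phi L R d(1)]) blast
  have "?S t \<le> ennreal d" if t: "s \<le> t" for t
  proof (rule SUP_least)
    fix a assume a: "a \<in> {a \<in> unit_disc. cmod (\<phi> a) \<le> R}"
    then have a1: "cmod a < 1" by simp
    have hol: "(\<phi> \<circ> \<sigma> a) holomorphic_on unit_disc"
      by (rule holomorphic_on_compose_gen[OF disc_involution_holomorphic[OF a1] phi(1)])
         (use disc_involution_bounds[OF a1] in auto)
    show "emeasure circle_lebesgue {\<zeta> \<in> unit_circle. t < cmod (radial_limit (\<phi> \<circ> \<sigma> a) \<zeta>)} \<le> ennreal d"
    proof (rule emeasure_radial_limit_superlevel_le[OF hol _ t])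
      show "h2_norm (\<phi> \<circ> \<sigma> a) < \<infinity>"
        by (rule h2_norm_bounded_finite[OF hol, of 1])
           (auto intro!: less_imp_le self_map_less_1[OF phi(2)] disc_involution_bounds[OF a1])
      fix r :: real assume "0 < r" "r < 1"
      then show "emeasure circle_lebesgue {\<zeta> \<in> unit_circle. s < cmod ((\<phi> \<circ> \<sigma> a) (of_real r * \<zeta>))} \<le> ennreal d"
        using small[OF translated_dilation_disc_map[OF a1]] a by (simp add: disc_involution_0)
    qed
  qed
  then have "?S t < x" if "s < t" for t
    using that by (intro order.strict_trans1[OF _ d(2)]) (simp add: less_imp_le)
  then show "\<forall>\<^sub>F t in at_left 1. ?S t < x"
    using s by (auto simp: eventually_at_left[OF s])
qed simp

theorem theorem2:
  fixes \<phi> :: "complex \<Rightarrow> complex"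
  assumes "\<phi> holomorphic_on unit_disc"
    and "\<phi> ` unit_disc \<subseteq> unit_disc"
  shows "(condition_L \<phi> \<longrightarrow>
           (\<forall>R::real. 0 < R \<and> R < 1 \<longrightarrow>
             ((\<lambda>t::real. SUP a\<in>{a \<in> unit_disc. cmod (\<phi> a) \<le> R}.
                 emeasure circle_lebesgue
                   {\<zeta> \<in> unit_circle. cmod (radial_limit (\<phi> \<circ> \<sigma> a) \<zeta>) > t})
               \<longlongrightarrow> 0) (at_left 1)))
       \<and> (compact_operator BMOA bmoa_dist (composition_operator \<phi>) \<longleftrightarrow> condition_L \<phi>)"
proof (intro conjI impI allI iffI)
  fix R :: real assume "condition_L \<phi>" "0 < R \<and> R < 1"
  then show "((\<lambda>t::real. SUP a\<in>{a \<in> unit_disc. cmod (\<phi> a) \<le> R}.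
      emeasure circle_lebesgue {\<zeta> \<in> unit_circle. cmod (radial_limit (\<phi> \<circ> \<sigma> a) \<zeta>) > t}) \<longlongrightarrow> 0) (at_left 1)"
    by (intro condition_L_imp_boundary_superlevel_vanishes[OF assms]) simp_all
next
  show "compact_operator BMOA bmoa_dist (composition_operator \<phi>)" if "condition_L \<phi>"
    by (rule condition_L_imp_compact[OF assms that])
  show "condition_L \<phi>" if "compact_operator BMOA bmoa_dist (composition_operator \<phi>)"
    by (rule compact_imp_condition_L[OF assms that])
qed

end
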